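(* Let $s\ge4$ and $\nu\ge1$, and let $\mathbb{X}=\{P_1,\dots,P_s\}\subseteq\mathbb{P}^2$ be a set of $s$ distinct $K$-rational points which lie on a non-singular conic $\mathcal{C}=\mathcal{Z}^+(C)$. Then we have $$\Omega^3_{R_{\nu\mathbb{X}}/K}\cong(S/\mathfrak{M}I_{(\nu-1)\mathbb{X}})(-3).$$ In particular, for all $i\in\mathbb{N}$, we have $\mathrm{HF}_{\Omega^3_{R_{\nu\mathbb{X}}/K}}(i)=\mathrm{HF}_{S/\mathfrak{M}I_{(\nu-1)\mathbb{X}}}(i-3)$.
   Context: $K$ is a field of characteristic zero, $S=K[X_0,X_1,X_2]$ with the standard grading is the homogeneous coordinate ring of $\mathbb{P}^2$ over $K$, $\mathfrak{M}=\langle X_0,X_1,X_2\rangle$, and $C\in S$ is a quadratic form whose zero locus $\mathcal{Z}^+(C)$ is a non-singular conic. Coordinates are chosen so that no $P_j$ lies on $X_0=0$. With $\wp_j\subseteq S$ the homogeneous vanishing ideal of $P_j$ and $k\ge1$, the fat point scheme $k\mathbb{X}$ has homogeneous vanishing ideal $I_{k\mathbb{X}}=\wp_1^k\cap\cdots\cap\wp_s^k$ and coordinate ring $R_{k\mathbb{X}}=S/I_{k\mathbb{X}}$; by convention $I_{0\mathbb{X}}=\langle1\rangle$. $\Omega^1_{R_{\nu\mathbb{X}}/K}$ is the module of Kähler differentials of $R_{\nu\mathbb{X}}/K$, graded with $\deg(dx_i)=1$ where $x_i$ is the image of $X_i$, and $\Omega^3_{R_{\nu\mathbb{X}}/K}=\bigwedge^3_{R_{\nu\mathbb{X}}}\Omega^1_{R_{\nu\mathbb{X}}/K}$.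 The isomorphism is one of graded modules, $M(a)_i=M_{a+i}$, and $\mathrm{HF}_M(i)=\dim_KM_i$. *)

theory Defs
  imports
    "HOL-Library.Poly_Mapping"
    "HOL-Library.Numeral_Type"
    "HOL-Algebra.Ideal_Product"
    "HOL-Algebra.QuotRing"
    "HOL-Algebra.Generated_Groups"
    "HOL-Algebra.Algebraic_Closure_Type"
    "Jordan_Normal_Form.VS_Connect"
begin

section \<open>The polynomial ring in three indeterminates\<close>

text \<open>Exponent vectors are indexed by the three-element type \<^typ>\<open>3\<close>, with elements \<open>0, 1, 2\<close>.\<close>

type_synonym 'k poly3 = "(3 \<Rightarrow>\<^sub>0 nat) \<Rightarrow>\<^sub>0 'k"

abbreviation S_ring :: "'k::field poly3 ring"
  where "S_ring \<equiv> class_ring"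

definition pconst :: "'k::field \<Rightarrow> 'k poly3"
  where "pconst c = Poly_Mapping.single 0 c"

definition pvar :: "3 \<Rightarrow> 'k::field poly3"
  where "pvar i = Poly_Mapping.single (Poly_Mapping.single i 1) 1"

definition homog :: "int \<Rightarrow> 'k::field poly3 set"
  where "homog d = {f. \<forall>m\<in>Poly_Mapping.keys f. int (\<Sum>i\<in>UNIV. Poly_Mapping.lookup m i) = d}"

text \<open>Evaluation at a point with coordinates in an extension field; \<open>h\<close> is the embedding of
  the coefficients.\<close>

definition peval :: "('k::field \<Rightarrow> 'l::field) \<Rightarrow> (3 \<Rightarrow> 'l) \<Rightarrow> 'k poly3 \<Rightarrow> 'l"
  where "peval h v f = (\<Sum>m\<in>Poly_Mapping.keys f.
           h (Poly_Mapping.lookup f m) * (\<Prod>i\<in>UNIV. v i ^ Poly_Mapping.lookup m i))"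

definition partial_deriv :: "3 \<Rightarrow> 'k::field poly3 \<Rightarrow> 'k poly3"
  where "partial_deriv i f = (\<Sum>m\<in>Poly_Mapping.keys f.
           Poly_Mapping.single (m - Poly_Mapping.single i 1)
             (of_nat (Poly_Mapping.lookup m i) * Poly_Mapping.lookup f m))"

definition irrelevant_ideal :: "'k::field poly3 set"
  where "irrelevant_ideal = genideal S_ring (range pvar)"


section \<open>The projective plane, conics and fat point schemes\<close>

text \<open>The \<open>K\<close>-rational points of the projective plane are the lines through the origin of \<open>K\<^sup>3\<close>.\<close>

definition proj_plane :: "(3 \<Rightarrow> 'k::field) set set"
  where "proj_plane = {{(\<lambda>i. c * v i) | c. True} | v. v \<noteq> (\<lambda>_. 0)}"

text \<open>The zero locus among the \<open>K\<close>-rational points; only meaningful for homogeneous \<open>f\<close>.\<close>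

definition zero_locus :: "'k::field poly3 \<Rightarrow> (3 \<Rightarrow> 'k) set set"
  where "zero_locus f = {P \<in> proj_plane. \<forall>v\<in>P. peval id v f = 0}"

text \<open>The Jacobian criterion, at all geometric points.\<close>

definition nonsingular_conic :: "'k::field poly3 \<Rightarrow> bool"
  where "nonsingular_conic C \<longleftrightarrow> C \<in> homog 2 \<and>
    (\<forall>v :: 3 \<Rightarrow> 'k alg_closure. v \<noteq> (\<lambda>_. 0) \<and> peval to_ac v C = 0 \<longrightarrow>
       (\<exists>i. peval to_ac v (partial_deriv i C) \<noteq> 0))"

definition vanishing_ideal :: "(3 \<Rightarrow> 'k::field) set \<Rightarrow> 'k poly3 set"
  where "vanishing_ideal P = genideal S_ring {f. (\<exists>d. f \<in> homog d) \<and> P \<in> zero_locus f}"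

text \<open>For \<open>k = 0\<close> this is the unit ideal, since the unit of \<^const>\<open>ideals_set\<close> is the whole ring.\<close>

definition fat_ideal :: "nat \<Rightarrow> (3 \<Rightarrow> 'k::field) set set \<Rightarrow> 'k poly3 set"
  where "fat_ideal k \<X> = (\<Inter>P\<in>\<X>. vanishing_ideal P [^]\<^bsub>ideals_set S_ring\<^esub> k)"


section \<open>Module constructions\<close>

text \<open>The fields \<^const>\<open>monoid.mult\<close> and \<^const>\<open>monoid.one\<close> of a module record carry no
  meaning.\<close>

definition restrict_scalars :: "('a \<Rightarrow> 'b) \<Rightarrow> ('b, 'm) module \<Rightarrow> ('a, 'm) module"
  where "restrict_scalars \<phi> M = \<lparr>carrier = carrier M, monoid.mult = monoid.mult M,
    one = monoid.one M, zero = ring.zero M, add = add M, module.smult = (\<lambda>a. module.smult M (\<phi> a))\<rparr>"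

definition regular_module :: "'a ring \<Rightarrow> ('a, 'a) module"
  where "regular_module R = \<lparr>carrier = carrier R, monoid.mult = monoid.mult R,
    one = monoid.one R, zero = ring.zero R, add = add R, module.smult = monoid.mult R\<rparr>"

definition quotient_module :: "('a, 'm) module \<Rightarrow> 'm set \<Rightarrow> ('a, 'm set) module"
  where "quotient_module M N = \<lparr>carrier = a_rcosets\<^bsub>M\<^esub> N, monoid.mult = (\<lambda>_ _. N), one = N, zero = N,
    add = set_add M, module.smult = (\<lambda>a A. \<Union>x\<in>A. N +>\<^bsub>M\<^esub> (a \<odot>\<^bsub>M\<^esub> x))\<rparr>"

text \<open>The free module on \<open>B\<close>, realised as the finitely supported functions on \<open>B\<close>.\<close>

definition free_module :: "'a ring \<Rightarrow> 'b set \<Rightarrow> ('a, 'b \<Rightarrow> 'a) module"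
  where "free_module R B = \<lparr>
    carrier = {f. (\<forall>b\<in>B. f b \<in> carrier R) \<and> (\<forall>b. b \<notin> B \<longrightarrow> f b = \<zero>\<^bsub>R\<^esub>) \<and> finite {b. f b \<noteq> \<zero>\<^bsub>R\<^esub>}},
    monoid.mult = (\<lambda>_ _ _. \<zero>\<^bsub>R\<^esub>), one = (\<lambda>_. \<zero>\<^bsub>R\<^esub>), zero = (\<lambda>_. \<zero>\<^bsub>R\<^esub>),
    add = (\<lambda>f g b. f b \<oplus>\<^bsub>R\<^esub> g b), module.smult = (\<lambda>a f b. a \<otimes>\<^bsub>R\<^esub> f b)\<rparr>"

definition free_gen :: "'a ring \<Rightarrow> 'b \<Rightarrow> 'b \<Rightarrow> 'a"
  where "free_gen R b = (\<lambda>b'. if b' = b then \<one>\<^bsub>R\<^esub> else \<zero>\<^bsub>R\<^esub>)"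

text \<open>The module presented by generators \<open>B\<close> and relations \<open>E\<close>.\<close>

definition presented_module :: "'a ring \<Rightarrow> 'b set \<Rightarrow> ('b \<Rightarrow> 'a) set \<Rightarrow> ('a, ('b \<Rightarrow> 'a) set) module"
  where "presented_module R B E =
    quotient_module (free_module R B) (LinearCombinations.module.span R (free_module R B) E)"

definition presented_gen :: "'a ring \<Rightarrow> 'b set \<Rightarrow> ('b \<Rightarrow> 'a) set \<Rightarrow> 'b \<Rightarrow> ('b \<Rightarrow> 'a) set"
  where "presented_gen R B E b =
    LinearCombinations.module.span R (free_module R B) E +>\<^bsub>free_module R B\<^esub> free_gen R b"


section \<open>Kaehler differentials\<close>

text \<open>\<open>R\<close> is an algebra over the ring \<open>K\<close> by means of \<open>\<phi>\<close>. The module of differentials is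
  generated by symbols \<open>da\<close>, for \<open>a \<in> R\<close>, subject to additivity, the Leibniz rule and
  \<open>d(\<phi> c) = 0\<close>.\<close>

definition kahler_rels :: "'c ring \<Rightarrow> ('c \<Rightarrow> 'a) \<Rightarrow> 'a ring \<Rightarrow> ('a \<Rightarrow> 'a) set"
  where "kahler_rels K \<phi> R = (let F = free_module R (carrier R); \<delta> = free_gen R in
      {\<delta> (a \<oplus>\<^bsub>R\<^esub> b) \<ominus>\<^bsub>F\<^esub> (\<delta> a \<oplus>\<^bsub>F\<^esub> \<delta> b) | a b. a \<in> carrier R \<and> b \<in> carrier R}
    \<union> {\<delta> (a \<otimes>\<^bsub>R\<^esub> b) \<ominus>\<^bsub>F\<^esub> (a \<odot>\<^bsub>F\<^esub> \<delta> b \<oplus>\<^bsub>F\<^esub> b \<odot>\<^bsub>F\<^esub> \<delta> a) | a b. a \<in> carrier R \<and> b \<in> carrier R}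
    \<union> {\<delta> (\<phi> c) | c. c \<in> carrier K})"

definition kahler :: "'c ring \<Rightarrow> ('c \<Rightarrow> 'a) \<Rightarrow> 'a ring \<Rightarrow> ('a, ('a \<Rightarrow> 'a) set) module"
  where "kahler K \<phi> R = presented_module R (carrier R) (kahler_rels K \<phi> R)"

definition kahler_d :: "'c ring \<Rightarrow> ('c \<Rightarrow> 'a) \<Rightarrow> 'a ring \<Rightarrow> 'a \<Rightarrow> ('a \<Rightarrow> 'a) set"
  where "kahler_d K \<phi> R = presented_gen R (carrier R) (kahler_rels K \<phi> R)"


section \<open>Exterior powers\<close>

text \<open>The \<open>n\<close>-th exterior power is generated by symbols for the \<open>n\<close>-tuples (lists of length \<open>n\<close>)
  of elements of \<open>M\<close>, subject to multilinearity and alternation.\<close>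

definition tuples :: "('a, 'm) module \<Rightarrow> nat \<Rightarrow> 'm list set"
  where "tuples M n = {ws. length ws = n \<and> set ws \<subseteq> carrier M}"

definition exterior_rels :: "'a ring \<Rightarrow> ('a, 'm) module \<Rightarrow> nat \<Rightarrow> ('m list \<Rightarrow> 'a) set"
  where "exterior_rels R M n = (let F = free_module R (tuples M n); \<epsilon> = free_gen R in
      {\<epsilon> (ws[i := x \<oplus>\<^bsub>M\<^esub> y]) \<ominus>\<^bsub>F\<^esub> (\<epsilon> (ws[i := x]) \<oplus>\<^bsub>F\<^esub> \<epsilon> (ws[i := y])) | ws i x y.
         ws \<in> tuples M n \<and> i < n \<and> x \<in> carrier M \<and> y \<in> carrier M}
    \<union> {\<epsilon> (ws[i := a \<odot>\<^bsub>M\<^esub> x]) \<ominus>\<^bsub>F\<^esub> (a \<odot>\<^bsub>F\<^esub> \<epsilon> (ws[i := x])) | ws i a x.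
         ws \<in> tuples M n \<and> i < n \<and> a \<in> carrier R \<and> x \<in> carrier M}
    \<union> {\<epsilon> ws | ws. ws \<in> tuples M n \<and> \<not> distinct ws})"

definition exterior_power :: "'a ring \<Rightarrow> ('a, 'm) module \<Rightarrow> nat \<Rightarrow> ('a, ('m list \<Rightarrow> 'a) set) module"
  where "exterior_power R M n = presented_module R (tuples M n) (exterior_rels R M n)"

definition wedge :: "'a ring \<Rightarrow> ('a, 'm) module \<Rightarrow> nat \<Rightarrow> 'm list \<Rightarrow> ('m list \<Rightarrow> 'a) set"
  where "wedge R M n = presented_gen R (tuples M n) (exterior_rels R M n)"


section \<open>Graded modules\<close>

text \<open>A grading of a module is given by its homogeneous components \<open>G i\<close>, for \<open>i :: int\<close>.\<close>

definition shift :: "int \<Rightarrow> (int \<Rightarrow> 'm set) \<Rightarrow> int \<Rightarrow> 'm set"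
  where "shift a G = (\<lambda>i. G (a + i))"

definition graded_isomorphic ::
  "'a ring \<Rightarrow> ('a, 'm) module \<Rightarrow> (int \<Rightarrow> 'm set) \<Rightarrow> ('a, 'n) module \<Rightarrow> (int \<Rightarrow> 'n set) \<Rightarrow> bool"
  where "graded_isomorphic R M G N H \<longleftrightarrow>
    (\<exists>h \<in> module_hom R M N. bij_betw h (carrier M) (carrier N) \<and> (\<forall>i. h ` G i = H i))"

text \<open>The Hilbert function of a graded module over the polynomial ring.\<close>

definition hilbert_function ::
  "('k::field poly3, 'm) module \<Rightarrow> (int \<Rightarrow> 'm set) \<Rightarrow> int \<Rightarrow> nat"
  where "hilbert_function M G i =
    vectorspace.dim (class_ring :: 'k ring) ((restrict_scalars pconst M)\<lparr>carrier := G i\<rparr>)"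

definition quot_poly :: "'k::field poly3 set \<Rightarrow> ('k poly3, 'k poly3 set) module"
  where "quot_poly J = quotient_module (regular_module S_ring) J"

definition quot_poly_deg :: "'k::field poly3 set \<Rightarrow> int \<Rightarrow> 'k poly3 set set"
  where "quot_poly_deg J i = (\<lambda>f. J +>\<^bsub>S_ring\<^esub> f) ` homog i"


section \<open>Differentials of the coordinate ring \<open>S/I\<close>\<close>

text \<open>\<open>I\<close> is a homogeneous ideal. The elements of the coordinate ring \<^term>\<open>S_ring Quot I\<close>
  are cosets; its homogeneous component of degree \<open>i\<close> is \<^term>\<open>quot_poly_deg I i\<close>.\<close>

definition omega1 :: "'k::field poly3 set \<Rightarrow> ('k poly3 set, ('k poly3 set \<Rightarrow> 'k poly3 set) set) module"
  where "omega1 I =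
    kahler (class_ring :: 'k ring) (\<lambda>c. I +>\<^bsub>S_ring\<^esub> pconst c) (S_ring Quot I)"

definition omega1_dx :: "'k::field poly3 set \<Rightarrow> 3 \<Rightarrow> ('k poly3 set \<Rightarrow> 'k poly3 set) set"
  where "omega1_dx I j = kahler_d (class_ring :: 'k ring) (\<lambda>c. I +>\<^bsub>S_ring\<^esub> pconst c)
    (S_ring Quot I) (I +>\<^bsub>S_ring\<^esub> pvar j)"

text \<open>The grading with \<open>deg dx\<^sub>j = 1\<close>: the component of degree \<open>n\<close> is \<open>\<Sum>\<^sub>j R\<^sub>n\<^sub>-\<^sub>1 dx\<^sub>j\<close>.\<close>

definition omega1_deg :: "'k::field poly3 set \<Rightarrow> int \<Rightarrow> ('k poly3 set \<Rightarrow> 'k poly3 set) set set"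
  where "omega1_deg I n = generate (add_monoid (omega1 I))
    {r \<odot>\<^bsub>omega1 I\<^esub> omega1_dx I j | r j. r \<in> quot_poly_deg I (n - 1)}"

text \<open>The \<open>m\<close>-th exterior power over \<open>S/I\<close>, regarded as an \<open>S\<close>-module through \<open>S \<rightarrow> S/I\<close>, with the
  induced grading.\<close>

definition omega :: "'k::field poly3 set \<Rightarrow> nat \<Rightarrow>
    ('k poly3, (('k poly3 set \<Rightarrow> 'k poly3 set) set list \<Rightarrow> 'k poly3 set) set) module"
  where "omega I m = restrict_scalars (\<lambda>f. I +>\<^bsub>S_ring\<^esub> f)
    (exterior_power (S_ring Quot I) (omega1 I) m)"

definition omega_deg :: "'k::field poly3 set \<Rightarrow> nat \<Rightarrow> int \<Rightarrow>
    (('k poly3 set \<Rightarrow> 'k poly3 set) set list \<Rightarrow> 'k poly3 set) set set"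
  where "omega_deg I m n = generate (add_monoid (omega I m))
    {wedge (S_ring Quot I) (omega1 I) m ws | ws ds.
       list_all2 (\<lambda>w d. w \<in> omega1_deg I d) ws ds \<and> length ws = m \<and> sum_list ds = n}"

end

theory Submission
  imports Defs
begin

text \<open>Eliminating relations, the third exterior power of the differentials of \<open>S/I\<close> is
  \<open>(S/J)(-3)\<close>, where \<open>J\<close> is generated by \<open>I\<close> and the partial derivatives of its elements, so
  everything comes down to \<open>J = \<MM> I'\<close> for \<open>I\<close> the ideal of \<open>\<nu>\<X>\<close> and \<open>I'\<close> that of \<open>(\<nu> - 1)\<X>\<close>.
  Parametrise the conic by the binary forms of degree two; then \<open>C\<close> is a multiple of
  \<open>Y\<^sub>1\<^sup>2 - Y\<^sub>0 Y\<^sub>2\<close>. A form in the ideal of \<open>\<mu>\<X>\<close> restricts to a multiple of \<open>f\<^sup>\<mu>\<close>, where \<open>f\<close> is the product of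
  the \<open>s\<close> linear factors of the points, and every such multiple of degree \<open>2e\<close> is the restriction of a
  product of lines joining distinct points. Hence for \<open>2e \<ge> \<mu>s\<close> the elements of degree
  \<open>e + 1\<close> lie in \<open>\<MM>\<close> times the ideal of \<open>\<mu>\<X>\<close>. A form of degree \<open>d\<close> in \<open>I\<close> is either divisible by \<open>C\<close>, which
  allows induction on \<open>\<nu>\<close>, or satisfies \<open>2d \<ge> \<nu>s\<close>, and then \<open>s \<ge> 4\<close> puts its derivatives into the range just
  described: \<open>J \<subseteq> \<MM> I'\<close>. Conversely, the derivatives of \<open>C\<close> span the linear forms, and
  differentiating \<open>C\<^sup>k\<^sup>+\<^sup>1 G\<close> gives \<open>\<MM> C\<^sup>k G \<subseteq> J\<close> by descending induction on \<open>k\<close>.\<close>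

text \<open>The module of differentials of \<open>S/I\<close> is the quotient of a free module of
  rank three by the gradients of the elements of \<open>I\<close>. The top exterior power of such a
  quotient is the ring modulo the ideal of all coordinates of the relations; hence the partial
  derivatives generate \<open>J\<close>. The bound 4 is twice 2. Dividing by \<open>C\<close> costs
  two degrees and one multiplicity at each of the s points, so \<open>2 * e\<close> loses 4 while
  \<mu>s loses s. A derivative loses one degree, and the factor from \<MM> a second one, so
  \<open>2 * d\<close> again loses 4 while the multiplicity drops by one. The delicate point is to
  cancel \<open>C\<close>: if C f vanishes to order \<mu> + 1 at the points, then f must vanish to
  order \<mu>. Powers of an ideal are only given by sums of products, so they are first described by
  a valuation, the order in t after a contraction towards the point; it is additive because S is a
  domain, and \<open>C\<close> has order exactly 1. As the base field is infinite, a rational point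
  of the conic away from the given ones can be sent to infinity. Binary forms then become univariate
  polynomials together with a degree bound. Characteristic zero enters through Euler's formula, and
  when k + 1 is divided out of the derivative of a power.\<close>

abbreviation "lookup \<equiv> Poly_Mapping.lookup"
abbreviation "single \<equiv> Poly_Mapping.single"
abbreviation "keys \<equiv> Poly_Mapping.keys"

section \<open>Three indices, inductions for polynomials, evaluation homomorphisms\<close>

lemma UNIV_3: "(UNIV :: 3 set) = {0, 1, 2}"
  apply (rule sym, rule card_subset_eq) apply auto done

lemma sum_UNIV_3: "(\<Sum>i\<in>(UNIV :: 3 set). g i) = g 0 + g 1 + (g 2 :: 'a::comm_monoid_add)"
  unfolding UNIV_3 by (simp add: add.assoc)

lemma prod_UNIV_3: "(\<Prod>i\<in>(UNIV :: 3 set). g i) = g 0 * g 1 * (g 2 :: 'a::comm_monoid_mult)"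
  unfolding UNIV_3 by (simp add: mult.assoc)

lemma all_3: "(\<forall>i::3. P i) \<longleftrightarrow> P 0 \<and> P 1 \<and> P 2"
  using UNIV_3 by (metis UNIV_I insertE singletonD)

lemma poly_mapping_sum_single:
  "f = (\<Sum>m\<in>keys f. single m (lookup f m))"
  by (rule poly_mapping_eqI)
    (auto simp: lookup_sum lookup_single when_def not_in_keys_iff_lookup_eq_zero)

lemma poly_mapping_single_induct [case_names single add]:
  fixes f :: "'a \<Rightarrow>\<^sub>0 'b::comm_monoid_add"
  assumes "\<And>m c. P (single m c)" and "\<And>f g. P f \<Longrightarrow> P g \<Longrightarrow> P (f + g)"
  shows "P f"
proof -
  note poly_mapping_sum_single[of f]
  moreover have "P (\<Sum>m\<in>A. single m (lookup f m))" if "finite A" for A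
    using that
  proof induction
    case empty
    show ?case using assms(1)[of undefined 0] by simp
  next
    case (insert x F)
    then show ?case using assms by simp
  qed
  ultimately show ?thesis by (metis finite_keys)
qed

text \<open>The formula of \<open>peval\<close> with values in a commutative ring instead of a
  field: the later maps \<open>\<chi>\<close>, \<open>\<rho>\<close> and \<open>\<theta>\<close>
  take values in univariate polynomials.\<close>

definition ev :: "('k::field \<Rightarrow> 'a::comm_ring_1) \<Rightarrow> (3 \<Rightarrow> 'a) \<Rightarrow> 'k poly3 \<Rightarrow> 'a"
  where "ev h v f = (\<Sum>m\<in>keys f.
           h (lookup f m) * (\<Prod>i\<in>UNIV. v i ^ lookup m i))"

lemma peval_eq_ev: "peval = ev"
  by (intro ext) (simp add: peval_def ev_def)

context
  fixes h :: "'k::field \<Rightarrow> 'a::comm_ring_1"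
  assumes h: "comm_ring_hom h"
begin

interpretation h: comm_ring_hom h by (rule h)

lemma ev_add: "ev h v (f + g) = ev h v f + ev h v g"
  unfolding ev_def
  by (rule setsum_keys_plus_distrib) (simp_all add: h.hom_add distrib_right)

lemma ev_single: "ev h v (single m c) = h c * (\<Prod>i\<in>UNIV. v i ^ lookup m i)"
  by (simp add: ev_def)

lemma ev_mult: "ev h v (f * g) = ev h v f * ev h v g"
proof (induction f rule: poly_mapping_single_induct)
  case (single m c)
  show ?case
    by (induction g rule: poly_mapping_single_induct)
      (simp_all add: mult_single ev_single h.hom_mult lookup_add power_add prod.distrib
        distrib_left ev_add)
qed (simp add: distrib_right ev_add)

lemma ev_hom: "comm_ring_hom (ev h v)"
proof
  show "ev h v 1 = 1"
    using ev_single[of v 0 1] by (simp add: single_one[symmetric] del: single_one)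
  show "ev h v 0 = 0" by (simp add: ev_def)
qed (auto simp: ev_add ev_mult)

lemma ev_pconst: "ev h v (pconst c) = h c"
  by (simp add: pconst_def ev_single)

lemma ev_pvar: "ev h v (pvar i) = v i"
proof -
  have "(\<Prod>j\<in>UNIV. v j ^ lookup (single i 1) j) = v i"
    by (subst prod.remove[of _ i]) (auto simp: lookup_single when_def intro!: prod.neutral)
  then show ?thesis
    by (simp add: pvar_def ev_single)
qed

end

lemma pconst_hom: "comm_ring_hom (pconst :: 'k::field \<Rightarrow> 'k poly3)"
  by unfold_locales (simp_all add: pconst_def single_add mult_single)

interpretation pconst: comm_ring_hom pconst by (rule pconst_hom)

lemma single_eq_prod: "single m (c::'k::field) = pconst c * (\<Prod>i\<in>UNIV. pvar i ^ lookup m i)"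
proof -
  have pw: "pvar i ^ n = single (single i n) (1::'k)" for i n
    by (induction n) (simp_all add: pvar_def mult_single single_add[symmetric] add.commute)
  have "m = single 0 (lookup m 0) + single 1 (lookup m 1)
     + single 2 (lookup m 2)"
    apply (rule poly_mapping_eqI)
    subgoal for k using UNIV_3 UNIV_I[of k]
      by (auto simp: lookup_add lookup_single when_def)
    done
  then show ?thesis
    by (simp add: prod_UNIV_3 pw mult_single pconst_def)
qed

lemma poly3_induct [case_names const var add mult]:
  fixes f :: "'k::field poly3"
  assumes c: "\<And>c. P (pconst c)" and v: "\<And>i. P (pvar i)"
    and a: "\<And>f g. P f \<Longrightarrow> P g \<Longrightarrow> P (f + g)" and m: "\<And>f g. P f \<Longrightarrow> P g \<Longrightarrow> P (f * g)"
  shows "P f"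
proof (induction f rule: poly_mapping_single_induct)
  case (single n c)
  have pw: "P (pvar i ^ k)" for i k
    by (induction k) (use c[of 1] m v in auto)
  show ?case
    unfolding single_eq_prod prod_UNIV_3 by (intro m c pw)
qed (rule a)

subsection \<open>Partial derivatives\<close>

lemma partial_deriv_add: "partial_deriv i (f + g) = partial_deriv i f + partial_deriv i g"
  unfolding partial_deriv_def
  by (rule setsum_keys_plus_distrib) (simp_all add: single_add[symmetric] distrib_left)

lemma partial_deriv_single: "partial_deriv i (single m c) =
    single (m - single i 1) (of_nat (lookup m i) * c)"
  by (simp add: partial_deriv_def)

lemma partial_deriv_pconst [simp]: "partial_deriv i (pconst c) = 0"
  by (simp add: pconst_def partial_deriv_single)

lemma partial_deriv_pvar: "partial_deriv i (pvar j) = (if i = j then 1 else 0)"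
  by (auto simp: pvar_def partial_deriv_single lookup_single when_def)

lemma single_minus_add: "lookup m i \<noteq> 0 \<Longrightarrow> m - single i (1::nat) + n = m + n - single i 1"
  by (rule poly_mapping_eqI) (auto simp: lookup_add lookup_minus lookup_single when_def)

lemma partial_deriv_mult:
  "partial_deriv i (f * g) = partial_deriv i f * g + f * partial_deriv i g"
proof (induction f rule: poly_mapping_single_induct)
  case (single m c)
  show ?case
  proof (induction g rule: poly_mapping_single_induct)
    case (single n d)
    show ?case
    \<comment> \<open>Subtraction of exponents truncates at 0. Where an exponent is 0 the
      coefficient \<open>of_nat 0\<close> kills the term; elsewhere \<open>single_minus_add\<close>
      moves the subtraction through the sum.\<close>
    proof (cases "lookup m i = 0 \<or> lookup n i = 0")
      case True
      then show ?thesis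
        using single_minus_add[of m i n] single_minus_add[of n i m]
        by (cases "lookup m i = 0"; cases "lookup n i = 0")
          (simp_all add: mult_single partial_deriv_single lookup_add algebra_simps)
    next
      case False
      then show ?thesis
        using single_minus_add[of m i n] single_minus_add[of n i m]
        by (auto simp: mult_single partial_deriv_single lookup_add algebra_simps single_add[symmetric])
    qed
  qed (simp add: distrib_left partial_deriv_add)
qed (simp add: distrib_right partial_deriv_add)

subsection \<open>Homogeneous components\<close>

lemma homog_zero [simp]: "0 \<in> homog d"
  by (simp add: homog_def)

lemma homog_add: "f \<in> homog d \<Longrightarrow> g \<in> homog d \<Longrightarrow> f + g \<in> homog d"
  using keys_add[of f g] by (auto simp: homog_def)

lemma homog_single: "int (\<Sum>i\<in>UNIV. lookup m i) = d \<Longrightarrow> single m c \<in> homog d"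
  by (simp add: homog_def)

lemma homog_mult: "f \<in> homog d \<Longrightarrow> g \<in> homog e \<Longrightarrow> f * g \<in> homog (d + e)"
  using keys_mult[of f g] by (force simp: homog_def lookup_add sum.distrib)

lemma homog_sum: "(\<And>x. x \<in> A \<Longrightarrow> f x \<in> homog d) \<Longrightarrow> sum f A \<in> homog d"
  by (induction A rule: infinite_finite_induct) (auto intro: homog_add)

lemma homog_pconst [simp]: "pconst c \<in> homog 0"
  by (simp add: pconst_def homog_single)

lemma homog_pvar [simp]: "pvar i \<in> homog 1"
proof -
  have "(\<Sum>j\<in>UNIV. lookup (single i (1::nat)) j) = 1"
    by (simp add: lookup_single when_def)
  then show ?thesis unfolding pvar_def by (intro homog_single) simp
qed

lemma homog_uminus: "f \<in> homog d \<Longrightarrow> - f \<in> homog d"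
  using homog_mult[OF homog_pconst[of "-1"], of f d] by (simp add: pconst.hom_uminus)

lemma homog_diff: "f \<in> homog d \<Longrightarrow> g \<in> homog d \<Longrightarrow> f - g \<in> homog d"
  using homog_add[of f d "- g"] by (simp add: homog_uminus)

lemma homog_neg: "d < 0 \<Longrightarrow> f \<in> homog d \<Longrightarrow> f = 0"
proof (rule poly_mapping_eqI, rule ccontr)
  fix m assume "d < 0" "f \<in> homog d" "lookup f m \<noteq> lookup 0 m"
  then have "int (\<Sum>i\<in>UNIV. lookup m i) < 0"
    by (simp add: homog_def in_keys_iff)
  then show False by linarith
qed

lemma homog_power: "f \<in> homog d \<Longrightarrow> f ^ n \<in> homog (int n * d)"
  by (induction n) (auto simp: algebra_simps intro: homog_mult simp flip: pconst.hom_one)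

text \<open>\<open>\<chi> f = f(tX)\<close>, so the coefficient of \<open>t\<^sup>n\<close> is the homogeneous component of degree \<open>n\<close>.\<close>

definition \<chi> :: "'k::field poly3 \<Rightarrow> 'k poly3 poly"
  where "\<chi> = ev (\<lambda>c. [:pconst c:]) (\<lambda>i. [:0, pvar i:])"

lemma pconst_poly_hom: "comm_ring_hom (\<lambda>c. [:pconst c:])"
  by unfold_locales (simp_all add: pconst.hom_add pconst.hom_mult)

interpretation \<chi>: comm_ring_hom \<chi>
  unfolding \<chi>_def by (rule ev_hom, rule pconst_poly_hom)

lemma \<chi>_pvar: "\<chi> (pvar i) = monom (pvar i) 1"
  by (simp add: \<chi>_def ev_pvar[OF pconst_poly_hom] monom_altdef)

lemma \<chi>_pconst: "\<chi> (pconst c) = monom (pconst c) 0"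
  by (simp add: \<chi>_def ev_pconst[OF pconst_poly_hom] monom_altdef)

lemma \<chi>_single: "\<chi> (single m c) = monom (single m c) (\<Sum>i\<in>UNIV. lookup m i)"
  by (simp add: single_eq_prod prod_UNIV_3 sum_UNIV_3 \<chi>.hom_mult \<chi>.hom_power \<chi>_pconst \<chi>_pvar monom_power mult_monom)

lemma coeff_\<chi>_homog: "coeff (\<chi> f) n \<in> homog (int n)"
  by (induction f rule: poly_mapping_single_induct)
    (auto simp: \<chi>_single \<chi>.hom_add intro: homog_add homog_single)

lemma \<chi>_homog:
  assumes "f \<in> homog (int n)" shows "\<chi> f = monom f n"
proof -
  note * = poly_mapping_sum_single[of f]
  have "\<chi> f = (\<Sum>m\<in>keys f. \<chi> (single m (lookup f m)))"
    by (subst *) (rule \<chi>.hom_sum)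
  also have "\<dots> = (\<Sum>m\<in>keys f. monom (single m (lookup f m)) n)"
    using assms by (intro sum.cong) (auto simp: \<chi>_single homog_def simp del: of_nat_sum)
  also have "\<dots> = monom f n"
    by (simp only: monom_sum[symmetric] *[symmetric])
  finally show ?thesis .
qed

lemma poly_\<chi>_1: "poly (\<chi> f) 1 = f"
  by (induction f rule: poly_mapping_single_induct) (simp_all add: \<chi>_single \<chi>.hom_add poly_monom)

lemma sum_components: "f = (\<Sum>n\<le>Polynomial.degree (\<chi> f). coeff (\<chi> f) n)"
  using poly_\<chi>_1[of f] by (simp add: poly_altdef)

lemma partial_deriv_sum: "partial_deriv i (sum f A) = (\<Sum>x\<in>A. partial_deriv i (f x))"
  by (induction A rule: infinite_finite_induct)
    (simp_all add: partial_deriv_add partial_deriv_pconst[of i 0, simplified])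

lemma partial_deriv_homog:
  assumes "f \<in> homog d" shows "partial_deriv i f \<in> homog (d - 1)"
proof -
  have "single (m - single i 1) (of_nat (lookup m i) * lookup f m) \<in> homog (d - 1)"
    if m: "m \<in> keys f" for m
  proof (cases "lookup m i = 0")
    case False
    have "m = (m - single i 1) + single i 1"
      using single_minus_add[OF False, of "single i 1"] by simp
    then have "(\<Sum>j\<in>UNIV. lookup m j) = (\<Sum>j\<in>UNIV. lookup (m - single i 1) j) + (\<Sum>j\<in>UNIV. lookup (single i (1::nat)) j)"
      by (metis (no_types, lifting) lookup_add sum.cong sum.distrib)
    moreover have "(\<Sum>j\<in>UNIV. lookup (single i (1::nat)) j) = 1"
      by (simp add: lookup_single when_def)
    ultimately show ?thesis using assms m
      by (intro homog_single) (auto simp: homog_def simp del: of_nat_sum)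
  qed simp
  then show ?thesis unfolding partial_deriv_def by (rule homog_sum)
qed

lemma euler:
  assumes "f \<in> homog d"
  shows "(\<Sum>i\<in>UNIV. pvar i * partial_deriv i f) = pconst (of_int d) * f"
proof -
  have 1: "pvar i * partial_deriv i (single m c) = single m (of_nat (lookup m i) * c)" for i m c
  proof (cases "lookup m i = 0")
    case False
    have "m = single i 1 + (m - single i 1)"
      using single_minus_add[OF False, of "single i 1"] by (simp add: add.commute)
    then show ?thesis by (simp add: partial_deriv_single pvar_def mult_single)
  qed (simp add: partial_deriv_single)
  have 2: "(\<Sum>i\<in>UNIV. pvar i * partial_deriv i (single m c)) = pconst (of_nat (\<Sum>i\<in>UNIV. lookup m i)) * single m c" for m c
    by (simp add: 1 sum_UNIV_3 pconst_def mult_single single_add[symmetric] algebra_simps)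
  note * = poly_mapping_sum_single[of f]
  have "(\<Sum>i\<in>UNIV. pvar i * partial_deriv i f) = (\<Sum>i\<in>UNIV. \<Sum>m\<in>keys f. pvar i * partial_deriv i (single m (lookup f m)))"
    by (subst *) (simp add: partial_deriv_sum sum_distrib_left)
  also have "\<dots> = (\<Sum>m\<in>keys f. \<Sum>i\<in>UNIV. pvar i * partial_deriv i (single m (lookup f m)))"
    by (rule sum.swap)
  also have "\<dots> = (\<Sum>m\<in>keys f. pconst (of_int d) * single m (lookup f m))"
    unfolding 2 using assms by (intro sum.cong) (auto simp: homog_def)
  also have "\<dots> = pconst (of_int d) * f"
    by (simp only: sum_distrib_left[symmetric] *[symmetric])
  finally show ?thesis .
qed

subsection \<open>Quadratic forms in three variables\<close>

definition cross :: "(3 \<Rightarrow> 'k::field) \<Rightarrow> (3 \<Rightarrow> 'k) \<Rightarrow> 3 \<Rightarrow> 'k"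
  where "cross v w = (\<lambda>i. if i = 0 then v 1 * w 2 - v 2 * w 1
     else if i = 1 then v 2 * w 0 - v 0 * w 2 else v 0 * w 1 - v 1 * w 0)"

lemma cross_eq_0_imp_parallel:
  assumes "cross v w = (\<lambda>_. 0)" "w \<noteq> (\<lambda>_. 0)"
  obtains s where "v = (\<lambda>i. s * w i)"
proof -
  from assms(2) obtain j where j: "w j \<noteq> 0" by auto
  have "cross v w 0 = 0" "cross v w 1 = 0" "cross v w 2 = 0" using assms(1) by auto
  then have eq: "v 1 * w 2 = v 2 * w 1" "v 2 * w 0 = v 0 * w 2" "v 0 * w 1 = v 1 * w 0"
    by (auto simp: cross_def)
  have "\<forall>i k. v i * w k = v k * w i" using eq by (simp add: all_3)
  then have "v = (\<lambda>i. v j / w j * w i)"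
    using j by (intro ext) (simp add: field_simps)
  then show ?thesis by (rule that)
qed

text \<open>By the identity for the vector triple product, \<open>cross u (cross v w)\<close> is a
  combination of \<open>v\<close> and \<open>w\<close> whose coefficients are the two given dot
  products, so it vanishes.\<close>

lemma orthogonal_imp_parallel_cross:
  assumes "(\<Sum>i\<in>UNIV. u i * v i) = 0" "(\<Sum>i\<in>UNIV. u i * w i) = 0" "cross v w \<noteq> (\<lambda>_. 0)"
  obtains s where "u = (\<lambda>i. s * cross v w i)"
proof -
  have 0: "u 0 * v 0 + u 1 * v 1 + u 2 * v 2 = 0" "u 0 * w 0 + u 1 * w 1 + u 2 * w 2 = 0"
    using assms(1,2) by (simp_all add: sum_UNIV_3)
  have 1: "cross u (cross v w) = (\<lambda>i. v i * (u 0 * w 0 + u 1 * w 1 + u 2 * w 2) - w i * (u 0 * v 0 + u 1 * v 1 + u 2 * v 2))"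
    by (rule ext, rule all_3[THEN iffD2, rule_format]) (simp add: cross_def algebra_simps)
  have "cross u (cross v w) = (\<lambda>_. 0)" unfolding 1 0 by simp
  then show ?thesis using cross_eq_0_imp_parallel assms(3) that by blast
qed

lemma orthogonal_cross: "(\<Sum>i\<in>UNIV. v i * cross v w i) = 0" "(\<Sum>i\<in>UNIV. w i * cross v w i) = 0"
  by (simp_all add: sum_UNIV_3 cross_def algebra_simps)

definition line :: "(3 \<Rightarrow> 'k::field) \<Rightarrow> (3 \<Rightarrow> 'k) set"
  where "line v = {(\<lambda>i. c * v i) | c. True}"

lemma mem_line: "v \<in> line v"
  by (auto simp: line_def intro!: exI[of _ 1])

text \<open>\<open>b\<close> stands for the Hessian matrix of the conic; \<open>B v v\<close> will
  be twice the value of \<open>C\<close> at \<open>v\<close>, so isotropic vectors are the points of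
  the conic.\<close>

locale nondeg_form =
  fixes b :: "3 \<Rightarrow> 3 \<Rightarrow> 'k::field_char_0"
  assumes b_sym: "b i j = b j i"
    and b_nondeg: "(\<And>j. (\<Sum>i\<in>UNIV. p i * b i j) = 0) \<Longrightarrow> p = (\<lambda>_. 0)"
begin

definition B :: "(3 \<Rightarrow> 'k) \<Rightarrow> (3 \<Rightarrow> 'k) \<Rightarrow> 'k"
  where "B p q = (\<Sum>i\<in>UNIV. \<Sum>j\<in>UNIV. p i * b i j * q j)"

lemma B_sym: "B p q = B q p"
  unfolding B_def by (subst sum.swap) (simp add: b_sym mult_ac)

lemma B_add: "B (\<lambda>i. p i + p' i) q = B p q + B p' q"
  by (simp add: B_def distrib_right sum.distrib)

lemma B_scale: "B (\<lambda>i. s * p i) q = s * B p q"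
  by (simp add: B_def sum_distrib_left mult.assoc)

lemma B_add2: "B q (\<lambda>i. p i + p' i) = B q p + B q p'"
  by (metis B_add B_sym)

lemma B_scale2: "B q (\<lambda>i. s * p i) = s * B q p"
  by (metis B_scale B_sym)

lemma B_diff: "B (\<lambda>i. p i - p' i) q = B p q - B p' q"
  by (simp add: B_def left_diff_distrib sum_subtractf)

lemma B_diff2: "B q (\<lambda>i. p i - p' i) = B q p - B q p'"
  by (metis B_diff B_sym)

lemmas B_simps = B_add B_scale B_add2 B_scale2 B_diff B_diff2

text \<open>The linear functional \<open>B p\<close> as a coefficient vector (the polar line of
  \<open>p\<close>). It turns \<open>B\<close> into a dot product, to which the lemmas on
  \<open>cross\<close> apply.\<close>

definition cov :: "(3 \<Rightarrow> 'k) \<Rightarrow> 3 \<Rightarrow> 'k"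
  where "cov p j = (\<Sum>i\<in>UNIV. p i * b i j)"

lemma B_cov: "B p q = (\<Sum>j\<in>UNIV. cov p j * q j)"
  unfolding B_def cov_def by (subst sum.swap) (simp add: sum_distrib_right)

lemma cov_scale: "cov (\<lambda>i. s * p i) = (\<lambda>j. s * cov p j)"
  by (rule ext) (simp add: cov_def sum_distrib_left mult.assoc)

lemma cov_diff: "cov (\<lambda>i. p i - q i) = (\<lambda>j. cov p j - cov q j)"
  by (rule ext) (simp add: cov_def left_diff_distrib sum_subtractf)

lemma cov_eq_0: "cov p = (\<lambda>_. 0) \<Longrightarrow> p = (\<lambda>_. 0)"
  using b_nondeg[of p] by (simp add: cov_def fun_eq_iff)

lemma B_nondeg: "(\<And>q. B p q = 0) \<Longrightarrow> p = (\<lambda>_. 0)"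
proof (rule cov_eq_0, rule ext)
  fix j assume "\<And>q. B p q = 0"
  from this[of "\<lambda>i. if i = j then 1 else 0"] show "cov p j = 0"
    by (simp add: B_cov if_distrib cong: if_cong)
qed

text \<open>A non-degenerate form in three variables has no totally isotropic plane: otherwise
  \<open>cov v\<close> and \<open>cov w\<close> would both be multiples of \<open>cross v w\<close>,
  hence proportional, and so would be \<open>v\<close> and \<open>w\<close>.\<close>

lemma isotropic_pair:
  assumes "B v v = 0" "B w w = 0" "cross v w \<noteq> (\<lambda>_. 0)"
  shows "B v w \<noteq> 0"
proof
  assume 0: "B v w = 0"
  obtain s where s: "cov v = (\<lambda>i. s * cross v w i)"
    using orthogonal_imp_parallel_cross[of "cov v" v w] 0 assms by (auto simp: B_cov)
  obtain t where t: "cov w = (\<lambda>i. t * cross v w i)"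
    using orthogonal_imp_parallel_cross[of "cov w" v w] 0[unfolded B_sym[of v w]] assms by (auto simp: B_cov)
  have "cov (\<lambda>i. t * v i - s * w i) = (\<lambda>_. 0)"
    by (simp add: cov_diff cov_scale s t)
  then have "(\<lambda>i. t * v i - s * w i) = (\<lambda>_. 0)" by (rule cov_eq_0)
  then have eq: "t * v i = s * w i" for i by (simp add: fun_eq_iff)
  have "v \<noteq> (\<lambda>_. 0)" using assms(3) by (auto simp: cross_def)
  then have "s \<noteq> 0" using s cov_eq_0[of v] by auto
  then have "w = (\<lambda>i. t / s * v i)" using eq by (auto simp: field_simps)
  then have "cross v w = (\<lambda>_. 0)" by (subst (asm) (1) fun_eq_iff) (simp add: cross_def fun_eq_iff)
  then show False using assms by blast
qed

text \<open>\<open>v\<close> and \<open>w\<close> span a hyperbolic plane and \<open>z\<close> spans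
  its orthogonal complement. If \<open>z\<close> were isotropic it would be orthogonal to
  everything. The coefficients of the expansion are found by pairing with \<open>w\<close>,
  \<open>v\<close> and \<open>z\<close>.\<close>

lemma isotropic_basis:
  assumes v: "B v v = 0" and w: "B w w = 0" and vw: "cross v w \<noteq> (\<lambda>_. 0)"
  obtains z where "B v z = 0" "B w z = 0" "B z z \<noteq> 0" "B v w \<noteq> 0"
    "\<And>p i. p i = B p w / B v w * v i + B p v / B v w * w i + B p z / B z z * z i"
proof -
  have b: "B v w \<noteq> 0" using isotropic_pair assms by blast
  \<comment> \<open>Orthogonality to \<open>v\<close> under \<open>B\<close> is orthogonality to
    \<open>cov v\<close> under the dot product, so this vector is orthogonal to both
    \<open>v\<close> and \<open>w\<close>.\<close>
  define z where "z = cross (cov v) (cov w)"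
  have z: "z \<noteq> (\<lambda>_. 0)"
  proof
    assume "z = (\<lambda>_. 0)"
    moreover have "w \<noteq> (\<lambda>_. 0)" using b by (auto simp: B_def)
    then have "cov w \<noteq> (\<lambda>_. 0)" using cov_eq_0 by blast
    ultimately obtain s where "cov v = (\<lambda>i. s * cov w i)"
      unfolding z_def by (rule cross_eq_0_imp_parallel)
    then have "cov (\<lambda>i. v i - s * w i) = (\<lambda>_. 0)" by (simp add: cov_diff cov_scale)
    then have "v = (\<lambda>i. s * w i)" using cov_eq_0 by (fastforce simp: fun_eq_iff)
    then have "cross v w = (\<lambda>_. 0)" by (simp add: cross_def fun_eq_iff)
    then show False using vw by blast
  qed
  have vz: "B v z = 0" "B w z = 0" unfolding z_def B_cov by (rule orthogonal_cross)+
  have ex: "\<exists>t. \<forall>i. p i = B p w / B v w * v i + B p v / B v w * w i + t * z i" for p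
  proof -
    define p' where "p' = (\<lambda>i. p i - B p w / B v w * v i - B p v / B v w * w i)"
    have "B v p' = 0" "B w p' = 0"
      unfolding p'_def B_simps v w B_sym[of v p] B_sym[of w p] B_sym[of w v] using b by simp_all
    then have "(\<Sum>i\<in>UNIV. p' i * cov v i) = 0" "(\<Sum>i\<in>UNIV. p' i * cov w i) = 0"
      by (simp_all add: B_cov mult.commute)
    then obtain t where "p' = (\<lambda>i. t * z i)"
      using orthogonal_imp_parallel_cross[of p' "cov v" "cov w"] z unfolding z_def by blast
    then show ?thesis unfolding p'_def fun_eq_iff by (intro exI[of _ t]) (simp add: algebra_simps)
  qed
  have B_z: "B p z = t * B z z" if "\<forall>i. p i = B p w / B v w * v i + B p v / B v w * w i + t * z i" for p t
  proof -
    have "B p z = B (\<lambda>i. B p w / B v w * v i + B p v / B v w * w i + t * z i) z"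
      using that by (metis (no_types, lifting) ext)
    then show ?thesis by (simp only: B_simps vz) simp
  qed
  have d: "B z z \<noteq> 0"
  proof
    assume "B z z = 0"
    then have "B z p = 0" for p using ex[of p] B_z[of p] B_sym[of p z] by auto
    then show False using B_nondeg z by blast
  qed
  show ?thesis
  proof (rule that[OF vz d b])
    fix p i
    obtain t where t: "\<forall>i. p i = B p w / B v w * v i + B p v / B v w * w i + t * z i"
      using ex by blast
    then show "p i = B p w / B v w * v i + B p v / B v w * w i + B p z / B z z * z i"
      using B_z[of p t, OF t] d by simp
  qed
qed

text \<open>One rational point gives infinitely many: stereographic projection parametrises
  isotropic lines by the elements of the base field, which is infinite, so finitely many lines can
  be avoided.\<close>

lemma isotropic_avoiding:
  assumes "finite L" and v: "B v v = 0" and w: "B w w = 0" and vw: "cross v w \<noteq> (\<lambda>_. 0)"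
  obtains u where "B u u = 0" "u \<noteq> (\<lambda>_. 0)" "line u \<notin> L"
proof -
  obtain z where z: "B v z = 0" "B w z = 0" "B z z \<noteq> 0" "B v w \<noteq> 0"
    using isotropic_basis[OF assms(2-)] by metis
  \<comment> \<open>The coefficient of \<open>w\<close> is the solution of the linear equation that
    remains of \<open>B u u = 0\<close>. Pairing with \<open>w\<close> gives a constant, which fixes
    the scaling of \<open>u g\<close>, and pairing with \<open>z\<close> recovers \<open>g\<close>;
    hence the lines are distinct.\<close>
  define u where "u g = (\<lambda>i. v i + g * z i + (- g\<^sup>2 * B z z / (2 * B v w)) * w i)" for g
  have uu: "B (u g) (u g) = 0" for g
    using z(4) unfolding u_def
    by (simp only: B_simps v w z B_sym[of z v] B_sym[of z w] B_sym[of w v])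
       (simp add: z(4) field_simps power2_eq_square)
  have uz: "B (u g) z = g * B z z" for g
    unfolding u_def by (simp only: B_simps z) simp
  have uw: "B (u g) w = B v w" for g
    unfolding u_def by (simp only: B_simps z w B_sym[of z w]) simp
  have u0: "u g \<noteq> (\<lambda>_. 0)" for g
    using uw[of g] z(4) by (auto simp: B_def)
  let ?l = "\<lambda>g. line (u g)"
  have "inj ?l"
  proof (rule injI)
    fix g h assume "?l g = ?l h"
    then obtain c where c: "u g = (\<lambda>i. c * u h i)"
      using mem_line[of "u g"] unfolding line_def[of "u h"] by auto
    have "B (u g) w = c * B (u h) w" by (subst c) (rule B_scale)
    then have "c = 1" using z(4) uw by simp
    then have "B (u g) z = B (u h) z" using c by simp
    then show "g = h" using uz z(3) by simp
  qed
  then have "infinite (range ?l)"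
    using infinite_UNIV_char_0[where 'a = 'k] finite_image_iff by blast
  then obtain g where "?l g \<notin> L"
    using assms(1) by (metis (no_types, lifting) finite_subset image_subsetI)
  then show ?thesis using that[of "u g"] uu u0 by blast
qed

end


section \<open>Quadratic forms as polynomials and the normal form of a conic\<close>

lemma homog_0_const: "f \<in> homog 0 \<Longrightarrow> \<exists>c. f = pconst c"
proof (rule exI[of _ "lookup f 0"], rule poly_mapping_eqI)
  fix m assume f: "f \<in> homog 0"
  show "lookup f m = lookup (pconst (lookup f 0)) m"
  proof (cases "m = 0")
    case False
    then have "\<exists>i. lookup m i \<noteq> 0" by (metis lookup_zero poly_mapping_eqI)
    then have "(\<Sum>i\<in>UNIV. lookup m i) \<noteq> 0" by auto
    then have "m \<notin> keys f" using f by (auto simp: homog_def simp del: of_nat_sum)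
    then show ?thesis using False by (simp add: pconst_def lookup_single when_def in_keys_iff)
  qed (simp add: pconst_def)
qed

lemma partial_deriv_commute: "partial_deriv i (partial_deriv j f) = partial_deriv j (partial_deriv i f)"
  by (induction f arbitrary: i j rule: poly3_induct)
    (simp_all add: partial_deriv_add partial_deriv_mult partial_deriv_pvar algebra_simps
      partial_deriv_pconst[of _ 0, simplified] partial_deriv_pconst[of _ 1, simplified])

definition linform :: "(3 \<Rightarrow> 'k::field) \<Rightarrow> 'k poly3"
  where "linform a = (\<Sum>i\<in>UNIV. pconst (a i) * pvar i)"

lemma linform_homog: "linform a \<in> homog 1"
  unfolding linform_def using homog_mult[OF homog_pconst homog_pvar] by (intro homog_sum) simp

lemma linform_scale: "linform (\<lambda>i. s * a i) = pconst s * linform a"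
  by (simp add: linform_def sum_distrib_left pconst.hom_mult mult.assoc)

lemma linform_mult: "linform a * linform a' = (\<Sum>i\<in>UNIV. \<Sum>j\<in>UNIV. pconst (a i * a' j) * (pvar i * pvar j))"
  by (simp add: linform_def sum_product pconst.hom_mult mult_ac)

text \<open>\<open>b\<close> is the matrix of second derivatives, symmetric because they commute.
  Euler's formula for the linear forms \<open>partial_deriv j C\<close> and then for
  \<open>C\<close> gives the expressions; the factor 2 is the degree of \<open>C\<close>.\<close>

lemma quadratic_form:
  fixes C :: "'k::field_char_0 poly3"
  assumes "C \<in> homog 2"
  obtains b where "\<And>i j. b i j = b j i"
    "\<And>j. partial_deriv j C = linform (\<lambda>i. b i j)"
    "pconst 2 * C = (\<Sum>i\<in>UNIV. \<Sum>j\<in>UNIV. pconst (b i j) * (pvar i * pvar j))"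
proof -
  have "\<exists>c. partial_deriv i (partial_deriv j C) = pconst c" for i j
    using partial_deriv_homog[OF partial_deriv_homog[OF assms, of j], of i]
    by (intro homog_0_const) simp
  then obtain b where b: "\<And>i j. partial_deriv i (partial_deriv j C) = pconst (b i j)" by metis
  have pc: "pconst c = pconst d \<longleftrightarrow> c = d" for c d :: 'k
    by (metis pconst_def lookup_single_eq)
  have 1: "b i j = b j i" for i j using partial_deriv_commute[of i j C] unfolding b pc .
  have 2: "partial_deriv j C = linform (\<lambda>i. b i j)" for j
    using euler[OF partial_deriv_homog[OF assms, of j]] unfolding b
    by (simp add: linform_def mult.commute)
  have "pconst 2 * C = (\<Sum>i\<in>UNIV. pvar i * partial_deriv i C)" using euler[OF assms] by simp
  also have "\<dots> = (\<Sum>i\<in>UNIV. \<Sum>j\<in>UNIV. pconst (b i j) * (pvar i * pvar j))"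
    by (simp add: 2 linform_def sum_distrib_left 1 mult_ac)
  finally show ?thesis using 1 2 by (intro that)
qed

lemma id_hom: "comm_ring_hom (id :: 'k::field \<Rightarrow> 'k)"
  by unfold_locales auto

lemma to_ac_hom: "comm_ring_hom (to_ac :: 'k::field \<Rightarrow> 'k alg_closure)"
  by unfold_locales auto

lemmas peval_hom = ev_hom[OF id_hom, folded peval_eq_ev]

lemma peval_pconst: "peval id v (pconst c) = c"
  by (simp add: peval_eq_ev ev_pconst[OF id_hom])

lemma peval_pvar: "peval id v (pvar i) = v i"
  by (simp add: peval_eq_ev ev_pvar[OF id_hom])

lemma peval_linform: "peval id v (linform a) = (\<Sum>i\<in>UNIV. a i * v i)"
proof -
  interpret p: comm_ring_hom "peval id v" by (rule peval_hom)
  show ?thesis by (simp add: linform_def p.hom_sum p.hom_mult peval_pconst peval_pvar)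
qed

text \<open>Connects rational points with the Jacobian criterion, which is stated over the algebraic
  closure.\<close>

lemma to_ac_peval: "to_ac (peval id v f) = peval to_ac (\<lambda>i. to_ac (v i)) f"
proof -
  interpret p: comm_ring_hom "peval id v" by (rule peval_hom)
  interpret q: comm_ring_hom "peval to_ac (\<lambda>i. to_ac (v i))"
    unfolding peval_eq_ev by (rule ev_hom[OF to_ac_hom])
  have "peval to_ac (\<lambda>i. to_ac (v i)) (pconst c) = to_ac c"
    "peval to_ac (\<lambda>i. to_ac (v i)) (pvar i) = to_ac (v i)" for c i
    by (simp_all add: peval_eq_ev ev_pconst[OF to_ac_hom] ev_pvar[OF to_ac_hom])
  then show ?thesis
    by (induction f rule: poly3_induct)
      (simp_all only: p.hom_add q.hom_add p.hom_mult q.hom_mult peval_pconst peval_pvar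
        to_ac_add to_ac_mult)
qed

lemma proj_planeE:
  assumes "P \<in> proj_plane"
  obtains v where "v \<noteq> (\<lambda>_. 0)" "P = line v"
  using assms unfolding proj_plane_def line_def by auto

lemma line_eqI:
  assumes "v = (\<lambda>i. s * w i)" "v \<noteq> (\<lambda>_. 0)"
  shows "line v = line w"
proof -
  have s: "s \<noteq> 0" using assms by auto
  show ?thesis
  proof (intro equalityI subsetI)
    fix u assume "u \<in> line v"
    then obtain c where "u = (\<lambda>i. c * v i)" by (auto simp: line_def)
    then show "u \<in> line w" unfolding line_def assms(1)
      by (auto simp flip: mult.assoc)
  next
    fix u assume "u \<in> line w"
    then obtain c where "u = (\<lambda>i. c * w i)" by (auto simp: line_def)
    then show "u \<in> line v" unfolding line_def assms(1) using s
      by (auto intro!: exI[of _ "c / s"])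
  qed
qed

lemma cross_neq_0:
  assumes "line v \<noteq> line w" "v \<noteq> (\<lambda>_. 0)" "w \<noteq> (\<lambda>_. 0)"
  shows "cross v w \<noteq> (\<lambda>_. 0)"
  using assms cross_eq_0_imp_parallel line_eqI by metis

text \<open>\<open>Y\<^sub>0\<close> is the tangent at a rational point of the conic outside \<open>L\<close>. This point becomes the point at
  infinity of the parametrisation, and the last conclusion says that all points of \<open>L\<close> have finite
  parameters.\<close>

lemma conic_normal_form:
  fixes C :: "'k::field_char_0 poly3"
  assumes C: "nonsingular_conic C" and L: "finite L" "L \<subseteq> proj_plane" "L \<subseteq> zero_locus C" "card L \<ge> 2"
  obtains x y :: "3 \<Rightarrow> 3 \<Rightarrow> 'k" and c where "c \<noteq> 0"
    "\<And>i j. (\<Sum>k\<in>UNIV. x i k * y k j) = (if i = j then 1 else 0)"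
    "\<And>i j. (\<Sum>k\<in>UNIV. y i k * x k j) = (if i = j then 1 else 0)"
    "C = pconst c * ((linform (y 1))\<^sup>2 - linform (y 0) * linform (y 2))"
    "\<And>P v. P \<in> L \<Longrightarrow> v \<in> P \<Longrightarrow> v \<noteq> (\<lambda>_. 0) \<Longrightarrow> (\<Sum>i\<in>UNIV. y 0 i * v i) \<noteq> 0"
proof -
  have C2: "C \<in> homog 2" using C by (simp add: nonsingular_conic_def)
  obtain b where b: "\<And>i j. b i j = b j i"
    "\<And>j. partial_deriv j C = linform (\<lambda>i. b i j)"
    "pconst 2 * C = (\<Sum>i\<in>UNIV. \<Sum>j\<in>UNIV. pconst (b i j) * (pvar i * pvar j))"
    using quadratic_form[OF C2] by blast
  have ev2: "2 * peval id v C = (\<Sum>i\<in>UNIV. \<Sum>j\<in>UNIV. v i * b i j * v j)" for v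
  proof -
    interpret p: comm_ring_hom "peval id v" by (rule peval_hom)
    show ?thesis using arg_cong[OF b(3), of "peval id v"]
      by (simp add: p.hom_mult p.hom_sum peval_pconst peval_pvar mult_ac)
  qed
  interpret nondeg_form b
  proof
    show "b i j = b j i" for i j by (rule b(1))
    fix p assume p: "\<And>j. (\<Sum>i\<in>UNIV. p i * b i j) = 0"
    have d0: "peval id p (partial_deriv j C) = 0" for j
      using p[of j] by (simp add: b(2) peval_linform mult.commute)
    have "2 * peval id p C = (\<Sum>j\<in>UNIV. (\<Sum>i\<in>UNIV. p i * b i j) * p j)"
      unfolding ev2 by (subst sum.swap) (simp add: sum_distrib_right)
    then have c0: "peval id p C = 0" by (simp add: p)
    show "p = (\<lambda>_. 0)"
    proof (rule ccontr)
      assume "p \<noteq> (\<lambda>_. 0)"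
      then obtain k where "p k \<noteq> 0" by auto
      then have "to_ac (p k) \<noteq> 0" by (metis to_ac_0 to_ac_eq_iff)
      then have "(\<lambda>i. to_ac (p i)) \<noteq> (\<lambda>_. 0)" by metis
      moreover have "peval to_ac (\<lambda>i. to_ac (p i)) C = 0"
        unfolding to_ac_peval[symmetric] c0 by simp
      ultimately obtain j where "peval to_ac (\<lambda>i. to_ac (p i)) (partial_deriv j C) \<noteq> 0"
        using C unfolding nonsingular_conic_def by blast
      then show False unfolding to_ac_peval[symmetric] d0 by simp
    qed
  qed
  have evB: "2 * peval id v C = B v v" for v unfolding ev2 B_def ..
  have iso: "B v v = 0" if "P \<in> L" "v \<in> P" for P v
    using that L(3) evB[of v] by (auto simp: zero_locus_def)
  obtain P1 P2 where P: "P1 \<in> L" "P2 \<in> L" "P1 \<noteq> P2"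
    using L(4) by (metis One_nat_def card.infinite card_le_Suc0_iff_eq not_less_eq_eq numeral_2_eq_2 zero_le)
  obtain v1 where v1: "v1 \<noteq> (\<lambda>_. 0)" "P1 = line v1" using P L by (metis proj_planeE subsetD)
  obtain v2 where v2: "v2 \<noteq> (\<lambda>_. 0)" "P2 = line v2" using P L by (metis proj_planeE subsetD)
  have i1: "B v1 v1 = 0" "B v2 v2 = 0" using iso P v1 v2 mem_line by metis+
  have cv12: "cross v1 v2 \<noteq> (\<lambda>_. 0)" using cross_neq_0 v1 v2 P by metis
  obtain v where v: "B v v = 0" "v \<noteq> (\<lambda>_. 0)" "line v \<notin> L"
    using isotropic_avoiding[OF L(1) i1 cv12] by blast
  define w where "w = v1"
  have w: "B w w = 0" "w \<noteq> (\<lambda>_. 0)" using i1 v1 by (auto simp: w_def)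
  have cvw: "cross v w \<noteq> (\<lambda>_. 0)" using v w P v1 cross_neq_0 by (metis w_def)
  obtain z where z: "B v z = 0" "B w z = 0" "B z z \<noteq> 0" "B v w \<noteq> 0"
    "\<And>p i. p i = B p w / B v w * v i + B p v / B v w * w i + B p z / B z z * z i"
    using isotropic_basis[OF v(1) w(1) cvw] by blast
  define d where "d = B z z"
  define e where "e = B v w"
  \<comment> \<open>The expansion of \<open>C\<close> is \<open>1 / (2 * d)\<close> times the square
    of \<open>cov z\<close> plus \<open>2 * d / e\<close> times \<open>cov v\<close> times
    \<open>cov w\<close>; scaling \<open>cov v\<close> by \<open>\<kappa>\<close> turns the second
    term into minus \<open>Y 0 * Y 2\<close>.\<close>
  define \<kappa> where "\<kappa> = - 2 * d / e"
  have nz: "d \<noteq> 0" "e \<noteq> 0" "\<kappa> \<noteq> 0" using z by (auto simp: d_def e_def \<kappa>_def)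
  define y where "y = (\<lambda>k::3. if k = 0 then (\<lambda>i. \<kappa> * cov v i) else if k = 1 then cov z else cov w)"
  \<comment> \<open>The columns of \<open>x\<close> are the basis dual to the rows of
    \<open>y\<close>, read off from the expansion in \<open>isotropic_basis\<close>.\<close>
  define x where "x = (\<lambda>i k::3. if k = 0 then w i / (\<kappa> * e) else if k = 1 then z i / d else v i / e)"
  have y: "y 0 = (\<lambda>i. \<kappa> * cov v i)" "y 1 = cov z" "y 2 = cov w" by (simp_all add: y_def)
  have x: "x i 0 = w i / (\<kappa> * e)" "x i 1 = z i / d" "x i 2 = v i / e" for i by (simp_all add: x_def)
  let ?u = "\<lambda>j i. (if i = j then 1 else 0 :: 'k)"
  have Bu: "B p (?u j) = cov p j" for p j
    by (simp add: B_cov if_distrib cong: if_cong)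
  have ex: "?u j i = cov w j / e * v i + cov v j / e * w i + cov z j / d * z i" for i j
    using z(5)[of "?u j" i] unfolding B_sym[of "?u j"] Bu d_def e_def .
  have xy: "(\<Sum>k\<in>UNIV. x i k * y k j) = (if i = j then 1 else 0)" for i j
    unfolding ex using nz by (simp add: sum_UNIV_3 x y mult_ac)
  have yx: "(\<Sum>k\<in>UNIV. y i k * x k j) = (if i = j then 1 else 0)" for i j
  proof -
    have s: "(\<Sum>k\<in>UNIV. cov p k * (q k / r)) = B p q / r" for p q r
      by (simp add: B_cov sum_divide_distrib)
    have s': "(\<Sum>k\<in>UNIV. \<kappa> * cov p k * (q k / r)) = \<kappa> * B p q / r" for p q r
      by (simp add: B_cov sum_divide_distrib sum_distrib_left mult.assoc)
    have "\<forall>i j. (\<Sum>k\<in>UNIV. y i k * x k j) = (if i = j then 1 else 0)"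
      unfolding all_3 x y s s'
      using nz z(1,2) by (simp add: B_sym[of w v] B_sym[of z v] B_sym[of z w] v w flip: d_def e_def)
    then show ?thesis by blast
  qed
  have bij: "b i j = cov w i * cov v j / e + cov v i * cov w j / e + cov z i * cov z j / d" for i j
  proof -
    have "cov (?u i) j = b i j" by (simp add: cov_def if_distrib[where f = "\<lambda>t. t * b _ j"] cong: if_cong)
    then have "b i j = B (?u i) (?u j)" unfolding Bu ..
    also have "\<dots> = (\<Sum>k\<in>UNIV. cov (?u i) k * ?u j k)" by (rule B_cov)
    also have "\<dots> = B (?u i) (\<lambda>k. cov w j / e * v k + cov v j / e * w k + cov z j / d * z k)"
      unfolding ex[of _ j] by (rule B_cov[symmetric])
    also have "\<dots> = cov w j / e * cov v i + cov v j / e * cov w i + cov z j / d * cov z i"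
      unfolding B_add2 B_scale2 B_sym[of "?u i"] Bu ..
    finally show ?thesis by (simp add: mult_ac)
  qed
  have bij': "pconst (b i j) * (pvar i * pvar j) = pconst (1 / e) * (pconst (cov w i * cov v j) * (pvar i * pvar j))
      + pconst (1 / e) * (pconst (cov v i * cov w j) * (pvar i * pvar j))
      + pconst (1 / d) * (pconst (cov z i * cov z j) * (pvar i * pvar j))" for i j
    by (subst bij) (simp add: add_divide_distrib flip: pconst.hom_add pconst.hom_mult mult.assoc distrib_right)
  have "pconst 2 * C = pconst (1 / e) * (linform (cov w) * linform (cov v))
      + pconst (1 / e) * (linform (cov v) * linform (cov w))
      + pconst (1 / d) * (linform (cov z) * linform (cov z))"
    by (simp only: b(3) bij' linform_mult sum.distrib sum_distrib_left)
  then have "pconst (1 / 2) * (pconst 2 * C) = pconst (1 / 2) * (pconst (2 / e) * (linform (cov v) * linform (cov w))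
      + pconst (1 / d) * (linform (cov z) * linform (cov z)))"
    by (simp add: mult.commute flip: pconst.hom_add distrib_right)
  then have "C = pconst (1 / 2) * (pconst (2 / e) * (linform (cov v) * linform (cov w))
      + pconst (1 / d) * (linform (cov z) * linform (cov z)))"
    by (simp flip: pconst.hom_mult mult.assoc)
  also have "\<dots> = pconst (1 / (2 * d)) * ((linform (y 1))\<^sup>2 - linform (y 0) * linform (y 2))"
  proof -
    have k: "pconst (1 / (2 * d)) * pconst \<kappa> = - pconst (1 / e)"
      "pconst (1 / 2) * pconst (2 / e) = pconst (1 / e)" "pconst (1 / 2) * pconst (1 / d) = pconst (1 / (2 * d))"
      using nz by (simp_all add: \<kappa>_def flip: pconst.hom_mult pconst.hom_uminus)
    have "pconst (1 / (2 * d)) * ((linform (y 1))\<^sup>2 - linform (y 0) * linform (y 2)) =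
        pconst (1 / (2 * d)) * (linform (cov z) * linform (cov z)) - (pconst (1 / (2 * d)) * pconst \<kappa>) * (linform (cov v) * linform (cov w))"
      by (simp only: y linform_scale power2_eq_square right_diff_distrib mult.assoc)
    then show ?thesis unfolding k by (simp only: distrib_left k flip: mult.assoc) simp
  qed
  finally have Cy: "C = pconst (1 / (2 * d)) * ((linform (y 1))\<^sup>2 - linform (y 0) * linform (y 2))" .
  \<comment> \<open>The linear form \<open>y 0\<close> is a multiple of the polar of
    \<open>v\<close>; by \<open>isotropic_pair\<close> it does not vanish at a point of the conic
    other than \<open>line v\<close>.\<close>
  have ny: "(\<Sum>i\<in>UNIV. y 0 i * p i) \<noteq> 0" if p: "P \<in> L" "p \<in> P" "p \<noteq> (\<lambda>_. 0)" for P p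
  proof -
    have "(\<Sum>i\<in>UNIV. y 0 i * p i) = \<kappa> * B v p" by (simp add: y B_cov sum_distrib_left mult.assoc)
    obtain p' where p': "P = line p'" using p L by (metis proj_planeE subsetD)
    then obtain a where "p = (\<lambda>i. a * p' i)" using p by (auto simp: line_def)
    then have "P = line p" using p line_eqI[of p a p'] p' by simp
    then have "cross v p \<noteq> (\<lambda>_. 0)" using p v cross_neq_0 by metis
    then have "B v p \<noteq> 0" using isotropic_pair v iso p by blast
    then show ?thesis using \<open>_ = \<kappa> * B v p\<close> nz by simp
  qed
  show ?thesis by (rule that[OF _ xy yx Cy ny]) (use nz in auto)
qed

subsection \<open>Ideals of type class rings\<close>

lemma ideal_class_ringI:
  fixes I :: "'a::comm_ring_1 set"
  assumes "0 \<in> I" "\<And>a b. a \<in> I \<Longrightarrow> b \<in> I \<Longrightarrow> a + b \<in> I" "\<And>r a. a \<in> I \<Longrightarrow> r * a \<in> I"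
  shows "ideal I class_ring"
proof (rule idealI)
  show "ring (class_ring :: 'a ring)" by (rule class_ring.ring_axioms)
  have "- a \<in> I" if "a \<in> I" for a using assms(3)[OF that, of "-1"] by simp
  moreover have "inv\<^bsub>add_monoid class_ring\<^esub> a = - a" for a :: 'a
  proof -
    have "\<ominus>\<^bsub>class_ring\<^esub> a = - a" by (simp add: class_ring_simps)
    then show ?thesis by (simp add: a_inv_def)
  qed
  ultimately show "subgroup I (add_monoid class_ring)"
    using assms by (unfold_locales) (auto simp: Units_def)
qed (use assms(3) in \<open>auto simp: mult.commute\<close>)

context
  fixes I :: "'a::comm_ring_1 set"
  assumes I: "ideal I class_ring"
begin

interpretation ideal I class_ring by (rule I)

lemma ideal_0: "0 \<in> I" using zero_closed by simp
lemma ideal_add: "a \<in> I \<Longrightarrow> b \<in> I \<Longrightarrow> a + b \<in> I" using a_closed by simp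
lemma ideal_mult_left: "a \<in> I \<Longrightarrow> r * a \<in> I" using I_l_closed[of a r] by simp
lemma ideal_mult_right: "a \<in> I \<Longrightarrow> a * r \<in> I" using I_r_closed[of a r] by simp
lemma ideal_uminus: "a \<in> I \<Longrightarrow> - a \<in> I" using ideal_mult_left[of a "-1"] by simp
lemma ideal_diff: "a \<in> I \<Longrightarrow> b \<in> I \<Longrightarrow> a - b \<in> I" using ideal_add[of a "-b"] ideal_uminus by simp
lemma ideal_sum: "(\<And>x. x \<in> S \<Longrightarrow> f x \<in> I) \<Longrightarrow> sum f S \<in> I"
  by (induction S rule: infinite_finite_induct) (auto intro: ideal_add ideal_0)

end

lemma ideal_colon: "ideal J class_ring \<Longrightarrow> ideal {a. a * b \<in> J} (class_ring :: 'a::comm_ring_1 ring)"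
  by (rule ideal_class_ringI) (auto simp: ideal_0 distrib_right mult.assoc ideal_add ideal_mult_left)

lemma ideal_UNIV: "ideal (UNIV :: 'a::comm_ring_1 set) class_ring"
  by (rule ideal_class_ringI) auto

lemma ideal_INT:
  "(\<And>x. x \<in> S \<Longrightarrow> ideal (I x) class_ring) \<Longrightarrow> ideal (\<Inter>x\<in>S. I x :: 'a::comm_ring_1 set) class_ring"
  by (rule ideal_class_ringI) (auto intro: ideal_0 ideal_add ideal_mult_left)

lemma ideal_genideal: "ideal (genideal class_ring S :: 'a::comm_ring_1 set) class_ring"
  by (rule ring.genideal_ideal[OF class_ring.ring_axioms]) simp

lemma genideal_mem: "x \<in> S \<Longrightarrow> x \<in> genideal class_ring (S :: 'a::comm_ring_1 set)"
  using ring.genideal_self[OF class_ring.ring_axioms, of S] by auto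

lemma genideal_subset: "ideal J class_ring \<Longrightarrow> S \<subseteq> J \<Longrightarrow> genideal class_ring (S :: 'a::comm_ring_1 set) \<subseteq> J"
  by (rule ring.genideal_minimal[OF class_ring.ring_axioms])

lemma ideal_ideal_prod:
  "ideal I class_ring \<Longrightarrow> ideal J class_ring \<Longrightarrow> ideal (ideal_prod class_ring I J :: 'a::comm_ring_1 set) class_ring"
  by (rule ring.ideal_prod_is_ideal[OF class_ring.ring_axioms])

lemma ideal_prod_mem: "a \<in> I \<Longrightarrow> b \<in> J \<Longrightarrow> a * b \<in> ideal_prod class_ring I (J :: 'a::comm_ring_1 set)"
  using ideal_prod.prod[of a I b J "class_ring"] by simp

lemma ideal_prod_induct [consumes 1, case_names mult add]:
  assumes "f \<in> ideal_prod class_ring I (J :: 'a::comm_ring_1 set)"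
    and "\<And>a b. a \<in> I \<Longrightarrow> b \<in> J \<Longrightarrow> P (a * b)" and "\<And>f g. P f \<Longrightarrow> P g \<Longrightarrow> P (f + g)"
  shows "P f"
  using assms(1) by induction (use assms(2,3) in auto)

definition ipow :: "'a::comm_ring_1 set \<Rightarrow> nat \<Rightarrow> 'a set"
  where "ipow I k = I [^]\<^bsub>ideals_set class_ring\<^esub> k"

lemma ideal_pow_0: "ipow I 0 = (UNIV :: 'a::comm_ring_1 set)"
  by (simp add: ipow_def nat_pow_def ideals_set_def)

lemma ideal_pow_Suc: "ipow I (Suc k) = ideal_prod class_ring (ipow I k) (I :: 'a::comm_ring_1 set)"
  by (simp add: ipow_def nat_pow_def ideals_set_def)

lemma ideal_pow:
  "ideal I class_ring \<Longrightarrow> ideal (ipow I k :: 'a::comm_ring_1 set) class_ring"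
  by (induction k) (simp_all add: ideal_pow_0 ideal_pow_Suc ideal_UNIV ideal_ideal_prod)

lemma ideal_pow_add:
  assumes I: "ideal I class_ring" and "a \<in> ipow I k" "b \<in> ipow I l"
  shows "a * b \<in> (ipow I (k + l) :: 'a::comm_ring_1 set)"
  using assms(3)
proof (induction l arbitrary: b)
  case 0
  then show ?case using assms(2) by (simp add: ideal_mult_right[OF ideal_pow[OF I]])
next
  case (Suc l)
  from Suc.prems show ?case unfolding ideal_pow_Suc
  proof (induction rule: ideal_prod_induct)
    case (mult c d)
    then show ?case using ideal_prod_mem[OF Suc.IH[OF mult(1)] mult(2)]
      by (simp add: ideal_pow_Suc mult.assoc)
  next
    case (add f g)
    then show ?case by (simp add: distrib_left ideal_add[OF ideal_pow[OF I]])
  qed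
qed

lemma ideal_pow_antimono:
  assumes "ideal I class_ring" "k \<le> l"
  shows "ipow I l \<subseteq> (ipow I k :: 'a::comm_ring_1 set)"
proof
  fix a assume "a \<in> ipow I l"
  with assms(2) show "a \<in> ipow I k"
  proof (induction l arbitrary: a rule: dec_induct)
    case (step l)
    have "\<forall>a \<in> ideal_prod class_ring (ipow I l) I. a \<in> ipow I l"
      using ring.ideal_prod_inter[OF class_ring.ring_axioms ideal_pow[OF assms(1)] assms(1)] by blast
    then show ?case using step by (auto simp: ideal_pow_Suc)
  qed auto
qed

lemma ideal_pow_1: "a \<in> I \<Longrightarrow> a \<in> (ipow I (Suc 0) :: 'a::comm_ring_1 set)"
  using ideal_prod_mem[of 1 UNIV a I] by (simp add: ideal_pow_Suc ideal_pow_0)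

text \<open>Used twice: for \<open>\<rho>\<close> with the linear factor of a point, and for
  \<open>\<theta>\<close> with the contraction parameter.\<close>

lemma hom_ideal_pow_dvd:
  fixes \<sigma> :: "'a::comm_ring_1 \<Rightarrow> 'b::comm_ring_1"
  assumes "comm_ring_hom \<sigma>" and "\<And>f. f \<in> I \<Longrightarrow> t dvd \<sigma> f"
    and "f \<in> ipow I k"
  shows "t ^ k dvd \<sigma> f"
proof -
  interpret comm_ring_hom \<sigma> by fact
  show ?thesis using assms(3)
  proof (induction k arbitrary: f)
    case (Suc k)
    from Suc.prems show ?case unfolding ideal_pow_Suc
    proof (induction rule: ideal_prod_induct)
      case (mult a b)
      then show ?case using mult_dvd_mono[OF Suc.IH[OF mult(1)] assms(2)[OF mult(2)]]
        by (simp add: hom_mult mult.commute)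
    qed (simp add: hom_add)
  qed simp
qed

lemma ideal_pow_graded:
  fixes I :: "'k::field poly3 set"
  assumes I: "ideal I class_ring" and g: "\<And>f n. f \<in> I \<Longrightarrow> coeff (\<chi> f) n \<in> I"
    and "f \<in> ipow I k"
  shows "coeff (\<chi> f) n \<in> ipow I k"
  using assms(3)
proof (induction k arbitrary: f n)
  case (Suc k)
  from Suc.prems have "\<forall>n. coeff (\<chi> f) n \<in> ipow I (Suc k)" unfolding ideal_pow_Suc
  proof (induction rule: ideal_prod_induct)
    case (mult a b)
    show ?case using Suc.IH[OF mult(1)] g[OF mult(2)]
      by (auto simp: \<chi>.hom_mult coeff_mult intro!: ideal_sum[OF ideal_ideal_prod[OF ideal_pow[OF I] I]] ideal_prod_mem)
  next
    case (add f g)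
    then show ?case by (auto simp: \<chi>.hom_add ideal_add[OF ideal_ideal_prod[OF ideal_pow[OF I] I]])
  qed
  then show ?case by simp
qed (simp add: ideal_pow_0)

section \<open>Vanishing ideals and the irrelevant ideal: gradings and derivatives\<close>

lemma ideal_vanishing_ideal: "ideal (vanishing_ideal P) class_ring"
  unfolding vanishing_ideal_def by (rule ideal_genideal)

text \<open>The polynomials all of whose homogeneous components lie in the vanishing ideal form an
  ideal, and it contains the homogeneous generators.\<close>

lemma vanishing_ideal_graded:
  assumes "f \<in> vanishing_ideal P"
  shows "coeff (\<chi> f) n \<in> vanishing_ideal P"
proof -
  let ?J = "{f. \<forall>n. coeff (\<chi> f) n \<in> vanishing_ideal P}"
  note J = ideal_vanishing_ideal[of P]
  have "vanishing_ideal P \<subseteq> ?J"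
    unfolding vanishing_ideal_def[of P]
  proof (rule genideal_subset, fold vanishing_ideal_def)
    show "ideal ?J class_ring"
      by (rule ideal_class_ringI) (auto simp: \<chi>.hom_add \<chi>.hom_mult coeff_mult ideal_0[OF J]
        intro!: ideal_add[OF J] ideal_sum[OF J] ideal_mult_left[OF J])
    show "{f. (\<exists>d. f \<in> homog d) \<and> P \<in> zero_locus f} \<subseteq> ?J"
    proof safe
      fix f d n assume f: "f \<in> homog d" "P \<in> zero_locus f"
      then have fP: "f \<in> vanishing_ideal P" unfolding vanishing_ideal_def by (intro genideal_mem) auto
      show "coeff (\<chi> f) n \<in> vanishing_ideal P"
      proof (cases "d < 0")
        case True
        then have "f = 0" using homog_neg f by blast
        then show ?thesis by (simp add: ideal_0[OF J])
      next
        case False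
        then have "\<chi> f = monom f (nat d)" using \<chi>_homog[of f "nat d"] f by simp
        then show ?thesis using fP by (simp add: ideal_0[OF J])
      qed
    qed
  qed
  then show ?thesis using assms by blast
qed

text \<open>Leibniz: in a product of \<open>k + 1\<close> factors from \<open>I\<close> the
  derivative spoils only one of them.\<close>

lemma partial_deriv_ideal_pow:
  fixes I :: "'k::field poly3 set"
  assumes I: "ideal I class_ring" and "f \<in> ipow I (Suc k)"
  shows "partial_deriv i f \<in> ipow I k"
  using assms(2)
proof (induction k arbitrary: f)
  case (Suc k)
  note J = ideal_pow[OF I, of "Suc k"]
  from Suc.prems show ?case unfolding ideal_pow_Suc[of _ "Suc k"]
  proof (induction rule: ideal_prod_induct)
    case (mult a b)
    have "partial_deriv i a * b \<in> ipow I (Suc k)"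
      unfolding ideal_pow_Suc[of _ k] by (intro ideal_prod_mem Suc.IH mult)
    then show ?case
      by (auto simp: partial_deriv_mult intro!: ideal_add[OF J] ideal_mult_right[OF J] mult(1))
  qed (simp add: partial_deriv_add ideal_add[OF J])
qed (simp add: ideal_pow_0)

lemma irrelevant_ideal: "ideal irrelevant_ideal class_ring"
  unfolding irrelevant_ideal_def by (rule ideal_genideal)

lemma pvar_irrelevant: "pvar i \<in> irrelevant_ideal"
  unfolding irrelevant_ideal_def by (intro genideal_mem) auto

lemma euler_div:
  fixes f :: "'k::field_char_0 poly3"
  assumes "f \<in> homog d" "d \<noteq> 0"
  shows "f = (\<Sum>i\<in>UNIV. pvar i * (pconst (1 / of_int d) * partial_deriv i f))"
proof -
  have "(\<Sum>i\<in>UNIV. pvar i * (pconst (1 / of_int d) * partial_deriv i f))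
      = pconst (1 / of_int d) * (\<Sum>i\<in>UNIV. pvar i * partial_deriv i f)"
    by (simp add: sum_distrib_left mult_ac)
  also have "\<dots> = f" unfolding euler[OF assms(1)] using assms(2)
    by (simp flip: mult.assoc pconst.hom_mult)
  finally show ?thesis ..
qed

lemma homog_irrelevant:
  fixes f :: "'k::field_char_0 poly3"
  assumes "f \<in> homog d" "d \<noteq> 0"
  shows "f \<in> irrelevant_ideal"
  by (subst euler_div[OF assms], intro ideal_sum[OF irrelevant_ideal] ideal_mult_right[OF irrelevant_ideal] pvar_irrelevant)

subsection \<open>Univariate polynomials\<close>

text \<open>Factors belonging to different roots are coprime: the product over the other roots has
  order 0 at \<open>a\<close>, so the whole multiplicity at \<open>a\<close> sits in the
  cofactor.\<close>

lemma linear_powers_dvd: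
  fixes p :: "'k::field poly"
  assumes "finite S" "\<And>a. a \<in> S \<Longrightarrow> [:-a, 1:] ^ n dvd p"
  shows "(\<Prod>a\<in>S. [:-a, 1:] ^ n) dvd p"
  using assms
proof (induction S arbitrary: p rule: finite_induct)
  case (insert a S)
  obtain q where q: "p = (\<Prod>a\<in>S. [:-a, 1:] ^ n) * q" using insert by (auto elim!: dvdE)
  show ?case
  proof (cases "p = 0")
    case False
    have o: "order a (\<Prod>a\<in>S. [:-a, 1:] ^ n) = 0"
      using insert(1,2) by (intro order_0I) (auto simp: poly_prod)
    have "n \<le> order a p" using insert(4)[of a] False by (simp add: order_divides)
    then have "n \<le> order a q" using False unfolding q by (subst (asm) order_mult) (auto simp: o)
    then have "[:-a, 1:] ^ n dvd q" by (simp add: order_divides)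
    then show ?thesis using insert(1,2) unfolding q
      by (simp add: mult_dvd_mono mult.commute)
  qed simp
qed simp

lemma X_pow_dvd_coeff:
  assumes "[:0, 1:] ^ k dvd (p :: 'a::comm_ring_1 poly)" "j < k"
  shows "coeff p j = 0"
proof -
  have "[:0, 1 :: 'a:] ^ k = monom 1 k" by (simp add: monom_altdef)
  then show ?thesis using assms by (auto elim!: dvdE simp: coeff_monom_mult)
qed

lemma degree_diff_monom:
  assumes "Polynomial.degree (p :: 'a::comm_ring_1 poly) \<le> Suc n"
  shows "Polynomial.degree (p - monom (coeff p (Suc n)) (Suc n)) \<le> n"
  by (rule degree_le) (use assms in \<open>auto simp: coeff_eq_0\<close>)

text \<open>The list is consumed two entries at a time, and only the two entries of such a pair have
  to differ: they are the parameters of two points to be joined by a line. A last single entry is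
  allowed.\<close>

fun no_equal_pairs :: "'a list \<Rightarrow> bool" where
  "no_equal_pairs (a # b # as) \<longleftrightarrow> a \<noteq> b \<and> no_equal_pairs as"
| "no_equal_pairs _ \<longleftrightarrow> True"

lemma no_equal_pairs_successively: "successively (\<noteq>) as \<Longrightarrow> no_equal_pairs as"
  by (induction as rule: no_equal_pairs.induct) (auto simp: successively_Cons)

text \<open>Running through the points cyclically keeps neighbours distinct also at the seams. Thus
  the repeated list can be cut into pairs of distinct points, whatever the parity of the number of
  points.\<close>

lemma successively_concat_replicate:
  assumes "distinct as" "length as \<ge> 2"
  shows "successively (\<noteq>) (concat (replicate n as))"
proof (induction n)
  case (Suc n)
  have "successively (\<noteq>) as" using assms(1)
    by (induction as) (auto simp: successively_Cons)
  moreover have "last as \<noteq> hd as" using assms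
    by (cases as) auto
  moreover have "hd (concat (replicate n as)) = hd as" if "concat (replicate n as) \<noteq> []"
    using that by (cases n) (auto simp: hd_append)
  ultimately show ?case using Suc by (auto simp: successively_append_iff)
qed simp

lemma count_list_concat_replicate: "count_list (concat (replicate n as)) a = n * count_list as a"
  by (induction n) (auto simp: count_list_append)

lemma count_list_distinct: "distinct as \<Longrightarrow> count_list as a = (if a \<in> set as then 1 else 0)"
  by (induction as) auto

lemma prod_list_concat_replicate: "prod_list (map h (concat (replicate n as))) = prod_list (map h as) ^ n"
  for h :: "'a \<Rightarrow> 'b::comm_monoid_mult"
  by (induction n) auto

subsection \<open>Fat points on a parametrised conic\<close>

text \<open>The data of \<open>conic_normal_form\<close>: the rows of \<open>y\<close> are the new
  coordinates, the columns of the inverse matrix \<open>x\<close> are the coefficients of 1, u, u^2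
  in the parametrisation, and \<open>A\<close> is the set of parameters of the given points.\<close>

locale conic_points =
  fixes x y :: "3 \<Rightarrow> 3 \<Rightarrow> 'k::field_char_0" and c :: 'k and A :: "'k set"
  assumes xy: "(\<Sum>k\<in>UNIV. x i k * y k j) = (if i = j then 1 else 0)"
    and yx: "(\<Sum>k\<in>UNIV. y i k * x k j) = (if i = j then 1 else 0)"
    and c_nonzero: "c \<noteq> 0" and finite_A: "finite A" and card_A: "card A \<ge> 4"
begin

definition Y :: "3 \<Rightarrow> 'k poly3"
  where "Y k = linform (y k)"

definition C :: "'k poly3"
  where "C = pconst c * ((Y 1)\<^sup>2 - Y 0 * Y 2)"

definition pt :: "'k \<Rightarrow> 3 \<Rightarrow> 'k"
  where "pt a i = x i 0 + x i 1 * a + x i 2 * a\<^sup>2"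

definition vi :: "'k \<Rightarrow> 'k poly3 set"
  where "vi a = vanishing_ideal (line (pt a))"

definition I :: "nat \<Rightarrow> 'k poly3 set"
  where "I \<mu> = (\<Inter>a\<in>A. ipow (vi a) \<mu>)"

definition MI :: "nat \<Rightarrow> 'k poly3 set"
  where "MI \<mu> = ideal_prod class_ring irrelevant_ideal (I \<mu>)"

lemma Y_homog: "Y k \<in> homog 1"
  unfolding Y_def by (rule linform_homog)

lemma C_homog: "C \<in> homog 2"
  unfolding C_def power2_eq_square
  using homog_mult[OF homog_pconst homog_diff[OF homog_mult[OF Y_homog[of 1] Y_homog[of 1]] homog_mult[OF Y_homog[of 0] Y_homog[of 2]]], of c]
  by simp

lemma pvar_eq_Y: "pvar i = (\<Sum>k\<in>UNIV. pconst (x i k) * Y k)"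
proof -
  have "(\<Sum>k\<in>UNIV. pconst (x i k) * Y k) = (\<Sum>k\<in>UNIV. \<Sum>j\<in>UNIV. pconst (x i k * y k j) * pvar j)"
    by (simp add: Y_def linform_def sum_distrib_left pconst.hom_mult mult.assoc)
  also have "\<dots> = (\<Sum>j\<in>UNIV. pconst (\<Sum>k\<in>UNIV. x i k * y k j) * pvar j)"
    by (subst sum.swap) (simp add: pconst.hom_sum sum_distrib_right)
  also have "\<dots> = pvar i"
    by (simp add: xy if_distrib[of pconst] if_distrib[of "\<lambda>t. t * _"] cong: if_cong)
  finally show ?thesis ..
qed

lemma Y_irrelevant: "Y k \<in> irrelevant_ideal"
  by (rule homog_irrelevant[OF Y_homog]) simp

lemma irrelevant_subset:
  assumes "ideal J class_ring" "\<And>k. Y k \<in> J"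
  shows "irrelevant_ideal \<subseteq> J"
  unfolding irrelevant_ideal_def
proof (rule genideal_subset[OF assms(1)], safe)
  fix i show "pvar i \<in> J" unfolding pvar_eq_Y
    by (intro ideal_sum[OF assms(1)] ideal_mult_left[OF assms(1)] assms(2))
qed

subsubsection \<open>Restriction to the conic\<close>

text \<open>Restriction to the conic, dehomogenised at the point at infinity: \<open>Y 0\<close>,
  \<open>Y 1\<close>, \<open>Y 2\<close> go to 1, u, u^2. A binary form of degree 2e is represented
  by a polynomial of degree at most \<open>2 * e\<close>, so degree bounds take the place of
  degrees.\<close>

definition \<rho> :: "'k poly3 \<Rightarrow> 'k poly"
  where "\<rho> = ev (\<lambda>a. [:a:]) (\<lambda>i. [:x i 0, x i 1, x i 2:])"

lemma const_poly_hom: "comm_ring_hom (\<lambda>a::'k. [:a:])"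
  by unfold_locales auto

sublocale \<rho>: comm_ring_hom \<rho>
  unfolding \<rho>_def by (rule ev_hom[OF const_poly_hom])

lemma \<rho>_pconst: "\<rho> (pconst a) = [:a:]"
  by (simp add: \<rho>_def ev_pconst[OF const_poly_hom])

lemma \<rho>_pvar: "\<rho> (pvar i) = [:x i 0, x i 1, x i 2:]"
  by (simp add: \<rho>_def ev_pvar[OF const_poly_hom])

lemma \<rho>_Y: "\<rho> (Y k) = [:if k = 0 then 1 else 0, if k = 1 then 1 else 0, if k = 2 then 1 else 0:]"
proof -
  have "\<rho> (Y k) = [:\<Sum>j\<in>UNIV. y k j * x j 0, \<Sum>j\<in>UNIV. y k j * x j 1, \<Sum>j\<in>UNIV. y k j * x j 2:]"
    by (simp add: Y_def linform_def \<rho>.hom_add \<rho>.hom_mult \<rho>_pconst \<rho>_pvar sum_UNIV_3)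
  then show ?thesis by (simp add: yx)
qed

lemma \<rho>_Ys: "\<rho> (Y 0) = 1" "\<rho> (Y 1) = [:0, 1:]" "\<rho> (Y 2) = [:0, 0, 1:]"
  by (simp_all add: \<rho>_Y one_pCons)

lemma \<rho>_C: "\<rho> C = 0"
  by (simp add: C_def \<rho>.hom_mult \<rho>.hom_minus \<rho>.hom_power \<rho>_Ys power2_eq_square)

lemma poly_\<rho>: "poly (\<rho> f) a = peval id (pt a) f"
proof -
  interpret p: comm_ring_hom "peval id (pt a)" by (rule peval_hom)
  show ?thesis
    by (induction f rule: poly3_induct)
      (simp_all only: \<rho>.hom_add \<rho>.hom_mult p.hom_add p.hom_mult poly_add poly_mult peval_pconst
        peval_pvar \<rho>_pconst \<rho>_pvar,
       simp_all add: pt_def power2_eq_square algebra_simps)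
qed

text \<open>\<open>N e j\<close> restricts to \<open>u\<^sup>j\<close>, and modulo \<open>C\<close> every form of degree \<open>e\<close> is a combination of the \<open>N e j\<close>.\<close>

definition N :: "nat \<Rightarrow> nat \<Rightarrow> 'k poly3"
  where "N e j = (if j \<le> e then Y 0 ^ (e - j) * Y 1 ^ j else Y 1 ^ (2 * e - j) * Y 2 ^ (j - e))"

definition lift :: "nat \<Rightarrow> 'k poly \<Rightarrow> 'k poly3"
  where "lift e g = (\<Sum>j\<le>2 * e. pconst (coeff g j) * N e j)"

lemma N_homog: "j \<le> 2 * e \<Longrightarrow> N e j \<in> homog (int e)"
proof -
  assume j: "j \<le> 2 * e"
  have "Y k ^ p * Y l ^ q \<in> homog (int e)" if "p + q = e" for k l p q
    using homog_mult[OF homog_power[OF Y_homog[of k], of p] homog_power[OF Y_homog[of l], of q]] that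
    by (metis mult.right_neutral of_nat_add)
  then show ?thesis using j by (auto simp: N_def)
qed

lemma \<rho>_N: "j \<le> 2 * e \<Longrightarrow> \<rho> (N e j) = monom 1 j"
proof -
  assume j: "j \<le> 2 * e"
  have m: "\<rho> (Y 0) = 1" "\<rho> (Y 1) = monom 1 1" "\<rho> (Y 2) = monom 1 2"
    by (simp_all add: \<rho>_Ys monom_altdef power2_eq_square)
  have "2 * e + 2 * (j - e) - j = j" if "\<not> j \<le> e" using that j by arith
  then show ?thesis using j
    by (auto simp: N_def \<rho>.hom_mult \<rho>.hom_power m monom_power mult_monom)
qed

lemma lift_homog: "lift e g \<in> homog (int e)"
  unfolding lift_def using homog_mult[OF homog_pconst N_homog] by (intro homog_sum) auto

lemma \<rho>_lift: "Polynomial.degree g \<le> 2 * e \<Longrightarrow> \<rho> (lift e g) = g"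
proof -
  assume g: "Polynomial.degree g \<le> 2 * e"
  have "\<rho> (lift e g) = (\<Sum>j\<le>2 * e. monom (coeff g j) j)"
    by (simp add: lift_def \<rho>.hom_sum \<rho>.hom_mult \<rho>_pconst \<rho>_N smult_monom)
  then show ?thesis using poly_as_sum_of_monoms'[OF g] by simp
qed

lemma lift_add: "lift e (g + h) = lift e g + lift e h"
  by (simp add: lift_def pconst.hom_add distrib_right sum.distrib)

lemma lift_smult: "lift e (smult a g) = pconst a * lift e g"
  by (simp add: lift_def pconst.hom_mult sum_distrib_left mult.assoc)

lemma lift_monom: "j \<le> 2 * e \<Longrightarrow> lift e (monom 1 j) = N e j"
  by (simp add: lift_def if_distrib[of pconst] if_distrib[of "\<lambda>t. t * _"] cong: if_cong)

text \<open>The elements of degree \<open>e\<close> that have a normal form modulo \<open>C\<close>;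
  \<open>homog_T\<close> shows that all forms of degree \<open>e\<close> do. For
  \<open>e < 2\<close> the cofactor \<open>h\<close> has negative degree and is 0.\<close>

definition T :: "nat \<Rightarrow> 'k poly3 set"
  where "T e = {f. \<exists>g h. Polynomial.degree g \<le> 2 * e \<and> h \<in> homog (int e - 2) \<and> f = lift e g + C * h}"

lemma T_add: "f \<in> T e \<Longrightarrow> f' \<in> T e \<Longrightarrow> f + f' \<in> T e"
proof -
  assume "f \<in> T e" "f' \<in> T e"
  then obtain g h g' h' where "Polynomial.degree g \<le> 2 * e" "h \<in> homog (int e - 2)" "f = lift e g + C * h"
    "Polynomial.degree g' \<le> 2 * e" "h' \<in> homog (int e - 2)" "f' = lift e g' + C * h'"
    unfolding T_def by auto
  then show ?thesis unfolding T_def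
    by (intro CollectI exI[of _ "g + g'"] exI[of _ "h + h'"])
      (auto simp: lift_add algebra_simps degree_add_le homog_add)
qed

lemma T_scale: "f \<in> T e \<Longrightarrow> pconst a * f \<in> T e"
proof -
  assume "f \<in> T e"
  then obtain g h where "Polynomial.degree g \<le> 2 * e" "h \<in> homog (int e - 2)" "f = lift e g + C * h"
    unfolding T_def by auto
  then show ?thesis unfolding T_def
    using homog_mult[OF homog_pconst[of a], of h "int e - 2"] degree_smult_le[of a g]
    by (intro CollectI exI[of _ "smult a g"] exI[of _ "pconst a * h"])
      (auto simp: lift_smult algebra_simps)
qed

lemma T_sum: "finite S \<Longrightarrow> S \<noteq> {} \<Longrightarrow> (\<And>s. s \<in> S \<Longrightarrow> f s \<in> T e) \<Longrightarrow> sum f S \<in> T e"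
  by (induction S rule: finite_ne_induct) (auto intro: T_add)

lemma T_C: "h \<in> homog (int e - 2) \<Longrightarrow> C * h \<in> T e"
  unfolding T_def by (intro CollectI exI[of _ 0] exI[of _ h]) (simp add: lift_def)

lemma T_N: "j \<le> 2 * e \<Longrightarrow> N e j \<in> T e"
  unfolding T_def
  by (intro CollectI exI[of _ "monom 1 j"] exI[of _ 0]) (simp add: lift_monom degree_monom_eq)

lemma C_eq: "Y 0 * Y 2 = Y 1 * Y 1 - C * pconst (1 / c)"
proof -
  have "C * pconst (1 / c) = pconst (c * (1 / c)) * ((Y 1)\<^sup>2 - Y 0 * Y 2)"
    unfolding C_def pconst.hom_mult by (simp only: mult_ac)
  then show ?thesis using c_nonzero by (simp add: power2_eq_square)
qed

lemma C_mult_homog: "f \<in> homog d \<Longrightarrow> pconst a * f \<in> homog d"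
  using homog_mult[OF homog_pconst[of a], of f d] by simp

text \<open>Multiplying by a coordinate either gives the next monomial of the same shape or creates
  a product \<open>Y 0 * Y 2\<close>, which \<open>C_eq\<close> replaces by the square of
  \<open>Y 1\<close> at the cost of a multiple of \<open>C\<close>.\<close>

lemma Y_N_T:
  assumes j: "j \<le> 2 * e" shows "Y k * N e j \<in> T (Suc e)"
proof -
  have YY: "Y l ^ p * Y m ^ q \<in> homog (int e - 1)" if "p + q + 1 = e" for l m p q
    using homog_mult[OF homog_power[OF Y_homog[of l], of p] homog_power[OF Y_homog[of m], of q]] that
    by (simp add: algebra_simps flip: that)
  have "\<forall>k::3. Y k * N e j \<in> T (Suc e)" unfolding all_3
  proof (intro conjI)
    show "Y 0 * N e j \<in> T (Suc e)"
    proof (cases "j \<le> e")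
      case True
      then have "Y 0 * N e j = N (Suc e) j" by (simp add: N_def Suc_diff_le mult.assoc)
      then show ?thesis using T_N[of j "Suc e"] j by simp
    next
      case False
      then obtain q where q: "j = e + Suc q" by (metis add_Suc_right less_iff_Suc_add not_le)
      define p where "p = 2 * e - j"
      have pq: "p + q + 1 = e" using q j by (simp add: p_def)
      have N: "N e j = Y 1 ^ p * (Y 2 * Y 2 ^ q)" using False q by (simp add: N_def p_def)
      have N2: "N (Suc e) j = Y 1 ^ (p + 2) * Y 2 ^ q" using q pq by (auto simp: N_def)
      have "Y 0 * N e j = (Y 0 * Y 2) * (Y 1 ^ p * Y 2 ^ q)" unfolding N by (simp only: mult_ac)
      also have "\<dots> = N (Suc e) j + C * (- (pconst (1 / c) * (Y 1 ^ p * Y 2 ^ q)))"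
        unfolding C_eq N2 by (simp add: algebra_simps power2_eq_square power_add)
      finally show ?thesis using T_add[OF T_N[of j "Suc e"] T_C[of "- (pconst (1 / c) * (Y 1 ^ p * Y 2 ^ q))" "Suc e"]]
        homog_uminus[OF C_mult_homog[OF YY[OF pq, of 1 2], of "1 / c"]] j by simp
    qed
    show "Y 1 * N e j \<in> T (Suc e)"
    proof -
      have 1: "2 * Suc e - Suc j = Suc (2 * e - j)" using j by arith
      have "Y 1 * N e j = N (Suc e) (Suc j)" unfolding N_def 1 by (simp add: mult_ac)
      then show ?thesis using T_N[of "Suc j" "Suc e"] j by simp
    qed
    show "Y 2 * N e j \<in> T (Suc e)"
    proof (cases "j < e")
      case False
      then have "Y 2 * N e j = N (Suc e) (j + 2)"
        using j by (cases "j = e") (auto simp: N_def Suc_diff_le mult_ac)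
      then show ?thesis using T_N[of "j + 2" "Suc e"] j by simp
    next
      case True
      then obtain p where p: "e = j + Suc p" by (metis add_Suc_right less_iff_Suc_add)
      have N: "N e j = Y 0 * Y 0 ^ p * Y 1 ^ j" using p by (simp add: N_def)
      have N2: "N (Suc e) (j + 2) = Y 0 ^ p * Y 1 ^ (j + 2)" using p by (simp add: N_def)
      have "Y 2 * N e j = (Y 0 * Y 2) * (Y 0 ^ p * Y 1 ^ j)" unfolding N by (simp only: mult_ac)
      also have "\<dots> = N (Suc e) (j + 2) + C * (- (pconst (1 / c) * (Y 0 ^ p * Y 1 ^ j)))"
        unfolding C_eq N2 by (simp add: algebra_simps power2_eq_square power_add)
      finally show ?thesis using T_add[OF T_N[of "j + 2" "Suc e"] T_C[of "- (pconst (1 / c) * (Y 0 ^ p * Y 1 ^ j))" "Suc e"]]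
        homog_uminus[OF C_mult_homog[OF YY[of p j 0 1], of "1 / c"]] p by simp
    qed
  qed
  then show ?thesis by simp
qed

lemma Y_T: assumes "f \<in> T e" shows "Y k * f \<in> T (Suc e)"
proof -
  obtain g h where gh: "h \<in> homog (int e - 2)" "f = lift e g + C * h"
    using assms unfolding T_def by auto
  have "Y k * f = (\<Sum>j\<le>2 * e. pconst (coeff g j) * (Y k * N e j)) + C * (Y k * h)"
    by (simp add: gh(2) lift_def sum_distrib_left algebra_simps)
  moreover have "(\<Sum>j\<le>2 * e. pconst (coeff g j) * (Y k * N e j)) \<in> T (Suc e)"
    by (rule T_sum) (auto intro!: T_scale Y_N_T)
  moreover have "Y k * h \<in> homog (int (Suc e) - 2)"
    using homog_mult[OF Y_homog gh(1), of k] by (simp add: algebra_simps)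
  ultimately show ?thesis using T_add T_C by simp
qed

text \<open>Euler's formula writes a form as a combination of variables times forms of one degree
  less, so closure under multiplication by the \<open>Y k\<close> carries the induction.\<close>

lemma homog_T: "f \<in> homog (int e) \<Longrightarrow> f \<in> T e"
proof (induction e arbitrary: f)
  case 0
  then obtain a where "f = pconst a * N 0 0" using homog_0_const[of f] by (auto simp: N_def)
  then show ?case using T_scale[OF T_N[of 0 0]] by simp
next
  case (Suc e)
  have d: "partial_deriv i f \<in> T e" for i
    using Suc.IH[of "partial_deriv i f"] partial_deriv_homog[OF Suc.prems, of i] by simp
  have "f = (\<Sum>i\<in>UNIV. pvar i * (pconst (1 / of_int (int (Suc e))) * partial_deriv i f))"
    using euler_div[OF Suc.prems] by simp
  also have "\<dots> = (\<Sum>i\<in>UNIV. \<Sum>k\<in>UNIV. pconst (x i k) * (Y k * (pconst (1 / of_int (int (Suc e))) * partial_deriv i f)))"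
    by (simp only: pvar_eq_Y sum_distrib_right mult.assoc)
  also have "\<dots> \<in> T (Suc e)"
    by (intro T_sum T_scale Y_T d) auto
  finally show ?case .
qed

lemma conic_normal:
  assumes "f \<in> homog (int e)"
  obtains h where "Polynomial.degree (\<rho> f) \<le> 2 * e" "h \<in> homog (int e - 2)" "f = lift e (\<rho> f) + C * h"
proof -
  obtain g h where gh: "Polynomial.degree g \<le> 2 * e" "h \<in> homog (int e - 2)" "f = lift e g + C * h"
    using homog_T[OF assms] unfolding T_def by auto
  then have "\<rho> f = g" by (simp add: \<rho>.hom_add \<rho>.hom_mult \<rho>_C \<rho>_lift)
  then show ?thesis using gh that by blast
qed

text \<open>If the restriction is 0, then so is the lift in the normal form and only the multiple of
  \<open>C\<close> remains.\<close>

lemma conic_kernel: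
  assumes "f \<in> homog (int e)" "\<rho> f = 0"
  obtains h where "h \<in> homog (int e - 2)" "f = C * h"
  using conic_normal[OF assms(1)] assms(2) by (auto simp: lift_def)

subsubsection \<open>Ideals of points\<close>

lemma ideal_vi: "ideal (vi a) class_ring"
  unfolding vi_def by (rule ideal_vanishing_ideal)

lemmas ideal_pw = ideal_pow[OF ideal_vi]

lemma ideal_I: "ideal (I \<mu>) class_ring"
  unfolding I_def by (rule ideal_INT[OF ideal_pw])

lemma ideal_MI: "ideal (MI \<mu>) class_ring"
  unfolding MI_def by (rule ideal_ideal_prod[OF irrelevant_ideal ideal_I])

lemma Y_pt: "peval id (pt a) (Y 0) = 1" "peval id (pt a) (Y 1) = a" "peval id (pt a) (Y 2) = a\<^sup>2"
  by (simp_all add: \<rho>_Ys power2_eq_square flip: poly_\<rho>)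

lemma line_pt: "line (pt a) \<in> proj_plane"
proof -
  have "pt a \<noteq> (\<lambda>_. 0)"
    using Y_pt(1)[of a] by (auto simp: Y_def peval_linform)
  then show ?thesis unfolding proj_plane_def line_def by auto
qed

lemma linform_vi: "peval id (pt a) (linform v) = 0 \<Longrightarrow> linform v \<in> vi a"
  unfolding vi_def vanishing_ideal_def
proof (rule genideal_mem, intro CollectI conjI)
  assume 0: "peval id (pt a) (linform v) = 0"
  have "peval id (\<lambda>i. s * pt a i) (linform v) = s * peval id (pt a) (linform v)" for s
    by (simp add: peval_linform sum_distrib_left mult_ac)
  then show "line (pt a) \<in> zero_locus (linform v)"
    using line_pt 0 by (auto simp: zero_locus_def line_def)
qed (use linform_homog in auto)

lemma linform_lincomb: "pconst s * linform v + pconst t * linform w = linform (\<lambda>i. s * v i + t * w i)"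
  by (simp add: linform_def sum_distrib_left pconst.hom_mult pconst.hom_add distrib_right sum.distrib mult.assoc)

lemma vi_Y: "Y 1 - pconst a * Y 0 \<in> vi a" "Y 2 - pconst a * Y 1 \<in> vi a"
proof -
  interpret p: comm_ring_hom "peval id (pt a)" by (rule peval_hom)
  have *: "Y k - pconst a * Y l \<in> vi a" if "peval id (pt a) (Y k - pconst a * Y l) = 0" for k l
  proof -
    have "Y k - pconst a * Y l = pconst 1 * linform (y k) + pconst (- a) * linform (y l)"
      by (simp add: Y_def pconst.hom_uminus)
    then show ?thesis using linform_vi that unfolding linform_lincomb by metis
  qed
  show "Y 1 - pconst a * Y 0 \<in> vi a" "Y 2 - pconst a * Y 1 \<in> vi a"
    by (rule *, simp add: p.hom_minus p.hom_mult peval_pconst Y_pt power2_eq_square)+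
qed

lemma vi_dvd: assumes "f \<in> vi a" shows "[:- a, 1:] dvd \<rho> f"
proof -
  have "vi a \<subseteq> {f. [:- a, 1:] dvd \<rho> f}"
    unfolding vi_def vanishing_ideal_def
  proof (rule genideal_subset)
    show "ideal {f. [:- a, 1:] dvd \<rho> f} class_ring"
      by (rule ideal_class_ringI) (auto simp: \<rho>.hom_add \<rho>.hom_mult)
    show "{f. (\<exists>d. f \<in> homog d) \<and> line (pt a) \<in> zero_locus f} \<subseteq> {f. [:- a, 1:] dvd \<rho> f}"
      using mem_line by (auto simp: zero_locus_def poly_\<rho> simp flip: poly_eq_0_iff_dvd)
  qed
  then show ?thesis using assms by blast
qed

lemma pw_dvd: "f \<in> ipow (vi a) k \<Longrightarrow> [:- a, 1:] ^ k dvd \<rho> f"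
  by (rule hom_ideal_pow_dvd[OF \<rho>.comm_ring_hom_axioms vi_dvd])

lemma I_graded: "f \<in> I \<mu> \<Longrightarrow> coeff (\<chi> f) n \<in> I \<mu>"
  unfolding I_def vi_def
  by (auto intro: ideal_pow_graded[OF ideal_vanishing_ideal vanishing_ideal_graded])

lemma I_deriv: "f \<in> I (Suc \<mu>) \<Longrightarrow> partial_deriv i f \<in> I \<mu>"
  unfolding I_def by (auto intro: partial_deriv_ideal_pow[OF ideal_vi])

lemma I_0: "I 0 = UNIV"
  by (simp add: I_def ideal_pow_0)

lemma I_add: "f \<in> I \<mu> \<Longrightarrow> g \<in> I \<mu>' \<Longrightarrow> f * g \<in> I (\<mu> + \<mu>')"
  unfolding I_def by (auto intro: ideal_pow_add[OF ideal_vi])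

lemma C_I: "C \<in> I 1"
proof -
  have "C \<in> vi a" for a
  proof -
    have "C = pconst c * ((Y 1 - pconst a * Y 0) * Y 1 - Y 0 * (Y 2 - pconst a * Y 1))"
      unfolding C_def by (simp add: algebra_simps power2_eq_square)
    also have "\<dots> \<in> vi a"
      by (rule ideal_mult_left[OF ideal_vi], rule ideal_diff[OF ideal_vi],
          rule ideal_mult_right[OF ideal_vi], rule vi_Y, rule ideal_mult_left[OF ideal_vi], rule vi_Y)
    finally show ?thesis .
  qed
  then show ?thesis by (auto simp: I_def intro!: ideal_pow_1)
qed

text \<open>\<open>\<theta> a\<close> contracts towards the point \<open>pt a\<close>: it is the identity at \<open>t = 1\<close>, and the order of
  vanishing at \<open>pt a\<close> is the order in \<open>t\<close>.\<close>

definition \<theta> :: "'k \<Rightarrow> 'k poly3 \<Rightarrow> 'k poly3 poly"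
  where "\<theta> a = ev (\<lambda>s. [:pconst s:]) (\<lambda>i. [:pconst (pt a i) * Y 0, pvar i - pconst (pt a i) * Y 0:])"

lemma \<theta>_hom: "comm_ring_hom (\<theta> a)"
  unfolding \<theta>_def by (rule ev_hom[OF pconst_poly_hom])

lemma \<theta>_pconst: "\<theta> a (pconst s) = [:pconst s:]"
  by (simp add: \<theta>_def ev_pconst[OF pconst_poly_hom])

lemma \<theta>_pvar: "\<theta> a (pvar i) = [:pconst (pt a i) * Y 0, pvar i - pconst (pt a i) * Y 0:]"
  by (simp add: \<theta>_def ev_pvar[OF pconst_poly_hom])

lemma \<theta>_linform: "\<theta> a (linform v) = [:pconst (peval id (pt a) (linform v)) * Y 0, linform v - pconst (peval id (pt a) (linform v)) * Y 0:]"
proof -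
  interpret comm_ring_hom "\<theta> a" by (rule \<theta>_hom)
  show ?thesis
    unfolding peval_linform by (simp add: linform_def hom_add hom_mult \<theta>_pconst \<theta>_pvar sum_UNIV_3 pconst.hom_mult pconst.hom_add algebra_simps)
qed

lemma \<theta>_1: "poly (\<theta> a f) 1 = f"
proof -
  interpret comm_ring_hom "\<theta> a" by (rule \<theta>_hom)
  show ?thesis by (induction f rule: poly3_induct) (simp_all add: hom_add hom_mult \<theta>_pconst \<theta>_pvar)
qed

text \<open>Describes \<open>\<theta>\<close> at t = 0, where all variables become multiples of
  \<open>Y 0\<close>: a form is sent to its value at the point times a power of
  \<open>Y 0\<close>.\<close>

lemma ev_scaled:
  assumes "f \<in> homog (int d)"
  shows "ev pconst (\<lambda>i. pconst (v i) * Z) f = pconst (peval id v f) * Z ^ d"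
proof -
  have "ev pconst (\<lambda>i. pconst (v i) * Z) f = (\<Sum>m\<in>keys f.
      pconst (lookup f m * (\<Prod>i\<in>UNIV. v i ^ lookup m i)) * Z ^ (\<Sum>i\<in>UNIV. lookup m i))"
    by (simp add: ev_def power_mult_distrib prod.distrib power_sum pconst.hom_mult pconst.hom_prod pconst.hom_power mult.assoc)
  also have "\<dots> = (\<Sum>m\<in>keys f. pconst (lookup f m * (\<Prod>i\<in>UNIV. v i ^ lookup m i)) * Z ^ d)"
    using assms by (intro sum.cong) (auto simp: homog_def simp del: of_nat_sum)
  also have "\<dots> = pconst (peval id v f) * Z ^ d"
    by (simp add: peval_def pconst.hom_sum sum_distrib_right)
  finally show ?thesis .
qed

lemma poly_\<theta>_0: "poly (\<theta> a f) 0 = ev pconst (\<lambda>i. pconst (pt a i) * Y 0) f"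
proof -
  interpret comm_ring_hom "\<theta> a" by (rule \<theta>_hom)
  interpret e: comm_ring_hom "ev pconst (\<lambda>i. pconst (pt a i) * Y 0)" by (rule ev_hom[OF pconst_hom])
  show ?thesis
    by (induction f rule: poly3_induct)
      (simp_all add: hom_add hom_mult e.hom_add e.hom_mult \<theta>_pconst \<theta>_pvar ev_pconst[OF pconst_hom] ev_pvar[OF pconst_hom])
qed

lemma vi_\<theta>: assumes "f \<in> vi a" shows "[:0, 1:] dvd \<theta> a f"
proof -
  interpret comm_ring_hom "\<theta> a" by (rule \<theta>_hom)
  have "vi a \<subseteq> {f. [:0, 1:] dvd \<theta> a f}"
    unfolding vi_def vanishing_ideal_def
  proof (rule genideal_subset)
    show "ideal {f. [:0, 1:] dvd \<theta> a f} class_ring"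
      by (rule ideal_class_ringI) (auto simp: hom_add hom_mult)
    show "{f. (\<exists>d. f \<in> homog d) \<and> line (pt a) \<in> zero_locus f} \<subseteq> {f. [:0, 1:] dvd \<theta> a f}"
    proof safe
      fix f d assume f: "f \<in> homog d" "line (pt a) \<in> zero_locus f"
      show "[:0, 1:] dvd \<theta> a f"
      proof (cases "d < 0")
        case True
        then show ?thesis using homog_neg f by fastforce
      next
        case False
        moreover have "peval id (pt a) f = 0" using f(2) mem_line[of "pt a"]
          by (simp add: zero_locus_def)
        ultimately have "poly (\<theta> a f) 0 = 0"
          using ev_scaled[of f "nat d" "pt a" "Y 0"] f(1) by (simp add: poly_\<theta>_0)
        then show ?thesis by (simp add: poly_eq_0_iff_dvd)
      qed
    qed
  qed
  then show ?thesis using assms by blast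
qed

text \<open>For a variable the coefficient of t is a linear form vanishing at the point; for
  products the coefficients convolve, and the exponents of the powers add up.\<close>

lemma coeff_\<theta>: "coeff (\<theta> a f) j \<in> ipow (vi a) j"
proof -
  interpret comm_ring_hom "\<theta> a" by (rule \<theta>_hom)
  show ?thesis
  proof (induction f arbitrary: j rule: poly3_induct)
    case (const s)
    then show ?case by (cases j) (auto simp: \<theta>_pconst ideal_pow_0 ideal_0[OF ideal_pw])
  next
    case (var i)
    interpret p: comm_ring_hom "peval id (pt a)" by (rule peval_hom)
    have "pvar i - pconst (pt a i) * Y 0 = linform (\<lambda>k. 1 * (if k = i then 1 else 0) + (- pt a i) * y 0 k)"
      unfolding linform_lincomb[symmetric]
      by (simp add: Y_def linform_def if_distrib[of pconst] if_distrib[of "\<lambda>t. t * _"] pconst.hom_uminus cong: if_cong)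
    moreover have "peval id (pt a) (pvar i - pconst (pt a i) * Y 0) = 0"
      by (simp add: p.hom_minus p.hom_mult peval_pconst peval_pvar Y_pt)
    ultimately have "pvar i - pconst (pt a i) * Y 0 \<in> vi a"
      using linform_vi by simp
    then have "coeff (\<theta> a (pvar i)) (Suc n) \<in> ipow (vi a) (Suc n)" for n
      unfolding \<theta>_pvar by (cases n) (simp_all add: ideal_0[OF ideal_pw] ideal_pow_1)
    then show ?case by (cases j) (simp_all add: ideal_pow_0)
  next
    case (add f g)
    then show ?case by (simp add: hom_add ideal_add[OF ideal_pw])
  next
    case (mult f g)
    have "coeff (\<theta> a f) i * coeff (\<theta> a g) (j - i) \<in> ipow (vi a) j" if "i \<le> j" for i
      using ideal_pow_add[OF ideal_vi mult(1)[of i] mult(2)[of "j - i"]] that by simp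
    then show ?case by (auto simp: hom_mult coeff_mult intro!: ideal_sum[OF ideal_pw])
  qed
qed

text \<open>The image of the vanishing ideal is divisible by t, which gives one direction.
  Conversely \<open>f\<close> is the sum of the coefficients of \<open>\<theta> a f\<close>, and
  those that are left lie in powers with exponent at least \<open>k\<close>.\<close>

lemma pw_iff_\<theta>: "f \<in> ipow (vi a) k \<longleftrightarrow> [:0, 1:] ^ k dvd \<theta> a f"
proof
  assume "f \<in> ipow (vi a) k"
  then show "[:0, 1:] ^ k dvd \<theta> a f" by (rule hom_ideal_pow_dvd[of "\<theta> a" "vi a", rotated 2]) (auto intro: \<theta>_hom vi_\<theta>)
next
  assume "[:0, 1:] ^ k dvd \<theta> a f"
  note 0 = X_pow_dvd_coeff[OF this]
  have f: "f = (\<Sum>j\<le>Polynomial.degree (\<theta> a f). coeff (\<theta> a f) j)"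
    using \<theta>_1[of a f] by (simp add: poly_altdef)
  have co: "coeff (\<theta> a f) j \<in> ipow (vi a) k" for j
  proof (cases "j < k")
    case False
    then show ?thesis using coeff_\<theta>[of a f j] ideal_pow_antimono[OF ideal_vi, of k j a] by auto
  qed (simp add: 0 ideal_0[OF ideal_pw])
  show "f \<in> ipow (vi a) k" by (subst f, intro ideal_sum[OF ideal_pw] co)
qed

text \<open>A conic is smooth at each of its points, so \<open>\<theta> a C\<close> has order
  exactly 1 in t, and orders in t add up because the coefficients form a domain.\<close>

lemma pw_cancel_C:
  assumes "C * f \<in> ipow (vi a) (Suc k)"
  shows "f \<in> ipow (vi a) k"
proof -
  interpret comm_ring_hom "\<theta> a" by (rule \<theta>_hom)
  define \<eta>1 where "\<eta>1 = Y 1 - pconst a * Y 0"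
  define \<eta>2 where "\<eta>2 = Y 2 - pconst (a\<^sup>2) * Y 0"
  have \<theta>Y: "\<theta> a (Y 0) = [:Y 0:]" "\<theta> a (Y 1) = [:pconst a * Y 0, \<eta>1:]" "\<theta> a (Y 2) = [:pconst (a\<^sup>2) * Y 0, \<eta>2:]"
    using Y_pt[of a] by (simp_all add: Y_def \<theta>_linform \<eta>1_def \<eta>2_def)
  \<comment> \<open>\<open>\<theta> a C\<close> divided by t. Its constant term is, up to the factor
    \<open>Y 0\<close> and a scalar, the tangent line at \<open>pt a\<close>.\<close>
  define E where "E = [:pconst c * (2 * pconst a * Y 0 * \<eta>1 - Y 0 * \<eta>2), pconst c * \<eta>1\<^sup>2:]"
  have \<theta>C: "\<theta> a C = [:0, 1:] * E"
    by (simp add: C_def hom_mult hom_minus hom_power \<theta>Y \<theta>_pconst E_def power2_eq_square algebra_simps pconst.hom_mult)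
  \<comment> \<open>Restricted to the conic this is -c (u - a)^2, the double contact of the tangent,
    so it is not 0.\<close>
  have "\<rho> (pconst c * (2 * pconst a * Y 0 * \<eta>1 - Y 0 * \<eta>2)) \<noteq> 0"
    using c_nonzero by (simp add: \<eta>1_def \<eta>2_def \<rho>.hom_mult \<rho>.hom_minus \<rho>.hom_power \<rho>_Ys \<rho>_pconst
        \<rho>.hom_numeral numeral_poly)
  then have E0: "poly E 0 \<noteq> 0" unfolding E_def by auto
  show ?thesis
  proof (cases "\<theta> a f = 0")
    case True
    then show ?thesis by (simp add: pw_iff_\<theta>)
  next
    case False
    have "E \<noteq> 0" using E0 by auto
    have o: "order 0 E = 0" using E0 by (rule order_0I)
    have "[:0, 1:] ^ Suc k dvd [:0, 1:] * (E * \<theta> a f)"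
      using assms unfolding pw_iff_\<theta> hom_mult \<theta>C by (simp add: mult.assoc)
    then have "[:0, 1:] ^ k dvd E * \<theta> a f" by (subst (asm) power_Suc, subst (asm) dvd_mult_cancel_left) auto
    then have "k \<le> order 0 (E * \<theta> a f)" using False \<open>E \<noteq> 0\<close> order_divides[of 0 k "E * \<theta> a f"] by simp
    then have "k \<le> order 0 (\<theta> a f)" using False \<open>E \<noteq> 0\<close> by (simp add: order_mult o)
    then show ?thesis unfolding pw_iff_\<theta> using order_divides[of 0 k "\<theta> a f"] by simp
  qed
qed

lemma I_cancel_C: "C * f \<in> I (Suc \<mu>) \<Longrightarrow> f \<in> I \<mu>"
  unfolding I_def using pw_cancel_C by blast

end

context conic_points
begin

section \<open>Forms with prescribed multiplicities and restriction\<close>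

lemma pw_mult_vi: "f \<in> ipow (vi a) k \<Longrightarrow> g \<in> vi a \<Longrightarrow> f * g \<in> ipow (vi a) (Suc k)"
  unfolding ideal_pow_Suc by (rule ideal_prod_mem)

text \<open>The linear factors are grouped into pairs, and \<open>(u - a) (u - b)\<close> with \<open>a \<noteq> b\<close> is the
  restriction of the line through \<open>pt a\<close> and \<open>pt b\<close>, which contributes to the multiplicity at both points.\<close>

lemma lift_products_of_lines:
  assumes "no_equal_pairs as" "length as + Polynomial.degree g \<le> 2 * e"
  shows "\<exists>f \<in> homog (int e). \<rho> f = g * (\<Prod>a\<leftarrow>as. [:-a, 1:]) \<and> (\<forall>a. f \<in> ipow (vi a) (count_list as a))"
  using assms
proof (induction as arbitrary: e rule: no_equal_pairs.induct)
  case (1 a b as)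
  then obtain e' where e: "e = Suc e'" by (cases e) auto
  obtain f where f: "f \<in> homog (int e')" "\<rho> f = g * (\<Prod>a\<leftarrow>as. [:-a, 1:])"
    "\<And>a. f \<in> ipow (vi a) (count_list as a)" using 1 e by auto
  \<comment> \<open>The line through both points, Y2 - (a + b) Y1 + ab Y0. It is symmetric in
    \<open>a\<close> and \<open>b\<close>; each of the two ways of writing it shows membership in
    one vanishing ideal.\<close>
  define l where "l = Y 2 - pconst a * Y 1 - pconst b * (Y 1 - pconst a * Y 0)"
  have l': "l = Y 2 - pconst b * Y 1 - pconst a * (Y 1 - pconst b * Y 0)"
    by (simp add: l_def algebra_simps)
  have la: "l \<in> vi a" unfolding l_def
    by (intro ideal_diff[OF ideal_vi] vi_Y ideal_mult_left[OF ideal_vi])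
  have lb: "l \<in> vi b" unfolding l'
    by (intro ideal_diff[OF ideal_vi] vi_Y ideal_mult_left[OF ideal_vi])
  have lh: "l \<in> homog 1" unfolding l_def
    by (intro homog_diff C_mult_homog Y_homog)
  have \<rho>l: "\<rho> l = [:-a, 1:] * [:-b, 1:]"
    by (simp add: l_def \<rho>.hom_minus \<rho>.hom_mult \<rho>_pconst \<rho>_Ys)
  have "f * l \<in> ipow (vi d) (count_list (a # b # as) d)" for d
    using f(3)[of d] pw_mult_vi[OF f(3) la] pw_mult_vi[OF f(3) lb] 1(2)
    by (auto simp: ideal_mult_right[OF ideal_pw])
  moreover have "f * l \<in> homog (int e)"
    using homog_mult[OF f(1) lh] by (simp add: e algebra_simps)
  moreover have "\<rho> (f * l) = g * (\<Prod>a\<leftarrow>a # b # as. [:-a, 1:])"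
    by (simp only: \<rho>.hom_mult f(2) \<rho>l list.map prod_list.Cons mult_ac)
  ultimately show ?case by blast
next
  case "2_1"
  then show ?case using lift_homog[of e g] \<rho>_lift[of g e]
    by (intro bexI[of _ "lift e g"]) (auto simp: ideal_pow_0)
next
  case ("2_2" a)
  then obtain e' where e: "e = Suc e'" by (cases e) auto
  \<comment> \<open>One linear factor is left over and \<open>g\<close> may have degree
    \<open>2 * e' + 1\<close>, one more than \<open>lift e'\<close> can take. The top term of
    \<open>g\<close> is split as u times s u^(2e'), and the extra u is absorbed by
    \<open>Y 2 - pconst a * Y 1\<close>, which restricts to u (u - a).\<close>
  define s where "s = coeff g (Suc (2 * e'))"
  define g1 where "g1 = g - monom s (Suc (2 * e'))"
  have d: "Polynomial.degree g1 \<le> 2 * e'"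
    unfolding g1_def s_def using "2_2" e by (intro degree_diff_monom) auto
  define f where "f = (Y 1 - pconst a * Y 0) * lift e' g1 + (Y 2 - pconst a * Y 1) * (pconst s * N e' (2 * e'))"
  have "f \<in> vi a" unfolding f_def
    by (intro ideal_add[OF ideal_vi] ideal_mult_right[OF ideal_vi] vi_Y)
  moreover have "f \<in> homog (int e)"
  proof -
    have "(Y 1 - pconst a * Y 0) * lift e' g1 + (Y 2 - pconst a * Y 1) * (pconst s * N e' (2 * e')) \<in> homog (1 + int e')"
      by (intro homog_add homog_mult homog_diff C_mult_homog Y_homog lift_homog N_homog) simp
    then show ?thesis by (simp add: f_def e)
  qed
  moreover have "\<rho> f = g * (\<Prod>a\<leftarrow>[a]. [:-a, 1:])"
  proof -
    have "g = g1 + [:0, 1:] * smult s (monom 1 (2 * e'))"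
      by (simp add: g1_def smult_monom monom_Suc)
    moreover have "\<rho> f = [:-a, 1:] * g1 + [:0, 1:] * [:-a, 1:] * smult s (monom 1 (2 * e'))"
      by (simp add: f_def \<rho>.hom_add \<rho>.hom_minus \<rho>.hom_mult \<rho>_pconst \<rho>_Ys \<rho>_lift[OF d] \<rho>_N)
    ultimately show ?thesis by (simp add: algebra_simps)
  qed
  ultimately show ?case by (intro bexI[of _ f]) (auto simp: ideal_pow_0 intro: ideal_pow_1)
qed

definition F :: "nat \<Rightarrow> 'k poly"
  where "F \<mu> = (\<Prod>a\<in>A. [:-a, 1:] ^ \<mu>)"

lemma degree_F: "Polynomial.degree (F \<mu>) = \<mu> * card A"
  unfolding F_def by (subst degree_prod_sum_eq) (auto simp: degree_linear_power)

lemma F_nonzero: "F \<mu> \<noteq> 0"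
  using finite_A by (simp add: F_def)

lemma F_dvd: "f \<in> I \<mu> \<Longrightarrow> F \<mu> dvd \<rho> f"
  unfolding F_def I_def by (rule linear_powers_dvd[OF finite_A]) (auto intro: pw_dvd)

text \<open>The product of lines is built from \<open>\<mu>\<close> copies of the list of points,
  one after the other; every point then occurs \<open>\<mu>\<close> times, which gives both the
  factor \<open>F \<mu>\<close> and the multiplicities.\<close>

lemma lift_fat:
  assumes "\<mu> * card A + Polynomial.degree g \<le> 2 * e"
  obtains f where "f \<in> homog (int e)" "f \<in> I \<mu>" "\<rho> f = F \<mu> * g"
proof -
  obtain as where as: "set as = A" "distinct as" using finite_A finite_distinct_list by metis
  define L where "L = concat (replicate \<mu> as)"
  have len: "length as = card A" using as distinct_card by metis
  have "no_equal_pairs L" unfolding L_def using card_A as len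
    by (intro no_equal_pairs_successively successively_concat_replicate) auto
  moreover have "length L = \<mu> * card A" by (simp add: L_def length_concat sum_list_replicate len)
  ultimately obtain f where f: "f \<in> homog (int e)" "\<rho> f = g * (\<Prod>a\<leftarrow>L. [:-a, 1:])"
    "\<And>a. f \<in> ipow (vi a) (count_list L a)" using lift_products_of_lines[of L g e] assms by auto
  have "(\<Prod>a\<leftarrow>L. [:-a, 1:]) = F \<mu>"
    unfolding L_def prod_list_concat_replicate F_def prod_power_distrib[symmetric]
    by (simp add: prod.distinct_set_conv_list[OF as(2)] flip: as(1))
  moreover have "f \<in> ipow (vi a) \<mu>" if "a \<in> A" for a
    using f(3)[of a] that as by (simp add: L_def count_list_concat_replicate count_list_distinct)
  then have "f \<in> I \<mu>" unfolding I_def by blast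
  ultimately show ?thesis using f that by (simp add: mult.commute)
qed

section \<open>The ideal of derivatives equals \<MM> times the ideal of lower multiplicity\<close>

lemma C_MI: "h \<in> MI \<mu> \<Longrightarrow> C * h \<in> MI (Suc \<mu>)"
  unfolding MI_def[of \<mu>]
proof (induction rule: ideal_prod_induct)
  case (mult a b)
  have "C * b \<in> I (Suc \<mu>)" using I_add[OF C_I mult(2)] by simp
  then show ?case using mult(1) ideal_prod_mem[of a irrelevant_ideal "C * b"]
    by (simp add: MI_def mult_ac)
next
  case (add f g)
  then show ?case by (simp add: distrib_left ideal_add[OF ideal_MI])
qed

text \<open>The restriction of \<open>f\<close> is \<open>F\<close> times some g. Splitting g as g0
  + u g1 + u^2 g2 and lifting each part to degree \<open>e\<close> gives an element of the product
  with \<MM> that agrees with \<open>f\<close> on the conic. The difference is \<open>C\<close>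
  times an element of \<open>I\<close> of one multiplicity less, to which the induction
  applies.\<close>

lemma MI_generated:
  assumes "\<mu> * card A \<le> 2 * e" "f \<in> I \<mu>" "f \<in> homog (int (Suc e))"
  shows "f \<in> MI \<mu>"
  using assms
proof (induction \<mu> arbitrary: e f)
  case 0
  have "f \<in> irrelevant_ideal" by (rule homog_irrelevant[OF 0(3)]) simp
  then show ?case unfolding MI_def I_0 using ideal_prod_mem[of f irrelevant_ideal 1] by simp
next
  case (Suc \<mu>)
  \<comment> \<open>The degree left for the cofactor of \<open>F\<close> in degree \<open>e\<close>.
    In degree \<open>e + 1\<close> the cofactor may have degree \<open>m + 2\<close>, and the two
    excess coefficients are carried by u and u^2, the restrictions of \<open>Y 1\<close> and
    \<open>Y 2\<close>.\<close>
  define m where "m = 2 * e - Suc \<mu> * card A"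
  have m: "2 * e = Suc \<mu> * card A + m" using Suc.prems(1) by (simp add: m_def)
  obtain g where g: "\<rho> f = F (Suc \<mu>) * g" using F_dvd[OF Suc.prems(2)] by (elim dvdE)
  have deg: "Polynomial.degree g \<le> Suc (Suc m)"
  proof (cases "g = 0")
    case False
    have "Polynomial.degree (\<rho> f) \<le> 2 * Suc e" by (rule conic_normal[OF Suc.prems(3)])
    then show ?thesis unfolding g degree_mult_eq[OF F_nonzero False] degree_F using m by simp
  qed simp
  define s2 where "s2 = coeff g (Suc (Suc m))"
  define g' where "g' = g - monom s2 (Suc (Suc m))"
  define s1 where "s1 = coeff g' (Suc m)"
  define g0 where "g0 = g' - monom s1 (Suc m)"
  have d': "Polynomial.degree g' \<le> Suc m" unfolding g'_def s2_def by (rule degree_diff_monom[OF deg])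
  have d0: "Polynomial.degree g0 \<le> m" unfolding g0_def s1_def by (rule degree_diff_monom[OF d'])
  have gs: "g = g0 + [:0, 1:] * monom s1 m + [:0, 0, 1:] * monom s2 m"
    by (simp add: g0_def g'_def monom_Suc)
  obtain f0 where f0: "f0 \<in> homog (int e)" "f0 \<in> I (Suc \<mu>)" "\<rho> f0 = F (Suc \<mu>) * g0"
    using lift_fat[of "Suc \<mu>" g0 e] m d0 by auto
  obtain f1 where f1: "f1 \<in> homog (int e)" "f1 \<in> I (Suc \<mu>)" "\<rho> f1 = F (Suc \<mu>) * monom s1 m"
    using lift_fat[of "Suc \<mu>" "monom s1 m" e] m degree_monom_le[of s1 m] by auto
  obtain f2 where f2: "f2 \<in> homog (int e)" "f2 \<in> I (Suc \<mu>)" "\<rho> f2 = F (Suc \<mu>) * monom s2 m"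
    using lift_fat[of "Suc \<mu>" "monom s2 m" e] m degree_monom_le[of s2 m] by auto
  define k where "k = Y 0 * f0 + Y 1 * f1 + Y 2 * f2"
  have kMI: "k \<in> MI (Suc \<mu>)" unfolding k_def
    by (intro ideal_add[OF ideal_MI]) (auto simp: MI_def intro!: ideal_prod_mem Y_irrelevant f0 f1 f2)
  have kI: "k \<in> I (Suc \<mu>)" unfolding k_def
    by (intro ideal_add[OF ideal_I] ideal_mult_left[OF ideal_I] f0 f1 f2)
  have "k \<in> homog (1 + int e)" unfolding k_def
    by (intro homog_add homog_mult Y_homog f0 f1 f2)
  then have "f - k \<in> homog (int (Suc e))" using Suc.prems(3) by (intro homog_diff) auto
  moreover have "\<rho> (f - k) = 0"
    unfolding k_def \<rho>.hom_minus \<rho>.hom_add \<rho>.hom_mult f0 f1 f2 g \<rho>_Ys by (subst gs) (simp add: algebra_simps)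
  ultimately obtain h where h: "h \<in> homog (int (Suc e) - 2)" "f - k = C * h"
    by (rule conic_kernel)
  have "C * h \<in> I (Suc \<mu>)" using ideal_diff[OF ideal_I Suc.prems(2) kI] h by simp
  then have hI: "h \<in> I \<mu>" by (rule I_cancel_C)
  \<comment> \<open>The cofactor \<open>h\<close> has degree \<open>e - 1\<close>, so the induction
    is used at \<open>e - 2\<close>: it needs \<open>\<mu> * card A \<le> 2 * e - 4\<close>, and
    this is where the four points enter.\<close>
  have e2: "2 * e \<ge> 4 + \<mu> * card A" using Suc.prems(1) card_A by simp
  then obtain e' where e': "e = Suc (Suc e')" by (cases e; cases "e - 1") auto
  have "h \<in> MI \<mu>" by (rule Suc.IH[of e', OF _ hI]) (use e2 e' h in auto)
  then have "C * h \<in> MI (Suc \<mu>)" by (rule C_MI)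
  then have "f - k + k \<in> MI (Suc \<mu>)" unfolding h(2) by (rule ideal_add[OF ideal_MI _ kMI])
  then show ?case by simp
qed

text \<open>If \<open>f = C * h\<close>, then both terms of the product rule lie in
  \<open>MI \<mu>\<close>: the derivative of \<open>C\<close> is a linear form and \<open>h\<close>
  lies in \<open>I \<mu>\<close>, while \<open>C\<close> raises the multiplicity of the derivative
  of \<open>h\<close>. Otherwise the number of zeros on the conic bounds the degree from below and
  \<open>MI_generated\<close> applies.\<close>

lemma deriv_MI_homog:
  assumes "f \<in> I (Suc \<mu>)" "f \<in> homog (int d)"
  shows "partial_deriv i f \<in> MI \<mu>"
  using assms
proof (induction \<mu> arbitrary: d f rule: less_induct)
  case (less \<mu>)
  show ?case
  proof (cases "\<rho> f = 0")
    case True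
    obtain h where h: "h \<in> homog (int d - 2)" "f = C * h"
      by (rule conic_kernel[OF less.prems(2) True])
    have hI: "h \<in> I \<mu>" using less.prems(1) unfolding h(2) by (rule I_cancel_C)
    have "partial_deriv i C \<in> homog 1" using partial_deriv_homog[OF C_homog, of i] by simp
    then have "partial_deriv i C * h \<in> MI \<mu>" unfolding MI_def
      by (intro ideal_prod_mem hI homog_irrelevant) auto
    moreover have "C * partial_deriv i h \<in> MI \<mu>"
    proof (cases \<mu>)
      \<comment> \<open>No smaller multiplicity is left for the induction, but \<open>I 0\<close> is
        the whole ring and \<open>C\<close> itself lies in \<MM>.\<close>
      case 0
      then show ?thesis unfolding MI_def
        by (auto intro!: ideal_prod_mem homog_irrelevant[OF C_homog] simp: I_0)
    next
      case (Suc \<mu>')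
      have "partial_deriv i h \<in> MI \<mu>'"
      proof (cases "d < 2")
        case True
        then have "h = 0" using homog_neg[OF _ h(1)] by simp
        then show ?thesis using ideal_0[OF ideal_MI] by (simp add: partial_deriv_def)
      next
        case False
        then show ?thesis using less.IH[of \<mu>' h "d - 2"] h(1) hI Suc by (simp add: of_nat_diff)
      qed
      then show ?thesis unfolding Suc by (rule C_MI)
    qed
    ultimately show ?thesis unfolding h(2) partial_deriv_mult by (rule ideal_add[OF ideal_MI])
  next
    case False
    have "Polynomial.degree (F (Suc \<mu>)) \<le> Polynomial.degree (\<rho> f)"
      using F_dvd[OF less.prems(1)] False by (rule dvd_imp_degree_le)
    moreover have "Polynomial.degree (\<rho> f) \<le> 2 * d" by (rule conic_normal[OF less.prems(2)])
    ultimately have *: "card A + \<mu> * card A \<le> 2 * d" by (simp add: degree_F)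
    \<comment> \<open>With \<open>d = e + 2\<close> the derivative has degree \<open>e + 1\<close>,
      and \<open>*\<close> gives \<open>\<mu> * card A \<le> 2 * e\<close> since
      \<open>card A\<close> is at least 4.\<close>
    then obtain e where e: "d = Suc (Suc e)" using card_A by (cases d; cases "d - 1") auto
    show ?thesis
      by (rule MI_generated[of \<mu> e])
        (use * card_A e I_deriv[OF less.prems(1)] partial_deriv_homog[OF less.prems(2), of i] in auto)
  qed
qed

lemma deriv_MI:
  assumes "f \<in> I (Suc \<mu>)"
  shows "partial_deriv i f \<in> MI \<mu>"
  by (subst sum_components[of f], subst partial_deriv_sum)
    (intro ideal_sum[OF ideal_MI] deriv_MI_homog[OF I_graded[OF assms] coeff_\<chi>_homog])

text \<open>By Euler's formula a component of positive degree is a combination of its derivatives.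
  The component of degree 0 is a constant divisible by \<open>F\<close>, which has positive degree,
  so it vanishes.\<close>

lemma I_subset_MI:
  assumes "f \<in> I (Suc \<mu>)"
  shows "f \<in> MI \<mu>"
proof -
  have "coeff (\<chi> f) n \<in> MI \<mu>" for n
  proof (cases "n = 0")
    case False
    have "(\<Sum>i\<in>UNIV. pvar i * (pconst (1 / of_int (int n)) * partial_deriv i (coeff (\<chi> f) n))) \<in> MI \<mu>"
      by (intro ideal_sum[OF ideal_MI] ideal_mult_left[OF ideal_MI] deriv_MI I_graded assms)
    then show ?thesis using euler_div[OF coeff_\<chi>_homog, of n f] False by simp
  next
    case True
    obtain s where s: "coeff (\<chi> f) n = pconst s"
      using homog_0_const[of "coeff (\<chi> f) n"] coeff_\<chi>_homog[of f n] True by auto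
    have "F (Suc \<mu>) dvd [:s:]" using F_dvd[OF I_graded[OF assms, of n]] by (simp add: s \<rho>_pconst)
    then have "s = 0" using dvd_imp_degree_le[of "F (Suc \<mu>)" "[:s:]"] card_A by (auto simp: degree_F)
    then show ?thesis using s by (simp add: ideal_0[OF ideal_MI])
  qed
  then show ?thesis by (subst sum_components[of f]) (intro ideal_sum[OF ideal_MI])
qed

text \<open>The partial derivative with respect to the coordinate \<open>Y k\<close>, as
  \<open>D_Y\<close> confirms. In these coordinates each derivative of \<open>C\<close> is a scalar
  times a single coordinate.\<close>

definition D :: "3 \<Rightarrow> 'k poly3 \<Rightarrow> 'k poly3"
  where "D k f = (\<Sum>i\<in>UNIV. pconst (x i k) * partial_deriv i f)"

lemma D_mult: "D k (f * g) = D k f * g + f * D k g"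
  by (simp add: D_def partial_deriv_mult distrib_left sum.distrib sum_distrib_left sum_distrib_right mult_ac)

lemma D_add: "D k (f + g) = D k f + D k g"
  by (simp add: D_def partial_deriv_add distrib_left sum.distrib)

lemma D_pconst: "D k (pconst s) = 0"
  by (simp add: D_def)

lemma D_power: "D k (f ^ Suc n) = of_nat (Suc n) * f ^ n * D k f"
  by (induction n) (simp_all add: D_mult algebra_simps)

lemma D_Y: "D k (Y l) = (if l = k then 1 else 0)"
proof -
  have "partial_deriv i (Y l) = pconst (y l i)" for i
    by (simp add: Y_def linform_def partial_deriv_sum partial_deriv_mult partial_deriv_pvar if_distrib[of "\<lambda>t. _ * t"] cong: if_cong)
  then have "D k (Y l) = pconst (\<Sum>i\<in>UNIV. y l i * x i k)"
    by (simp add: D_def pconst.hom_sum pconst.hom_mult mult.commute)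
  then show ?thesis by (simp add: yx)
qed

lemma D_diff: "D k (f - g) = D k f - D k g"
  using D_add[of k "f - g" g] by (simp add: algebra_simps)

lemma D_C: "D 0 C = pconst (- c) * Y 2" "D 1 C = pconst (2 * c) * Y 1" "D 2 C = pconst (- c) * Y 0"
  by (simp_all add: C_def D_mult D_diff D_pconst D_Y power2_eq_square pconst.hom_uminus pconst.hom_mult
      pconst.hom_numeral)

text \<open>Induction on the multiplicity \<open>m\<close> of \<open>g\<close>, the power of
  \<open>C\<close> making up the rest of \<open>n\<close>. In the derivative of C^(k+1) g the term
  with the derivative of \<open>g\<close> carries one more power of \<open>C\<close> and a factor of
  multiplicity \<open>m - 1\<close>, so it is covered by the induction. The other term is k + 1
  times C^k g times a derivative of \<open>C\<close>, and these derivatives give all the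
  \<open>Y j\<close>.\<close>

lemma derivs_generate_MI_step:
  assumes J: "ideal J class_ring" "\<And>f i. f \<in> I n \<Longrightarrow> partial_deriv i f \<in> J"
  shows "m + Suc k = n \<Longrightarrow> g \<in> I m \<Longrightarrow> Y j * C ^ k * g \<in> J"
proof (induction m arbitrary: k g j)
  have DJ: "D l f \<in> J" if "f \<in> I n" for f l
    unfolding D_def by (intro ideal_sum[OF J(1)] ideal_mult_left[OF J(1)] J(2) that)
  have CI: "C ^ k \<in> I k" for k
    by (induction k) (use I_add[OF C_I] in \<open>auto simp: I_0\<close>)
  \<comment> \<open>The part common to both cases; the assumption \<open>d\<close> says that the
    term with the derivative of \<open>g\<close> is already in \<open>J\<close>.\<close>
  have step: "Y j * C ^ k * g \<in> J" if n: "m + Suc k = n" and g: "g \<in> I m" and d: "\<And>l. C ^ Suc k * D l g \<in> J" for m k g j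
  proof -
    have 1: "C ^ k * D l C * g \<in> J" for l
    proof -
      have "C ^ Suc k * g \<in> I n" using I_add[OF CI[of "Suc k"] g] n by (simp add: add.commute)
      then have "D l (C ^ Suc k * g) - C ^ Suc k * D l g \<in> J" using DJ d ideal_diff[OF J(1)] by blast
      then have 2: "of_nat (Suc k) * C ^ k * D l C * g \<in> J" unfolding D_mult D_power by simp
      have "pconst (1 / of_nat (Suc k)) * (of_nat (Suc k) * C ^ k * D l C * g) \<in> J"
        by (rule ideal_mult_left[OF J(1) 2])
      moreover have "pconst (1 / of_nat (Suc k)) * of_nat (Suc k) = (1 :: 'k poly3)"
        by (simp del: of_nat_Suc flip: pconst.hom_of_nat pconst.hom_mult)
      moreover have "pconst (1 / of_nat (Suc k)) * (of_nat (Suc k) * C ^ k * D l C * g) =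
          (pconst (1 / of_nat (Suc k)) * of_nat (Suc k)) * (C ^ k * D l C * g)"
        by (simp only: mult_ac)
      ultimately show ?thesis by (simp only: mult_1)
    qed
    have 2: "Y j * C ^ k * g \<in> J" if "D l C = pconst s * Y j" "s \<noteq> 0" for l s j
    proof -
      have "pconst (1 / s) * (C ^ k * D l C * g) \<in> J" by (rule ideal_mult_left[OF J(1) 1])
      moreover have "pconst (1 / s) * (C ^ k * D l C * g) = pconst (1 / s * s) * (Y j * C ^ k * g)"
        unfolding that(1) pconst.hom_mult by (simp only: mult_ac)
      ultimately show ?thesis using that(2) by simp
    qed
    have "\<forall>j. Y j * C ^ k * g \<in> J" unfolding all_3
      using 2[OF D_C(1)] 2[OF D_C(2)] 2[OF D_C(3)] c_nonzero by simp
    then show ?thesis by blast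
  qed
  { case 0
    \<comment> \<open>For multiplicity 0 the derivatives of an arbitrary \<open>g\<close> are not
      controlled, so the step is made for 1, whose derivatives vanish, and the result is multiplied
      by \<open>g\<close>.\<close>
    have "D l 1 = 0" for l using D_pconst[of l 1] by simp
    then have "Y j * C ^ k * 1 \<in> J" by (intro step[of 0]) (use 0 ideal_0[OF J(1)] in \<open>auto simp: I_0\<close>)
    then show ?case using ideal_mult_right[OF J(1), of "Y j * C ^ k * 1" g] by simp
  next
    case (Suc m)
    have "C ^ Suc k * h \<in> J" if "h \<in> MI m" for h
      using that unfolding MI_def
    proof (induction rule: ideal_prod_induct)
      case (mult a b)
      \<comment> \<open>A colon ideal reduces membership for all of \<MM> to the three coordinates,
        for which the induction hypothesis is stated.\<close>
      let ?J = "{a. a * (C ^ Suc k * b) \<in> J}"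
      have "ideal ?J class_ring" by (rule ideal_colon[OF J(1)])
      moreover have "Y l \<in> ?J" for l using Suc.IH[of "Suc k" b l] Suc.prems(1) mult(2)
        by (simp add: mult.assoc del: power_Suc)
      ultimately have "a \<in> ?J" using irrelevant_subset mult(1) by blast
      then show ?case by (simp add: mult_ac)
    next
      case (add f g)
      then show ?case by (simp add: distrib_left ideal_add[OF J(1)])
    qed
    moreover have "D l g \<in> MI m" for l unfolding D_def
      by (intro ideal_sum[OF ideal_MI] ideal_mult_left[OF ideal_MI] deriv_MI Suc.prems)
    ultimately have "C ^ Suc k * D l g \<in> J" for l by blast
    then show ?case by (rule step[OF Suc.prems])
  }
qed

lemma derivs_generate_MI:
  assumes J: "ideal J class_ring" "\<And>f i. f \<in> I (Suc \<mu>) \<Longrightarrow> partial_deriv i f \<in> J"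
  shows "MI \<mu> \<subseteq> J"
proof
  fix h assume "h \<in> MI \<mu>"
  then show "h \<in> J" unfolding MI_def
  proof (induction rule: ideal_prod_induct)
    case (mult a b)
    let ?J = "{a. a * b \<in> J}"
    have "ideal ?J class_ring" by (rule ideal_colon[OF J(1)])
    moreover have "Y l \<in> ?J" for l
      using derivs_generate_MI_step[OF J, of _ \<mu> 0 b l] mult(2) by simp
    ultimately show ?case using irrelevant_subset mult(1) by blast
  qed (rule ideal_add[OF J(1)])
qed

end

subsection \<open>Quotient modules and presented modules\<close>

lemma (in abelian_group) minus_eq_zeroD:
  assumes "a \<ominus> b = \<zero>" "a \<in> carrier G" "b \<in> carrier G"
  shows "a = b"
  using assms minus_equality[of a "\<ominus> b"] by (simp add: a_minus_def)

lemma submodule_abelian_subgroup: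
  assumes "LinearCombinations.submodule R N M"
  shows "abelian_subgroup N M"
proof -
  interpret N: LinearCombinations.submodule R N M by fact
  interpret M: module R M by (rule N.module)
  show ?thesis
  proof (rule abelian_subgroupI3)
    show "additive_subgroup N M"
    proof (rule additive_subgroup.intro, rule M.add.subgroupI)
      show "\<ominus>\<^bsub>M\<^esub> a \<in> N" if "a \<in> N" for a
      proof -
        have "\<ominus>\<^bsub>R\<^esub> \<one>\<^bsub>R\<^esub> \<odot>\<^bsub>M\<^esub> a \<in> N" using that by (intro N.smult_closed) auto
        moreover have "a \<in> carrier M" using that N.subset by blast
        ultimately show ?thesis by (simp add: M.smult_minus_1)
      qed
      show "N \<noteq> {}" using N.zero_closed by blast
    qed (use N.subset in auto)
  qed (rule M.abelian_group_axioms)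
qed

context
  fixes R :: "('a, 'r) ring_scheme" and M :: "('a, 'm) module" and N :: "'m set"
  assumes N: "LinearCombinations.submodule R N M"
begin

interpretation N: LinearCombinations.submodule R N M by (rule N)
interpretation M: module R M by (rule N.module)
interpretation A: abelian_subgroup N M by (rule submodule_abelian_subgroup[OF N])

lemma quotient_module_carrier: "carrier (quotient_module M N) = (\<lambda>m. N +>\<^bsub>M\<^esub> m) ` carrier M"
  by (auto simp: quotient_module_def A_RCOSETS_def')

lemma quotient_module_add: "m \<in> carrier M \<Longrightarrow> m' \<in> carrier M \<Longrightarrow>
    (N +>\<^bsub>M\<^esub> m) \<oplus>\<^bsub>quotient_module M N\<^esub> (N +>\<^bsub>M\<^esub> m') = N +>\<^bsub>M\<^esub> (m \<oplus>\<^bsub>M\<^esub> m')"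
  by (simp add: quotient_module_def A.a_rcos_sum)

lemma quotient_module_zero: "\<zero>\<^bsub>quotient_module M N\<^esub> = N"
  by (simp add: quotient_module_def)

lemma coset_mem_iff: "m \<in> carrier M \<Longrightarrow> m' \<in> carrier M \<Longrightarrow> m \<in> N +>\<^bsub>M\<^esub> m' \<longleftrightarrow> m \<ominus>\<^bsub>M\<^esub> m' \<in> N"
  by (simp add: A.a_rcos_module a_minus_def)

lemma coset_eq_iff: "m \<in> carrier M \<Longrightarrow> m' \<in> carrier M \<Longrightarrow> N +>\<^bsub>M\<^esub> m = N +>\<^bsub>M\<^esub> m' \<longleftrightarrow> m \<ominus>\<^bsub>M\<^esub> m' \<in> N"
  using A.a_rcos_self[of m] A.a_repr_independence'[of m m'] coset_mem_iff by blast

lemma coset_eq_self: "m \<in> carrier M \<Longrightarrow> N +>\<^bsub>M\<^esub> m = N \<longleftrightarrow> m \<in> N"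
  using A.a_rcos_self A.a_rcos_const by blast

lemma quotient_module_smult:
  assumes "a \<in> carrier R" "m \<in> carrier M"
  shows "a \<odot>\<^bsub>quotient_module M N\<^esub> (N +>\<^bsub>M\<^esub> m) = N +>\<^bsub>M\<^esub> (a \<odot>\<^bsub>M\<^esub> m)"
proof -
  have "N +>\<^bsub>M\<^esub> (a \<odot>\<^bsub>M\<^esub> m') = N +>\<^bsub>M\<^esub> (a \<odot>\<^bsub>M\<^esub> m)" if "m' \<in> N +>\<^bsub>M\<^esub> m" for m'
  proof -
    have m': "m' \<in> carrier M" using that A.a_elemrcos_carrier assms(2) by blast
    have "m' \<ominus>\<^bsub>M\<^esub> m \<in> N" using that m' assms(2) coset_mem_iff by blast
    then have "a \<odot>\<^bsub>M\<^esub> (m' \<ominus>\<^bsub>M\<^esub> m) \<in> N" using assms by simp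
    moreover have "a \<odot>\<^bsub>M\<^esub> (m' \<ominus>\<^bsub>M\<^esub> m) = a \<odot>\<^bsub>M\<^esub> m' \<ominus>\<^bsub>M\<^esub> a \<odot>\<^bsub>M\<^esub> m"
      using assms m' by (simp add: a_minus_def M.smult_r_distr M.smult_r_minus)
    ultimately show ?thesis using assms m' by (simp add: coset_eq_iff)
  qed
  then have "(\<Union>x\<in>N +>\<^bsub>M\<^esub> m. N +>\<^bsub>M\<^esub> (a \<odot>\<^bsub>M\<^esub> x)) = (\<Union>x\<in>N +>\<^bsub>M\<^esub> m. N +>\<^bsub>M\<^esub> (a \<odot>\<^bsub>M\<^esub> m))"
    by (intro SUP_cong refl)
  moreover have "m \<in> N +>\<^bsub>M\<^esub> m" using A.a_rcos_self assms by blast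
  ultimately show ?thesis unfolding quotient_module_def by (simp only: module.simps) blast
qed

lemma quotient_module_is_module: "module R (quotient_module M N)"
  apply (rule module_criteria)
             apply (rule M.R.cring_axioms)
            apply (use A.a_subgroup_in_rcosets in \<open>simp add: quotient_module_def\<close>)
           apply (auto simp: quotient_module_carrier quotient_module_add)[1]
          apply (clarsimp simp: quotient_module_carrier quotient_module_zero)
  subgoal for m by (rule bexI[of _ "\<ominus>\<^bsub>M\<^esub> m"]) (simp_all add: quotient_module_add M.r_neg coset_eq_self)
         apply (auto simp: quotient_module_carrier quotient_module_smult)[1]
        apply (auto simp: quotient_module_carrier quotient_module_add M.a_comm)[1]
       apply (auto simp: quotient_module_carrier quotient_module_add M.a_assoc)[1]
      apply (clarsimp simp: quotient_module_carrier quotient_module_zero)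
  subgoal for m using quotient_module_add[of m "\<zero>\<^bsub>M\<^esub>"] coset_eq_self[of "\<zero>\<^bsub>M\<^esub>"] by simp
     apply (auto simp: quotient_module_carrier quotient_module_smult M.smult_assoc1)[1]
    apply (auto simp: quotient_module_carrier quotient_module_smult)[1]
   apply (auto simp: quotient_module_carrier quotient_module_smult quotient_module_add M.smult_l_distr)[1]
  apply (auto simp: quotient_module_carrier quotient_module_smult quotient_module_add M.smult_r_distr)[1]
  done

lemma quotient_module_universal:
  assumes P: "module R P" and g: "g \<in> module_hom R M P" and 0: "\<And>n. n \<in> N \<Longrightarrow> g n = \<zero>\<^bsub>P\<^esub>"
  obtains h where "h \<in> module_hom R (quotient_module M N) P" "\<And>m. m \<in> carrier M \<Longrightarrow> h (N +>\<^bsub>M\<^esub> m) = g m"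
proof -
  interpret P: module R P by fact
  interpret g: mod_hom R M P g by unfold_locales (rule g)
  define h where "h K = g (SOME m. m \<in> K)" for K
  have h: "h (N +>\<^bsub>M\<^esub> m) = g m" if m: "m \<in> carrier M" for m
  proof -
    define m' where "m' = (SOME m'. m' \<in> N +>\<^bsub>M\<^esub> m)"
    have "m' \<in> N +>\<^bsub>M\<^esub> m" unfolding m'_def using A.a_rcos_self[OF m] by (rule someI)
    then have m'1: "m' \<in> carrier M" by (rule A.a_elemrcos_carrier[OF m])
    then have "m' \<ominus>\<^bsub>M\<^esub> m \<in> N" using m \<open>m' \<in> N +>\<^bsub>M\<^esub> m\<close> by (simp only: coset_mem_iff)
    note m' = m'1 this
    then have "g m' \<ominus>\<^bsub>P\<^esub> g m = \<zero>\<^bsub>P\<^esub>" using 0[OF m'(2)] m by simp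
    then have "g m' = g m" by (rule P.minus_eq_zeroD[OF _ g.f_im[OF m'1] g.f_im[OF m]])
    then show ?thesis by (simp add: h_def m'_def)
  qed
  show ?thesis
  proof (rule that[OF _ h])
    show "h \<in> module_hom R (quotient_module M N) P"
      unfolding module_hom_def quotient_module_carrier
      by (auto simp: h quotient_module_add quotient_module_smult)
  qed
qed

end

context
  fixes R :: "'a ring" and B :: "'b set"
  assumes R: "cring R"
begin

interpretation R: cring R by (rule R)

lemma free_module_simps:
  "f \<oplus>\<^bsub>free_module R B\<^esub> g = (\<lambda>b. f b \<oplus>\<^bsub>R\<^esub> g b)" "\<zero>\<^bsub>free_module R B\<^esub> = (\<lambda>_. \<zero>\<^bsub>R\<^esub>)"
  "a \<odot>\<^bsub>free_module R B\<^esub> f = (\<lambda>b. a \<otimes>\<^bsub>R\<^esub> f b)"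
  by (simp_all add: free_module_def)

lemma free_module_carrier: "f \<in> carrier (free_module R B) \<longleftrightarrow>
    (\<forall>b. f b \<in> carrier R) \<and> (\<forall>b. b \<notin> B \<longrightarrow> f b = \<zero>\<^bsub>R\<^esub>) \<and> finite {b. f b \<noteq> \<zero>\<^bsub>R\<^esub>}"
  by (auto simp: free_module_def)

lemma free_module_is_module: "module R (free_module R B)"
proof (rule module_criteria[OF R], goal_cases)
  case 2
  have "finite {b. v b \<oplus>\<^bsub>R\<^esub> w b \<noteq> \<zero>\<^bsub>R\<^esub>}" if "finite {b. v b \<noteq> \<zero>\<^bsub>R\<^esub>}" "finite {b. w b \<noteq> \<zero>\<^bsub>R\<^esub>}"
    "\<forall>b. w b \<in> carrier R" for v w :: "'b \<Rightarrow> 'a"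
    by (rule finite_subset[of _ "{b. v b \<noteq> \<zero>\<^bsub>R\<^esub>} \<union> {b. w b \<noteq> \<zero>\<^bsub>R\<^esub>}"]) (use that in auto)
  then show ?case by (auto simp: free_module_carrier free_module_simps)
next
  case 3
  have "finite {b. \<ominus>\<^bsub>R\<^esub> v b \<noteq> \<zero>\<^bsub>R\<^esub>}" if "finite {b. v b \<noteq> \<zero>\<^bsub>R\<^esub>}" for v :: "'b \<Rightarrow> 'a"
    by (rule finite_subset[OF _ that]) auto
  then have "(\<lambda>b. \<ominus>\<^bsub>R\<^esub> v b) \<in> carrier (free_module R B) \<and> v \<oplus>\<^bsub>free_module R B\<^esub> (\<lambda>b. \<ominus>\<^bsub>R\<^esub> v b) = \<zero>\<^bsub>free_module R B\<^esub>"
    if "v \<in> carrier (free_module R B)" for v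
    using that by (auto simp: free_module_carrier free_module_simps R.r_neg)
  then show ?case by blast
next
  case 4
  have "finite {b. c \<otimes>\<^bsub>R\<^esub> v b \<noteq> \<zero>\<^bsub>R\<^esub>}" if "finite {b. v b \<noteq> \<zero>\<^bsub>R\<^esub>}" "c \<in> carrier R" for v :: "'b \<Rightarrow> 'a" and c
    by (rule finite_subset[OF _ that(1)]) (use that in auto)
  then show ?case by (auto simp: free_module_carrier free_module_simps)
qed (auto simp: free_module_carrier free_module_simps R.a_ac R.m_assoc R.l_distr R.r_distr)

lemma free_gen_closed: "b \<in> B \<Longrightarrow> free_gen R b \<in> carrier (free_module R B)"
  by (auto simp: free_module_carrier free_gen_def)

interpretation F: module R "free_module R B" by (rule free_module_is_module)

lemma free_module_induct:
  assumes f: "f \<in> carrier (free_module R B)" and 0: "\<zero>\<^bsub>free_module R B\<^esub> \<in> S"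
    and gen: "\<And>a b. a \<in> carrier R \<Longrightarrow> b \<in> B \<Longrightarrow> a \<odot>\<^bsub>free_module R B\<^esub> free_gen R b \<in> S"
    and add: "\<And>f g. f \<in> S \<Longrightarrow> g \<in> S \<Longrightarrow> f \<oplus>\<^bsub>free_module R B\<^esub> g \<in> S"
  shows "f \<in> S"
proof -
  have "finite A \<Longrightarrow> f \<in> carrier (free_module R B) \<Longrightarrow> {b. f b \<noteq> \<zero>\<^bsub>R\<^esub>} \<subseteq> A \<Longrightarrow> f \<in> S" for A f
  proof (induction A arbitrary: f rule: finite_induct)
    case empty
    then have "f = \<zero>\<^bsub>free_module R B\<^esub>" by (auto simp: free_module_simps)
    then show ?case using 0 by simp
  next
    case (insert b A)
    have fR: "f b' \<in> carrier R" for b' using insert.prems by (simp add: free_module_carrier)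
    have "f(b := \<zero>\<^bsub>R\<^esub>) \<in> carrier (free_module R B)"
      using insert.prems(1) by (auto simp: free_module_carrier elim: finite_subset[rotated])
    then have 1: "f(b := \<zero>\<^bsub>R\<^esub>) \<in> S" using insert.prems(2) by (intro insert.IH) (assumption, auto)
    show ?case
    proof (cases "b \<in> B")
      case True
      have "f = (f b \<odot>\<^bsub>free_module R B\<^esub> free_gen R b) \<oplus>\<^bsub>free_module R B\<^esub> f(b := \<zero>\<^bsub>R\<^esub>)"
        by (auto simp: free_module_simps free_gen_def fR fun_eq_iff)
      then show ?thesis using add[OF gen[OF fR True] 1] by metis
    next
      case False
      then have "f(b := \<zero>\<^bsub>R\<^esub>) = f" using insert.prems(1) by (auto simp: free_module_carrier)
      then show ?thesis using 1 by simp
    qed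
  qed
  then show ?thesis using f by (auto simp: free_module_carrier)
qed

lemma free_module_universal:
  assumes P: "module R P" and \<phi>: "\<And>b. b \<in> B \<Longrightarrow> \<phi> b \<in> carrier P"
  obtains L where "L \<in> module_hom R (free_module R B) P" "\<And>b. b \<in> B \<Longrightarrow> L (free_gen R b) = \<phi> b"
proof -
  interpret P: module R P by fact
  define L where "L f = (\<Oplus>\<^bsub>P\<^esub>b\<in>{b. f b \<noteq> \<zero>\<^bsub>R\<^esub>}. f b \<odot>\<^bsub>P\<^esub> \<phi> b)" for f
  have cl: "f b \<odot>\<^bsub>P\<^esub> \<phi> b \<in> carrier P" if "f \<in> carrier (free_module R B)" "b \<in> B" for f b
    using that \<phi> by (simp add: free_module_carrier)
  have L: "L f = (\<Oplus>\<^bsub>P\<^esub>b\<in>A. f b \<odot>\<^bsub>P\<^esub> \<phi> b)"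
    if "f \<in> carrier (free_module R B)" "finite A" "{b. f b \<noteq> \<zero>\<^bsub>R\<^esub>} \<subseteq> A" "A \<subseteq> B" for f A
    unfolding L_def
    by (rule P.add.finprod_mono_neutral_cong_left) (use that cl \<phi> in \<open>auto simp: Pi_def\<close>)
  have supp: "{b. f b \<noteq> \<zero>\<^bsub>R\<^esub>} \<subseteq> B" "finite {b. f b \<noteq> \<zero>\<^bsub>R\<^esub>}" if "f \<in> carrier (free_module R B)" for f
    using that by (auto simp: free_module_carrier)
  have "L \<in> module_hom R (free_module R B) P"
    unfolding module_hom_def
  proof (intro CollectI conjI allI impI)
    show "L \<in> carrier (free_module R B) \<rightarrow> carrier P"
      unfolding L_def using cl supp by (auto intro!: P.finsum_closed)
  next
    fix f g assume fg: "f \<in> carrier (free_module R B) \<and> g \<in> carrier (free_module R B)"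
    let ?A = "{b. f b \<noteq> \<zero>\<^bsub>R\<^esub>} \<union> {b. g b \<noteq> \<zero>\<^bsub>R\<^esub>}"
    have A: "finite ?A" "?A \<subseteq> B" using fg supp by auto
    have fg': "f \<oplus>\<^bsub>free_module R B\<^esub> g \<in> carrier (free_module R B)" using fg by simp
    have "L (f \<oplus>\<^bsub>free_module R B\<^esub> g) = (\<Oplus>\<^bsub>P\<^esub>b\<in>?A. (f b \<oplus>\<^bsub>R\<^esub> g b) \<odot>\<^bsub>P\<^esub> \<phi> b)"
      using fg A by (subst L[OF fg', of ?A]) (auto simp: free_module_simps)
    also have "\<dots> = (\<Oplus>\<^bsub>P\<^esub>b\<in>?A. f b \<odot>\<^bsub>P\<^esub> \<phi> b \<oplus>\<^bsub>P\<^esub> g b \<odot>\<^bsub>P\<^esub> \<phi> b)"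
    proof (rule P.finsum_cong'[OF refl])
      show "(\<lambda>b. f b \<odot>\<^bsub>P\<^esub> \<phi> b \<oplus>\<^bsub>P\<^esub> g b \<odot>\<^bsub>P\<^esub> \<phi> b) \<in> ?A \<rightarrow> carrier P"
        using fg A cl by (intro Pi_I P.a_closed) blast+
      show "(f b \<oplus>\<^bsub>R\<^esub> g b) \<odot>\<^bsub>P\<^esub> \<phi> b = f b \<odot>\<^bsub>P\<^esub> \<phi> b \<oplus>\<^bsub>P\<^esub> g b \<odot>\<^bsub>P\<^esub> \<phi> b" if "b \<in> ?A" for b
        using that fg A \<phi> by (intro P.smult_l_distr) (auto simp: free_module_carrier)
    qed
    also have "\<dots> = L f \<oplus>\<^bsub>P\<^esub> L g"
    proof -
      have "L f = (\<Oplus>\<^bsub>P\<^esub>b\<in>?A. f b \<odot>\<^bsub>P\<^esub> \<phi> b)" "L g = (\<Oplus>\<^bsub>P\<^esub>b\<in>?A. g b \<odot>\<^bsub>P\<^esub> \<phi> b)"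
        using fg A by (auto intro!: L)
      moreover have "(\<lambda>b. f b \<odot>\<^bsub>P\<^esub> \<phi> b) \<in> ?A \<rightarrow> carrier P" "(\<lambda>b. g b \<odot>\<^bsub>P\<^esub> \<phi> b) \<in> ?A \<rightarrow> carrier P"
        using fg A cl by auto
      ultimately show ?thesis by (simp only: P.finsum_addf)
    qed
    finally show "L (f \<oplus>\<^bsub>free_module R B\<^esub> g) = L f \<oplus>\<^bsub>P\<^esub> L g" .
  next
    fix r f assume rf: "r \<in> carrier R \<and> f \<in> carrier (free_module R B)"
    let ?A = "{b. f b \<noteq> \<zero>\<^bsub>R\<^esub>}"
    have rf': "r \<odot>\<^bsub>free_module R B\<^esub> f \<in> carrier (free_module R B)" using rf by simp
    have "L (r \<odot>\<^bsub>free_module R B\<^esub> f) = (\<Oplus>\<^bsub>P\<^esub>b\<in>?A. (r \<otimes>\<^bsub>R\<^esub> f b) \<odot>\<^bsub>P\<^esub> \<phi> b)"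
      using rf supp by (subst L[OF rf', of ?A]) (auto simp: free_module_simps)
    also have "\<dots> = (\<Oplus>\<^bsub>P\<^esub>b\<in>?A. r \<odot>\<^bsub>P\<^esub> (f b \<odot>\<^bsub>P\<^esub> \<phi> b))"
    proof (rule P.finsum_cong'[OF refl])
      show "(\<lambda>b. r \<odot>\<^bsub>P\<^esub> (f b \<odot>\<^bsub>P\<^esub> \<phi> b)) \<in> ?A \<rightarrow> carrier P"
      proof (rule Pi_I)
        fix b assume "b \<in> ?A"
        then have "b \<in> B" using supp(1)[of f] rf by blast
        then show "r \<odot>\<^bsub>P\<^esub> (f b \<odot>\<^bsub>P\<^esub> \<phi> b) \<in> carrier P" using rf cl[of f b] by simp
      qed
      show "(r \<otimes>\<^bsub>R\<^esub> f b) \<odot>\<^bsub>P\<^esub> \<phi> b = r \<odot>\<^bsub>P\<^esub> (f b \<odot>\<^bsub>P\<^esub> \<phi> b)" if "b \<in> ?A" for b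
        using that rf supp[of f] \<phi> by (intro P.smult_assoc1) (auto simp: free_module_carrier)
    qed
    also have "\<dots> = r \<odot>\<^bsub>P\<^esub> L f"
      unfolding L_def using rf cl supp[of f] by (intro P.finsum_smult[symmetric]) auto
    finally show "L (r \<odot>\<^bsub>free_module R B\<^esub> f) = r \<odot>\<^bsub>P\<^esub> L f" .
  qed
  moreover have "L (free_gen R b) = \<phi> b" if b: "b \<in> B" for b
  proof -
    have "L (free_gen R b) = (\<Oplus>\<^bsub>P\<^esub>b'\<in>{b}. free_gen R b b' \<odot>\<^bsub>P\<^esub> \<phi> b')"
      using b by (intro L free_gen_closed) (auto simp: free_gen_def)
    then show ?thesis using b \<phi> by (simp add: free_gen_def)
  qed
  ultimately show ?thesis by (rule that)
qed

end

locale presentation =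
  fixes R :: "'a ring" and B :: "'b set" and E :: "('b \<Rightarrow> 'a) set"
  assumes cring: "cring R" and rels: "E \<subseteq> carrier (free_module R B)"
begin

sublocale R: cring R by (rule cring)
sublocale F: module R "free_module R B" by (rule free_module_is_module[OF cring])

abbreviation "Q \<equiv> presented_module R B E"
abbreviation "g \<equiv> presented_gen R B E"

lemma span_submodule: "LinearCombinations.submodule R (F.span E) (free_module R B)"
  by (rule F.span_is_submodule[OF rels])

sublocale Q: module R Q
  unfolding presented_module_def by (rule quotient_module_is_module[OF span_submodule])

definition \<pi> where "\<pi> f = F.span E +>\<^bsub>free_module R B\<^esub> f"

sublocale \<pi>: mod_hom R "free_module R B" Q \<pi>
  by unfold_locales (auto simp: module_hom_def presented_module_def \<pi>_def
      quotient_module_carrier[OF span_submodule] quotient_module_add[OF span_submodule] quotient_module_smult[OF span_submodule])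

lemma gen_eq: "g b = \<pi> (free_gen R b)"
  by (simp add: presented_gen_def \<pi>_def)

lemma gen_closed: "b \<in> B \<Longrightarrow> g b \<in> carrier Q"
  unfolding gen_eq by (rule \<pi>.f_im[OF free_gen_closed[OF cring]])

lemma relation:
  assumes "e \<in> E" shows "\<pi> e = \<zero>\<^bsub>Q\<^esub>"
proof -
  have "e \<in> F.span E" "e \<in> carrier (free_module R B)" using F.in_own_span[OF rels] rels assms by auto
  then show ?thesis
    by (simp add: \<pi>_def presented_module_def quotient_module_zero[OF span_submodule] coset_eq_self[OF span_submodule])
qed

lemma relation_diff: "e \<ominus>\<^bsub>free_module R B\<^esub> e' \<in> E \<Longrightarrow> e \<in> carrier (free_module R B) \<Longrightarrow> e' \<in> carrier (free_module R B) \<Longrightarrow>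
   \<pi> e = \<pi> e'"
  using relation[of "e \<ominus>\<^bsub>free_module R B\<^esub> e'"] Q.minus_eq_zeroD[OF _ \<pi>.f_im[of e] \<pi>.f_im[of e']] by simp

lemma presented_induct:
  assumes m: "m \<in> carrier Q" and 0: "\<zero>\<^bsub>Q\<^esub> \<in> S"
    and gen: "\<And>a b. a \<in> carrier R \<Longrightarrow> b \<in> B \<Longrightarrow> a \<odot>\<^bsub>Q\<^esub> g b \<in> S"
    and add: "\<And>m n. m \<in> S \<Longrightarrow> n \<in> S \<Longrightarrow> m \<in> carrier Q \<Longrightarrow> n \<in> carrier Q \<Longrightarrow> m \<oplus>\<^bsub>Q\<^esub> n \<in> S"
  shows "m \<in> S"
proof -
  obtain f where f: "f \<in> carrier (free_module R B)" "m = \<pi> f"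
    using m by (auto simp: presented_module_def quotient_module_carrier[OF span_submodule] \<pi>_def)
  note fg = free_gen_closed[OF cring, of _ B]
  have "f \<in> {f \<in> carrier (free_module R B). \<pi> f \<in> S}"
  proof (rule free_module_induct[OF cring f(1)])
    show "\<zero>\<^bsub>free_module R B\<^esub> \<in> {f \<in> carrier (free_module R B). \<pi> f \<in> S}" using 0 by simp
    show "a \<odot>\<^bsub>free_module R B\<^esub> free_gen R b \<in> {f \<in> carrier (free_module R B). \<pi> f \<in> S}"
      if "a \<in> carrier R" "b \<in> B" for a b
      using gen[OF that] that fg[OF that(2)] by (simp add: gen_eq)
    show "f \<oplus>\<^bsub>free_module R B\<^esub> f' \<in> {f \<in> carrier (free_module R B). \<pi> f \<in> S}"
      if "f \<in> {f \<in> carrier (free_module R B). \<pi> f \<in> S}" "f' \<in> {f \<in> carrier (free_module R B). \<pi> f \<in> S}" for f f'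
      using that add[of "\<pi> f" "\<pi> f'"] by simp
  qed
  then show ?thesis using f by simp
qed

text \<open>The relations are tested on an arbitrary linear extension \<open>L\<close> of
  \<open>\<phi>\<close>, because the extension to the free module is obtained only inside the proof;
  its values on generators are all that callers know.\<close>

lemma presented_universal:
  assumes P: "module R P" and \<phi>: "\<And>b. b \<in> B \<Longrightarrow> \<phi> b \<in> carrier P"
    and rel: "\<And>L e. L \<in> module_hom R (free_module R B) P \<Longrightarrow> (\<And>b. b \<in> B \<Longrightarrow> L (free_gen R b) = \<phi> b) \<Longrightarrow> e \<in> E \<Longrightarrow> L e = \<zero>\<^bsub>P\<^esub>"
  obtains h where "h \<in> module_hom R Q P" "\<And>b. b \<in> B \<Longrightarrow> h (g b) = \<phi> b"
proof -
  obtain L where L: "L \<in> module_hom R (free_module R B) P" "\<And>b. b \<in> B \<Longrightarrow> L (free_gen R b) = \<phi> b"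
    using free_module_universal[OF cring P] \<phi> by blast
  interpret P: module R P by fact
  interpret L: mod_hom R "free_module R B" P L by unfold_locales (rule L)
  have "F.span E \<subseteq> L.ker"
    using rels rel[OF L] by (intro F.span_is_subset L.ker_is_submodule) (auto simp: L.ker_def)
  then have "\<And>n. n \<in> F.span E \<Longrightarrow> L n = \<zero>\<^bsub>P\<^esub>" by (auto simp: L.ker_def)
  then obtain h where h: "h \<in> module_hom R Q P" "\<And>m. m \<in> carrier (free_module R B) \<Longrightarrow> h (\<pi> m) = L m"
    using quotient_module_universal[OF span_submodule P L(1)] unfolding \<pi>_def presented_module_def by blast
  show ?thesis by (rule that[OF h(1)]) (simp add: gen_eq h(2) free_gen_closed[OF cring] L(2))
qed

end

subsection \<open>Universal properties of differentials and exterior powers\<close>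

locale kahler_algebra =
  fixes K :: "'c ring" and \<phi> :: "'c \<Rightarrow> 'a" and R :: "'a ring"
  assumes R: "cring R" and \<phi>: "\<And>c. c \<in> carrier K \<Longrightarrow> \<phi> c \<in> carrier R"
begin

sublocale kp: presentation R "carrier R" "kahler_rels K \<phi> R"
proof (rule presentation.intro[OF R])
  interpret cring R by (rule R)
  interpret F: module R "free_module R (carrier R)" by (rule free_module_is_module[OF R])
  show "kahler_rels K \<phi> R \<subseteq> carrier (free_module R (carrier R))"
    unfolding kahler_rels_def Let_def
    using \<phi> by (auto intro!: F.minus_closed F.a_closed F.smult_closed free_gen_closed[OF R])
qed

abbreviation "\<Omega> \<equiv> kahler K \<phi> R"
abbreviation "d \<equiv> kahler_d K \<phi> R"

sublocale \<Omega>: module R \<Omega>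
  unfolding kahler_def by (rule kp.Q.module_axioms)

lemma d_closed: "a \<in> carrier R \<Longrightarrow> d a \<in> carrier \<Omega>"
  unfolding kahler_d_def kahler_def by (rule kp.gen_closed)

lemma d_gen: "d a = kp.\<pi> (free_gen R a)"
  unfolding kahler_d_def by (rule kp.gen_eq)

lemmas dg_closed = free_gen_closed[OF R, where B = "carrier R"]

lemma d_add:
  assumes "a \<in> carrier R" "b \<in> carrier R"
  shows "d (a \<oplus>\<^bsub>R\<^esub> b) = d a \<oplus>\<^bsub>\<Omega>\<^esub> d b"
proof -
  have "kp.\<pi> (free_gen R (a \<oplus>\<^bsub>R\<^esub> b)) = kp.\<pi> (free_gen R a \<oplus>\<^bsub>free_module R (carrier R)\<^esub> free_gen R b)"
    by (rule kp.relation_diff) (use assms dg_closed in \<open>auto simp: kahler_rels_def Let_def\<close>)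
  then show ?thesis using assms dg_closed by (simp add: d_gen kahler_def)
qed

lemma d_mult:
  assumes "a \<in> carrier R" "b \<in> carrier R"
  shows "d (a \<otimes>\<^bsub>R\<^esub> b) = a \<odot>\<^bsub>\<Omega>\<^esub> d b \<oplus>\<^bsub>\<Omega>\<^esub> b \<odot>\<^bsub>\<Omega>\<^esub> d a"
proof -
  have "kp.\<pi> (free_gen R (a \<otimes>\<^bsub>R\<^esub> b)) = kp.\<pi> (a \<odot>\<^bsub>free_module R (carrier R)\<^esub> free_gen R b \<oplus>\<^bsub>free_module R (carrier R)\<^esub> b \<odot>\<^bsub>free_module R (carrier R)\<^esub> free_gen R a)"
    by (rule kp.relation_diff) (use assms dg_closed in \<open>auto simp: kahler_rels_def Let_def\<close>)
  then show ?thesis using assms dg_closed by (simp add: d_gen kahler_def)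
qed

lemma d_const: "c \<in> carrier K \<Longrightarrow> d (\<phi> c) = \<zero>\<^bsub>\<Omega>\<^esub>"
  unfolding d_gen kahler_def by (rule kp.relation) (auto simp: kahler_rels_def Let_def)

lemma kahler_induct:
  assumes "m \<in> carrier \<Omega>" and "\<zero>\<^bsub>\<Omega>\<^esub> \<in> S"
    and "\<And>a b. a \<in> carrier R \<Longrightarrow> b \<in> carrier R \<Longrightarrow> a \<odot>\<^bsub>\<Omega>\<^esub> d b \<in> S"
    and "\<And>m n. m \<in> S \<Longrightarrow> n \<in> S \<Longrightarrow> m \<in> carrier \<Omega> \<Longrightarrow> n \<in> carrier \<Omega> \<Longrightarrow> m \<oplus>\<^bsub>\<Omega>\<^esub> n \<in> S"
  shows "m \<in> S"
  using kp.presented_induct[folded kahler_def kahler_d_def] assms by blast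

lemma kahler_universal:
  assumes P: "module R P" and cl: "\<And>a. a \<in> carrier R \<Longrightarrow> D a \<in> carrier P"
    and add: "\<And>a b. a \<in> carrier R \<Longrightarrow> b \<in> carrier R \<Longrightarrow> D (a \<oplus>\<^bsub>R\<^esub> b) = D a \<oplus>\<^bsub>P\<^esub> D b"
    and mult: "\<And>a b. a \<in> carrier R \<Longrightarrow> b \<in> carrier R \<Longrightarrow> D (a \<otimes>\<^bsub>R\<^esub> b) = a \<odot>\<^bsub>P\<^esub> D b \<oplus>\<^bsub>P\<^esub> b \<odot>\<^bsub>P\<^esub> D a"
    and const: "\<And>c. c \<in> carrier K \<Longrightarrow> D (\<phi> c) = \<zero>\<^bsub>P\<^esub>"
  obtains h where "h \<in> module_hom R \<Omega> P" "\<And>a. a \<in> carrier R \<Longrightarrow> h (d a) = D a"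
proof -
  interpret P: module R P by (rule P)
  show ?thesis
  proof (rule kp.presented_universal[OF P, of D])
    show "D a \<in> carrier P" if "a \<in> carrier R" for a using that by (rule cl)
    show "L e = \<zero>\<^bsub>P\<^esub>" if L: "L \<in> module_hom R (free_module R (carrier R)) P"
      "\<And>b. b \<in> carrier R \<Longrightarrow> L (free_gen R b) = D b" and e: "e \<in> kahler_rels K \<phi> R" for L e
    proof -
      interpret L: mod_hom R "free_module R (carrier R)" P L by unfold_locales (rule L)
      show ?thesis using e unfolding kahler_rels_def Let_def
        by (auto simp: dg_closed L(2) add mult const cl P.r_neg a_minus_def \<phi>)
    qed
    fix h assume "h \<in> module_hom R kp.Q P" "\<And>a. a \<in> carrier R \<Longrightarrow> h (kp.g a) = D a"
    then show thesis unfolding kahler_def[symmetric] kahler_d_def[symmetric] by (rule that)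
  qed
qed

end

locale exterior_algebra = M: module R M for R :: "'a ring" and M :: "('a, 'm) module" +
  fixes n :: nat
begin

lemma tuples_update: "ws \<in> tuples M n \<Longrightarrow> x \<in> carrier M \<Longrightarrow> ws[i := x] \<in> tuples M n"
  using set_update_subset_insert[of ws i x] by (auto simp: tuples_def)

sublocale ep: presentation R "tuples M n" "exterior_rels R M n"
proof (rule presentation.intro[OF M.R.cring_axioms])
  interpret F: module R "free_module R (tuples M n)" by (rule free_module_is_module[OF M.R.cring_axioms])
  show "exterior_rels R M n \<subseteq> carrier (free_module R (tuples M n))"
    unfolding exterior_rels_def Let_def
    by (auto intro!: F.minus_closed F.a_closed F.smult_closed free_gen_closed[OF M.R.cring_axioms] tuples_update)
qed

abbreviation "\<Lambda> \<equiv> exterior_power R M n"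
abbreviation "w \<equiv> wedge R M n"

sublocale \<Lambda>: module R \<Lambda>
  unfolding exterior_power_def by (rule ep.Q.module_axioms)

lemma wedge_closed: "ws \<in> tuples M n \<Longrightarrow> w ws \<in> carrier \<Lambda>"
  unfolding wedge_def exterior_power_def by (rule ep.gen_closed)

lemma wedge_gen: "w ws = ep.\<pi> (free_gen R ws)"
  unfolding wedge_def by (rule ep.gen_eq)

lemmas wg_closed = free_gen_closed[OF M.R.cring_axioms, where B = "tuples M n"]

lemma wedge_add:
  assumes "ws \<in> tuples M n" "i < n" "x \<in> carrier M" "y \<in> carrier M"
  shows "w (ws[i := x \<oplus>\<^bsub>M\<^esub> y]) = w (ws[i := x]) \<oplus>\<^bsub>\<Lambda>\<^esub> w (ws[i := y])"
proof -
  have "ep.\<pi> (free_gen R (ws[i := x \<oplus>\<^bsub>M\<^esub> y])) = ep.\<pi> (free_gen R (ws[i := x]) \<oplus>\<^bsub>free_module R (tuples M n)\<^esub> free_gen R (ws[i := y]))"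
    by (rule ep.relation_diff) (use assms wg_closed tuples_update in \<open>auto simp: exterior_rels_def Let_def\<close>)
  then show ?thesis using assms wg_closed tuples_update by (simp add: wedge_gen exterior_power_def)
qed

lemma wedge_smult:
  assumes "ws \<in> tuples M n" "i < n" "a \<in> carrier R" "x \<in> carrier M"
  shows "w (ws[i := a \<odot>\<^bsub>M\<^esub> x]) = a \<odot>\<^bsub>\<Lambda>\<^esub> w (ws[i := x])"
proof -
  have "ep.\<pi> (free_gen R (ws[i := a \<odot>\<^bsub>M\<^esub> x])) = ep.\<pi> (a \<odot>\<^bsub>free_module R (tuples M n)\<^esub> free_gen R (ws[i := x]))"
    by (rule ep.relation_diff) (use assms wg_closed tuples_update in \<open>auto simp: exterior_rels_def Let_def\<close>)
  then show ?thesis using assms wg_closed tuples_update by (simp add: wedge_gen exterior_power_def)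
qed

lemma wedge_alternating: "ws \<in> tuples M n \<Longrightarrow> \<not> distinct ws \<Longrightarrow> w ws = \<zero>\<^bsub>\<Lambda>\<^esub>"
  unfolding wedge_gen exterior_power_def by (rule ep.relation) (auto simp: exterior_rels_def Let_def)

lemma wedge_zero: "ws \<in> tuples M n \<Longrightarrow> i < n \<Longrightarrow> w (ws[i := \<zero>\<^bsub>M\<^esub>]) = \<zero>\<^bsub>\<Lambda>\<^esub>"
  using wedge_smult[of ws i "\<zero>\<^bsub>R\<^esub>" "\<zero>\<^bsub>M\<^esub>"] wedge_closed[OF tuples_update] by simp

lemma exterior_induct:
  assumes "m \<in> carrier \<Lambda>" and "\<zero>\<^bsub>\<Lambda>\<^esub> \<in> S"
    and "\<And>a ws. a \<in> carrier R \<Longrightarrow> ws \<in> tuples M n \<Longrightarrow> a \<odot>\<^bsub>\<Lambda>\<^esub> w ws \<in> S"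
    and "\<And>p q. p \<in> S \<Longrightarrow> q \<in> S \<Longrightarrow> p \<in> carrier \<Lambda> \<Longrightarrow> q \<in> carrier \<Lambda> \<Longrightarrow> p \<oplus>\<^bsub>\<Lambda>\<^esub> q \<in> S"
  shows "m \<in> S"
  using ep.presented_induct[folded exterior_power_def wedge_def] assms by blast

lemma exterior_universal:
  assumes P: "module R P" and cl: "\<And>ws. ws \<in> tuples M n \<Longrightarrow> f ws \<in> carrier P"
    and add: "\<And>ws i x y. ws \<in> tuples M n \<Longrightarrow> i < n \<Longrightarrow> x \<in> carrier M \<Longrightarrow> y \<in> carrier M \<Longrightarrow>
      f (ws[i := x \<oplus>\<^bsub>M\<^esub> y]) = f (ws[i := x]) \<oplus>\<^bsub>P\<^esub> f (ws[i := y])"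
    and smult: "\<And>ws i a x. ws \<in> tuples M n \<Longrightarrow> i < n \<Longrightarrow> a \<in> carrier R \<Longrightarrow> x \<in> carrier M \<Longrightarrow>
      f (ws[i := a \<odot>\<^bsub>M\<^esub> x]) = a \<odot>\<^bsub>P\<^esub> f (ws[i := x])"
    and alt: "\<And>ws. ws \<in> tuples M n \<Longrightarrow> \<not> distinct ws \<Longrightarrow> f ws = \<zero>\<^bsub>P\<^esub>"
  obtains h where "h \<in> module_hom R \<Lambda> P" "\<And>ws. ws \<in> tuples M n \<Longrightarrow> h (w ws) = f ws"
proof -
  interpret P: module R P by (rule P)
  show ?thesis
  proof (rule ep.presented_universal[OF P, of f])
    show "f ws \<in> carrier P" if "ws \<in> tuples M n" for ws using that by (rule cl)
    show "L e = \<zero>\<^bsub>P\<^esub>" if L: "L \<in> module_hom R (free_module R (tuples M n)) P"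
      "\<And>ws. ws \<in> tuples M n \<Longrightarrow> L (free_gen R ws) = f ws" and e: "e \<in> exterior_rels R M n" for L e
    proof -
      interpret L: mod_hom R "free_module R (tuples M n)" P L by unfold_locales (rule L)
      show ?thesis using e unfolding exterior_rels_def Let_def
        by (auto simp: wg_closed L(2) add smult alt cl P.r_neg a_minus_def tuples_update)
    qed
    fix h assume "h \<in> module_hom R ep.Q P" "\<And>ws. ws \<in> tuples M n \<Longrightarrow> h (ep.g ws) = f ws"
    then show thesis unfolding exterior_power_def[symmetric] wedge_def[symmetric] by (rule that)
  qed
qed

end

subsection \<open>The third exterior power of the differentials of \<open>S/I\<close>\<close>

lemma regular_module_is_module:
  assumes "cring R" shows "module R (regular_module R)"
proof -
  interpret cring R by fact
  show ?thesis
  proof (rule module_criteria[OF assms], goal_cases)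
    case 3
    have "\<exists>n\<in>carrier R. v \<oplus>\<^bsub>R\<^esub> n = \<zero>\<^bsub>R\<^esub>" if "v \<in> carrier R" for v
      using that by (intro bexI[of _ "\<ominus>\<^bsub>R\<^esub> v"]) (simp_all add: r_neg)
    then show ?case by (simp add: regular_module_def)
  qed (auto simp: regular_module_def a_ac m_assoc l_distr r_distr)
qed

lemma restrict_scalars_is_module:
  assumes "module R M" "cring R'" "\<phi> \<in> Ring.ring_hom R' R"
  shows "module R' (restrict_scalars \<phi> M)"
proof -
  interpret module R M by fact
  have cl: "\<phi> a \<in> carrier R" if "a \<in> carrier R'" for a using ring_hom_closed[OF assms(3) that] .
  show ?thesis
  proof (rule module_criteria[OF assms(2)], goal_cases)
    case 3
    have "\<exists>n\<in>carrier M. v \<oplus>\<^bsub>M\<^esub> n = \<zero>\<^bsub>M\<^esub>" if "v \<in> carrier M" for v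
      using that by (intro bexI[of _ "\<ominus>\<^bsub>M\<^esub> v"]) (simp_all add: M.r_neg)
    then show ?case by (simp add: restrict_scalars_def)
  qed (auto simp: restrict_scalars_def cl M.a_ac smult_assoc1 smult_l_distr smult_r_distr
      ring_hom_mult[OF assms(3)] ring_hom_add[OF assms(3)] ring_hom_one[OF assms(3)])
qed

definition qc :: "'k::field poly3 set \<Rightarrow> 'k poly3 \<Rightarrow> 'k poly3 set"
  where "qc I f = I +>\<^bsub>S_ring\<^esub> f"

context
  fixes I :: "'k::field poly3 set"
  assumes I: "ideal I S_ring"
begin

interpretation ideal I S_ring by (rule I)

lemma qc_ring_hom: "qc I \<in> Ring.ring_hom S_ring (S_ring Quot I)"
  using rcos_ring_hom by (simp add: qc_def[abs_def])

lemma qc_add: "qc I f \<oplus>\<^bsub>S_ring Quot I\<^esub> qc I g = qc I (f + g)"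
  using ring_hom_add[OF qc_ring_hom, of f g] by simp

lemma qc_mult: "qc I f \<otimes>\<^bsub>S_ring Quot I\<^esub> qc I g = qc I (f * g)"
  using ring_hom_mult[OF qc_ring_hom, of f g] by simp

lemma qc_one: "\<one>\<^bsub>S_ring Quot I\<^esub> = qc I 1"
  using ring_hom_one[OF qc_ring_hom] by simp

lemma qc_carrier: "carrier (S_ring Quot I) = range (qc I)"
  by (auto simp: FactRing_def A_RCOSETS_def' qc_def)

lemma qc_closed: "qc I f \<in> carrier (S_ring Quot I)"
  by (simp add: qc_carrier)

lemma qc_eq_iff: "qc I f = qc I g \<longleftrightarrow> f - g \<in> I"
proof -
  have "f \<in> qc I g \<longleftrightarrow> f - g \<in> I"
    using a_rcos_module_minus[OF class_ring.ring_axioms, of g f] by (simp add: qc_def class_ring_simps)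
  then show ?thesis
    using a_rcos_self[of f] a_repr_independence'[of f g] by (auto simp: qc_def)
qed

lemma qc_zero: "\<zero>\<^bsub>S_ring Quot I\<^esub> = qc I 0"
proof -
  have "qc I 0 = I" using a_rcos_const[OF ideal_0[OF I]] by (simp add: qc_def)
  then show ?thesis by (simp add: FactRing_def)
qed

lemma Quot_cring: "cring (S_ring Quot I)"
  by (rule quotient_is_cring) (rule class_cring.cring_axioms)

lemma submodule_regular: "LinearCombinations.submodule S_ring I (regular_module S_ring)"
  by (rule submodule.intro, rule regular_module_is_module, rule class_cring.cring_axioms)
    (auto simp: regular_module_def ideal_0[OF I] ideal_add[OF I] ideal_mult_left[OF I])

lemma regular_coset: "I +>\<^bsub>regular_module S_ring\<^esub> f = qc I f"
  by (simp add: qc_def a_r_coset_def r_coset_def regular_module_def)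

lemma quot_poly_carrier: "carrier (quot_poly I) = range (qc I)"
  unfolding quot_poly_def quotient_module_carrier[OF submodule_regular] regular_coset
  by (simp add: regular_module_def)

lemma quot_poly_add: "qc I f \<oplus>\<^bsub>quot_poly I\<^esub> qc I g = qc I (f + g)"
  using quotient_module_add[OF submodule_regular, of f g]
  unfolding quot_poly_def regular_coset by (simp add: regular_module_def)

lemma quot_poly_smult: "f \<odot>\<^bsub>quot_poly I\<^esub> qc I g = qc I (f * g)"
  using quotient_module_smult[OF submodule_regular, of f g]
  unfolding quot_poly_def regular_coset by (simp add: regular_module_def)

lemma quot_poly_zero: "\<zero>\<^bsub>quot_poly I\<^esub> = qc I 0"
  using quotient_module_zero[OF submodule_regular] qc_zero by (simp add: quot_poly_def FactRing_def)

lemma quot_poly_is_module: "module S_ring (quot_poly I)"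
  unfolding quot_poly_def by (rule quotient_module_is_module[OF submodule_regular])

lemma quot_poly_deg_eq: "quot_poly_deg I n = qc I ` homog n"
  by (simp add: quot_poly_deg_def qc_def)

end

definition det3 :: "(3 \<Rightarrow> 'a) \<Rightarrow> (3 \<Rightarrow> 'a) \<Rightarrow> (3 \<Rightarrow> 'a) \<Rightarrow> 'a::comm_ring_1"
  where "det3 u v w = u 0 * (v 1 * w 2 - v 2 * w 1) - u 1 * (v 0 * w 2 - v 2 * w 0) + u 2 * (v 0 * w 1 - v 1 * w 0)"

lemma det3_diff:
  "det3 u v w - det3 u' v' w' = det3 (\<lambda>i. u i - u' i) v w + det3 u' (\<lambda>i. v i - v' i) w + det3 u' v' (\<lambda>i. w i - w' i)"
  by (simp add: det3_def algebra_simps)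

lemma det3_ideal:
  assumes J: "ideal J class_ring"
  shows "(\<And>i. u i \<in> J) \<Longrightarrow> det3 u v w \<in> J" "(\<And>i. v i \<in> J) \<Longrightarrow> det3 u v w \<in> J" "(\<And>i. w i \<in> J) \<Longrightarrow> det3 u v w \<in> J"
proof -
  note r = ideal_add[OF J] ideal_diff[OF J]
  show "det3 u v w \<in> J" if "\<And>i. u i \<in> J"
    unfolding det3_def by (intro r ideal_mult_right[OF J] that)
  have 2: "det3 u v w = - (v 0 * (u 1 * w 2 - u 2 * w 1) - v 1 * (u 0 * w 2 - u 2 * w 0) + v 2 * (u 0 * w 1 - u 1 * w 0))"
    by (simp add: det3_def algebra_simps)
  show "det3 u v w \<in> J" if "\<And>i. v i \<in> J"
    unfolding 2 by (intro ideal_uminus[OF J] r ideal_mult_right[OF J] that)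
  have 3: "det3 u v w = w 0 * (u 1 * v 2 - u 2 * v 1) - w 1 * (u 0 * v 2 - u 2 * v 0) + w 2 * (u 0 * v 1 - u 1 * v 0)"
    by (simp add: det3_def algebra_simps)
  show "det3 u v w \<in> J" if "\<And>i. w i \<in> J"
    unfolding 3 by (intro r ideal_mult_right[OF J] that)
qed

text \<open>Lets the determinant be computed from representatives of classes modulo
  \<open>J\<close>.\<close>

lemma det3_cong:
  assumes J: "ideal J class_ring" and "\<And>i. u i - u' i \<in> J" "\<And>i. v i - v' i \<in> J" "\<And>i. w i - w' i \<in> J"
  shows "det3 u v w - det3 u' v' w' \<in> J"
  unfolding det3_diff by (intro ideal_add[OF J] det3_ideal(1)[OF J] det3_ideal(2)[OF J] det3_ideal(3)[OF J] assms(2-))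

lemma det3_homog:
  assumes "\<And>i. u i \<in> homog a" "\<And>i. v i \<in> homog b" "\<And>i. w i \<in> homog c"
  shows "det3 u v w \<in> homog (a + b + c)"
proof -
  have "u i * (v j * w k - v l * w m) \<in> homog (a + (b + c))" for i j k l m
    by (intro homog_mult homog_diff assms)
  then show ?thesis unfolding det3_def add.assoc by (intro homog_add homog_diff)
qed

text \<open>\<open>J\<close> is characterised as the least ideal containing \<open>I\<close> and the
  partial derivatives of its elements. \<open>deriv\<close> makes the map from the exterior power to
  \<open>S/J\<close> well defined, \<open>least\<close> makes it injective.\<close>

locale derivative_ideal =
  fixes I J :: "'k::field poly3 set"
  assumes I: "ideal I S_ring" and J: "ideal J S_ring" and IJ: "I \<subseteq> J"
    and deriv: "\<And>f i. f \<in> I \<Longrightarrow> partial_deriv i f \<in> J"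
    and least: "\<And>J'. ideal J' S_ring \<Longrightarrow> I \<subseteq> J' \<Longrightarrow> (\<And>f i. f \<in> I \<Longrightarrow> partial_deriv i f \<in> J') \<Longrightarrow> J \<subseteq> J'"
begin

abbreviation "Q \<equiv> S_ring Quot I"
abbreviation "q \<equiv> qc I"

lemma pconst_class_ring: "q (pconst c) \<in> carrier Q"
  by (rule qc_closed[OF I])

sublocale k: kahler_algebra "class_ring :: 'k ring" "\<lambda>c. q (pconst c)" Q
  by (rule kahler_algebra.intro) (rule Quot_cring[OF I], rule pconst_class_ring)

lemma omega1_eq: "omega1 I = k.\<Omega>"
  by (simp add: omega1_def qc_def)

abbreviation "dx j \<equiv> omega1_dx I j"

lemma dx_eq: "dx j = k.d (q (pvar j))"
  by (simp add: omega1_dx_def qc_def)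

lemma dx_closed: "dx j \<in> carrier k.\<Omega>"
  unfolding dx_eq by (rule k.d_closed[OF qc_closed[OF I]])

abbreviation "dx_sum u \<equiv> q (u 0) \<odot>\<^bsub>k.\<Omega>\<^esub> dx 0 \<oplus>\<^bsub>k.\<Omega>\<^esub> (q (u 1) \<odot>\<^bsub>k.\<Omega>\<^esub> dx 1 \<oplus>\<^bsub>k.\<Omega>\<^esub> q (u 2) \<odot>\<^bsub>k.\<Omega>\<^esub> dx 2)"

lemma d_formula: "k.d (q f) = dx_sum (\<lambda>j. partial_deriv j f)"
proof (induction f rule: poly3_induct)
  case (const c)
  then show ?case using k.d_const[of c] by (simp add: qc_zero[OF I, symmetric] dx_closed)
next
  case (var i)
  have "\<forall>i. k.d (q (pvar i)) = dx_sum (\<lambda>j. partial_deriv j (pvar i))"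
    unfolding all_3 by (simp add: partial_deriv_pvar qc_zero[OF I, symmetric] qc_one[OF I, symmetric] dx_closed dx_eq[symmetric])
  then show ?case by blast
next
  case (add f g)
  show ?case
    unfolding qc_add[OF I, symmetric] k.d_add[OF qc_closed[OF I] qc_closed[OF I]] add partial_deriv_add
    by (simp add: k.\<Omega>.smult_l_distr qc_closed[OF I] dx_closed k.\<Omega>.M.a_ac)
next
  case (mult f g)
  note c = qc_closed[OF I]
  have "k.d (q (f * g)) = q f \<odot>\<^bsub>k.\<Omega>\<^esub> k.d (q g) \<oplus>\<^bsub>k.\<Omega>\<^esub> q g \<odot>\<^bsub>k.\<Omega>\<^esub> k.d (q f)"
    unfolding qc_mult[OF I, symmetric] by (rule k.d_mult[OF c c])
  also have "\<dots> = dx_sum (\<lambda>j. partial_deriv j (f * g))"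
    unfolding mult partial_deriv_mult
    by (simp add: k.\<Omega>.smult_l_distr k.\<Omega>.smult_r_distr c dx_closed k.\<Omega>.M.a_ac k.\<Omega>.smult_assoc1[symmetric] qc_mult[OF I] mult.commute
        flip: qc_add[OF I])
  finally show ?case .
qed

text \<open>The projection from \<open>S/I\<close> to \<open>S/J\<close>. The choice of a
  representative does not matter since \<open>I\<close> is contained in \<open>J\<close>.\<close>

definition \<tau> :: "'k poly3 set \<Rightarrow> 'k poly3 set"
  where "\<tau> K = qc J (SOME f. q f = K)"

lemma \<tau>: "\<tau> (q f) = qc J f"
proof -
  have "q (SOME f'. q f' = q f) = q f" by (rule someI) (rule refl)
  then show ?thesis using IJ by (auto simp: \<tau>_def qc_eq_iff[OF I] qc_eq_iff[OF J])
qed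

lemma \<tau>_hom: "\<tau> \<in> Ring.ring_hom Q (S_ring Quot J)"
  by (rule ring_hom_memI)
    (auto simp: qc_carrier[OF I] qc_carrier[OF J] \<tau> qc_mult[OF I] qc_add[OF I] qc_mult[OF J] qc_add[OF J] qc_one[OF I] qc_one[OF J])

text \<open>\<open>S/J\<close> as a module over \<open>S/I\<close>, the target of the universal
  properties.\<close>

definition T :: "('k poly3 set, 'k poly3 set) module"
  where "T = restrict_scalars \<tau> (regular_module (S_ring Quot J))"

sublocale T: module Q T
  unfolding T_def
  by (rule restrict_scalars_is_module[OF regular_module_is_module[OF Quot_cring[OF J]] Quot_cring[OF I] \<tau>_hom])

lemma T_carrier: "carrier T = range (qc J)"
  by (simp add: T_def restrict_scalars_def regular_module_def qc_carrier[OF J])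

lemma T_add: "qc J f \<oplus>\<^bsub>T\<^esub> qc J g = qc J (f + g)"
  by (simp add: T_def restrict_scalars_def regular_module_def qc_add[OF J])

lemma T_smult: "q f \<odot>\<^bsub>T\<^esub> qc J g = qc J (f * g)"
  by (simp add: T_def restrict_scalars_def regular_module_def \<tau> qc_mult[OF J])

lemma T_zero: "\<zero>\<^bsub>T\<^esub> = qc J 0"
  by (simp add: T_def restrict_scalars_def regular_module_def qc_zero[OF J])

text \<open>The coefficient of \<open>dx j\<close> is not well defined over \<open>S/I\<close>, but
  it is modulo \<open>J\<close>: two representatives of a class differ by an element of
  \<open>I\<close>, whose derivatives lie in \<open>J\<close>. So the derivative in direction
  \<open>j\<close> is a derivation into \<open>T\<close>.\<close>

lemma \<psi>_exists: "\<exists>\<psi>. \<psi> \<in> module_hom Q k.\<Omega> T \<and> (\<forall>f. \<psi> (k.d (q f)) = qc J (partial_deriv j f))"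
proof -
  define D where "D K = qc J (partial_deriv j (SOME f. q f = K))" for K
  have D: "D (q f) = qc J (partial_deriv j f)" for f
  proof -
    define f' where "f' = (SOME f'. q f' = q f)"
    have "q f' = q f" unfolding f'_def by (rule someI) (rule refl)
    then have "partial_deriv j (f' - f) \<in> J" by (auto simp: qc_eq_iff[OF I] intro: deriv)
    moreover have "partial_deriv j (f' - f) = partial_deriv j f' - partial_deriv j f"
      using partial_deriv_add[of j "f' - f" f] by (simp add: algebra_simps)
    ultimately show ?thesis by (simp add: D_def f'_def qc_eq_iff[OF J])
  qed
  show ?thesis
  proof (rule k.kahler_universal[OF T.module_axioms, of D])
    fix h assume "h \<in> module_hom Q k.\<Omega> T" "\<And>a. a \<in> carrier Q \<Longrightarrow> h (k.d a) = D a"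
    then show ?thesis using D qc_closed[OF I] by (intro exI[of _ h]) auto
  next
    show "D (a \<otimes>\<^bsub>Q\<^esub> b) = a \<odot>\<^bsub>T\<^esub> D b \<oplus>\<^bsub>T\<^esub> b \<odot>\<^bsub>T\<^esub> D a" if ab: "a \<in> carrier Q" "b \<in> carrier Q" for a b
    proof -
      obtain f g where "a = q f" "b = q g" using ab by (auto simp: qc_carrier[OF I])
      moreover have "partial_deriv j (f * g) = f * partial_deriv j g + g * partial_deriv j f"
        by (simp add: partial_deriv_mult)
      ultimately show ?thesis by (simp only: D qc_mult[OF I] T_smult T_add)
    qed
  qed (auto simp: qc_carrier[OF I] T_carrier D qc_add[OF I] T_add partial_deriv_add T_zero)
qed

definition \<psi> :: "3 \<Rightarrow> ('k poly3 set \<Rightarrow> 'k poly3 set) set \<Rightarrow> 'k poly3 set"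
  where "\<psi> j = (SOME \<psi>. \<psi> \<in> module_hom Q k.\<Omega> T \<and> (\<forall>f. \<psi> (k.d (q f)) = qc J (partial_deriv j f)))"

lemma \<psi>: "\<psi> j \<in> module_hom Q k.\<Omega> T" "\<psi> j (k.d (q f)) = qc J (partial_deriv j f)"
  using someI_ex[OF \<psi>_exists[of j]] unfolding \<psi>_def by blast+

lemma \<psi>_mod_hom: "mod_hom Q k.\<Omega> T (\<psi> j)"
  by unfold_locales (rule \<psi>)

lemma \<psi>_dx: "\<psi> j (dx i) = qc J (if j = i then 1 else 0)"
  by (simp add: dx_eq \<psi> partial_deriv_pvar)

text \<open>Chosen polynomials representing the coordinates of a differential, determined only
  modulo \<open>J\<close>; \<open>vol_eq\<close> shows that their determinant does not depend on the
  choice there.\<close>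

definition p :: "('k poly3 set \<Rightarrow> 'k poly3 set) set \<Rightarrow> 3 \<Rightarrow> 'k poly3"
  where "p m j = (SOME f. qc J f = \<psi> j m)"

lemma p: "m \<in> carrier k.\<Omega> \<Longrightarrow> qc J (p m j) = \<psi> j m"
proof -
  assume "m \<in> carrier k.\<Omega>"
  then have "\<psi> j m \<in> carrier T" by (rule mod_hom.f_im[OF \<psi>_mod_hom])
  then obtain f where "qc J f = \<psi> j m" by (auto simp: T_carrier)
  then show ?thesis unfolding p_def by (rule someI)
qed

definition vol :: "('k poly3 set \<Rightarrow> 'k poly3 set) set list \<Rightarrow> 'k poly3 set"
  where "vol ws = qc J (det3 (p (ws ! 0)) (p (ws ! 1)) (p (ws ! 2)))"

lemma vol_eq:
  assumes "a \<in> carrier k.\<Omega>" "b \<in> carrier k.\<Omega>" "c \<in> carrier k.\<Omega>"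
    and "\<And>j. \<psi> j a = qc J (u j)" "\<And>j. \<psi> j b = qc J (v j)" "\<And>j. \<psi> j c = qc J (w j)"
  shows "vol [a, b, c] = qc J (det3 u v w)"
proof -
  have "det3 (p a) (p b) (p c) - det3 u v w \<in> J"
    using p[OF assms(1)] p[OF assms(2)] p[OF assms(3)] assms(4-)
    by (intro det3_cong[OF J]) (simp_all flip: qc_eq_iff[OF J])
  then show ?thesis by (simp add: vol_def qc_eq_iff[OF J])
qed

sublocale e: exterior_algebra Q k.\<Omega> 3
  by unfold_locales

lemma tuplesE:
  assumes "ws \<in> tuples k.\<Omega> 3"
  obtains a b c where "ws = [a, b, c]" "a \<in> carrier k.\<Omega>" "b \<in> carrier k.\<Omega>" "c \<in> carrier k.\<Omega>"
  using assms by (auto simp: tuples_def numeral_3_eq_3 length_Suc_conv)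

lemma tuplesI: "a \<in> carrier k.\<Omega> \<Longrightarrow> b \<in> carrier k.\<Omega> \<Longrightarrow> c \<in> carrier k.\<Omega> \<Longrightarrow> [a, b, c] \<in> tuples k.\<Omega> 3"
  by (auto simp: tuples_def)

lemma \<psi>_add:
  assumes "x \<in> carrier k.\<Omega>" "y \<in> carrier k.\<Omega>"
  shows "\<psi> j (x \<oplus>\<^bsub>k.\<Omega>\<^esub> y) = qc J (p x j + p y j)"
  using assms module_hom_add[OF \<psi>(1)] by (simp add: T_add[symmetric] p)

lemma \<psi>_smult:
  assumes "x \<in> carrier k.\<Omega>"
  shows "\<psi> j (q f \<odot>\<^bsub>k.\<Omega>\<^esub> x) = qc J (f * p x j)"
  using assms module_hom_smult[OF \<psi>(1) qc_closed[OF I]] by (simp add: T_smult[symmetric] p)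

lemma vol_update:
  assumes "ws \<in> tuples k.\<Omega> 3" "i < 3" "x \<in> carrier k.\<Omega>" "\<And>j. \<psi> j x = qc J (v j)"
  shows "vol (ws[i := x]) = qc J (det3 (if i = 0 then v else p (ws ! 0)) (if i = 1 then v else p (ws ! 1))
    (if i = 2 then v else p (ws ! 2)))"
proof -
  obtain a b c where ws: "ws = [a, b, c]" "a \<in> carrier k.\<Omega>" "b \<in> carrier k.\<Omega>" "c \<in> carrier k.\<Omega>"
    using assms(1) by (rule tuplesE)
  note v = vol_eq[of _ _ _ v "p b" "p c"] vol_eq[of _ _ _ "p a" v "p c"] vol_eq[of _ _ _ "p a" "p b" v]
  have "i = 0 \<or> i = 1 \<or> i = 2" using assms(2) by linarith
  then show ?thesis using ws(2-) assms(3,4) by (auto simp: ws(1) p v)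
qed

lemma vol_add:
  assumes "ws \<in> tuples k.\<Omega> 3" "i < 3" "x \<in> carrier k.\<Omega>" "y \<in> carrier k.\<Omega>"
  shows "vol (ws[i := x \<oplus>\<^bsub>k.\<Omega>\<^esub> y]) = vol (ws[i := x]) \<oplus>\<^bsub>T\<^esub> vol (ws[i := y])"
proof -
  have "i = 0 \<or> i = 1 \<or> i = 2" using assms(2) by linarith
  then show ?thesis
    using assms vol_update[OF assms(1,2,3) p[symmetric]] vol_update[OF assms(1,2,4) p[symmetric]]
      vol_update[OF assms(1,2) k.\<Omega>.M.a_closed[OF assms(3,4)] \<psi>_add]
    by (auto simp: T_add det3_def algebra_simps)
qed

lemma vol_smult:
  assumes "ws \<in> tuples k.\<Omega> 3" "i < 3" "r \<in> carrier Q" "x \<in> carrier k.\<Omega>"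
  shows "vol (ws[i := r \<odot>\<^bsub>k.\<Omega>\<^esub> x]) = r \<odot>\<^bsub>T\<^esub> vol (ws[i := x])"
proof -
  have i: "i = 0 \<or> i = 1 \<or> i = 2" using assms(2) by linarith
  obtain f where "r = q f" using assms(3) by (auto simp: qc_carrier[OF I])
  then show ?thesis
    using i assms vol_update[OF assms(1,2,4) p[symmetric]]
      vol_update[OF assms(1,2) k.\<Omega>.smult_closed[OF assms(3,4)], of "\<lambda>j. f * p x j"] \<psi>_smult[OF assms(4), of _ f]
    by (auto simp: T_smult det3_def algebra_simps)
qed

text \<open>Equal entries of the list have the same chosen representatives, so the determinant has
  two equal rows and is 0 already as a polynomial.\<close>

lemma vol_alternating: "ws \<in> tuples k.\<Omega> 3 \<Longrightarrow> \<not> distinct ws \<Longrightarrow> vol ws = \<zero>\<^bsub>T\<^esub>"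
  by (erule tuplesE) (auto simp: vol_def T_zero det3_def algebra_simps)

lemma vol_closed: "vol ws \<in> carrier T"
  by (simp add: vol_def T_carrier)

lemma \<Phi>_exists: "\<exists>\<Phi>. \<Phi> \<in> module_hom Q e.\<Lambda> T \<and> (\<forall>ws \<in> tuples k.\<Omega> 3. \<Phi> (e.w ws) = vol ws)"
proof (rule e.exterior_universal[OF T.module_axioms, of vol])
  show "vol ws \<in> carrier T" for ws by (rule vol_closed)
  fix h assume "h \<in> module_hom Q e.\<Lambda> T" "\<And>ws. ws \<in> tuples k.\<Omega> 3 \<Longrightarrow> h (e.w ws) = vol ws"
  then show ?thesis by blast
qed (rule vol_add vol_smult vol_alternating; assumption)+

definition \<Phi> :: "(('k poly3 set \<Rightarrow> 'k poly3 set) set list \<Rightarrow> 'k poly3 set) set \<Rightarrow> 'k poly3 set"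
  where "\<Phi> = (SOME \<Phi>. \<Phi> \<in> module_hom Q e.\<Lambda> T \<and> (\<forall>ws \<in> tuples k.\<Omega> 3. \<Phi> (e.w ws) = vol ws))"

lemma \<Phi>: "\<Phi> \<in> module_hom Q e.\<Lambda> T" "ws \<in> tuples k.\<Omega> 3 \<Longrightarrow> \<Phi> (e.w ws) = vol ws"
  using someI_ex[OF \<Phi>_exists] unfolding \<Phi>_def by blast+

sublocale \<Phi>: mod_hom Q e.\<Lambda> T \<Phi>
  by unfold_locales (rule \<Phi>)

definition \<omega> where "\<omega> = e.w [dx 0, dx 1, dx 2]"

lemma \<omega>_closed: "\<omega> \<in> carrier e.\<Lambda>"
  unfolding \<omega>_def by (intro e.wedge_closed tuplesI dx_closed)

lemma \<Phi>_\<omega>: "\<Phi> (q f \<odot>\<^bsub>e.\<Lambda>\<^esub> \<omega>) = qc J f"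
proof -
  have "vol [dx 0, dx 1, dx 2] = qc J (det3 (\<lambda>j. if j = 0 then 1 else 0) (\<lambda>j. if j = 1 then 1 else 0) (\<lambda>j. if j = 2 then 1 else 0))"
    by (rule vol_eq) (auto simp: dx_closed \<psi>_dx)
  then have "vol [dx 0, dx 1, dx 2] = qc J 1" by (simp add: det3_def)
  then have "\<Phi> \<omega> = qc J 1" by (simp add: \<omega>_def \<Phi>(2) tuplesI dx_closed)
  then show ?thesis using \<Phi>.f_smult[OF qc_closed[OF I, of f] \<omega>_closed] by (simp add: T_smult)
qed

end

text \<open>The homogeneous components are additive groups generated by a set, so a degree bound on
  images only has to be checked on generators and to respect zero, sums and negatives.\<close>

lemma generate_hom_image:
  assumes "mod_hom R M P h" "B \<subseteq> carrier M" "h ` B \<subseteq> U" "\<zero>\<^bsub>P\<^esub> \<in> U"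
    "\<And>x y. x \<in> U \<Longrightarrow> y \<in> U \<Longrightarrow> x \<oplus>\<^bsub>P\<^esub> y \<in> U" "\<And>x. x \<in> U \<Longrightarrow> \<ominus>\<^bsub>P\<^esub> x \<in> U"
    and "m \<in> generate (add_monoid M) B"
  shows "m \<in> carrier M \<and> h m \<in> U"
proof -
  interpret mod_hom R M P h by fact
  show ?thesis using assms(7)
  proof (induction rule: generate.induct)
    case (inv m)
    then have "m \<in> carrier M" "h m \<in> U" using assms(2,3) by auto
    then show ?case using assms(6) by (simp flip: a_inv_def)
  qed (use assms in auto)
qed

context derivative_ideal
begin

section \<open>The third exterior power is cyclic, with annihilator \<open>J\<close>\<close>

definition W where "W = (\<lambda>f. q f \<odot>\<^bsub>e.\<Lambda>\<^esub> \<omega>) ` UNIV"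

lemma qc_smult_W: "m \<in> W \<Longrightarrow> q f \<odot>\<^bsub>e.\<Lambda>\<^esub> m \<in> W"
  using \<omega>_closed qc_closed[OF I] by (auto simp: W_def qc_mult[OF I] simp flip: e.\<Lambda>.smult_assoc1)

lemma W_add: "m \<in> W \<Longrightarrow> n \<in> W \<Longrightarrow> m \<oplus>\<^bsub>e.\<Lambda>\<^esub> n \<in> W"
  using \<omega>_closed qc_closed[OF I] by (auto simp: W_def qc_add[OF I] simp flip: e.\<Lambda>.smult_l_distr)

lemma smult_W: "a \<in> carrier Q \<Longrightarrow> m \<in> W \<Longrightarrow> a \<odot>\<^bsub>e.\<Lambda>\<^esub> m \<in> W"
  by (auto simp: qc_carrier[OF I] qc_smult_W)

lemma W_zero: "\<zero>\<^bsub>e.\<Lambda>\<^esub> \<in> W"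
  unfolding W_def by (rule image_eqI[of _ _ 0]) (simp_all add: \<omega>_closed flip: qc_zero[OF I])

lemma W_closed: "m \<in> W \<Longrightarrow> m \<in> carrier e.\<Lambda>"
  using \<omega>_closed qc_closed[OF I] by (auto simp: W_def)

lemma differentials_induct:
  assumes m: "m \<in> carrier k.\<Omega>" and dx: "\<And>f j. q f \<odot>\<^bsub>k.\<Omega>\<^esub> dx j \<in> S"
    and add: "\<And>m n. m \<in> S \<Longrightarrow> n \<in> S \<Longrightarrow> m \<in> carrier k.\<Omega> \<Longrightarrow> n \<in> carrier k.\<Omega> \<Longrightarrow> m \<oplus>\<^bsub>k.\<Omega>\<^esub> n \<in> S"
  shows "m \<in> S"
  using m
proof (rule k.kahler_induct)
  show "\<zero>\<^bsub>k.\<Omega>\<^esub> \<in> S" using dx[of 0 0] by (simp add: dx_closed flip: qc_zero[OF I])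
  show "a \<odot>\<^bsub>k.\<Omega>\<^esub> k.d b \<in> S" if ab: "a \<in> carrier Q" "b \<in> carrier Q" for a b
  proof -
    obtain f g where fg: "a = q f" "b = q g" using ab by (auto simp: qc_carrier[OF I])
    note c = qc_closed[OF I]
    have "a \<odot>\<^bsub>k.\<Omega>\<^esub> k.d b = dx_sum (\<lambda>j. f * partial_deriv j g)"
      unfolding fg d_formula by (simp add: c dx_closed k.\<Omega>.smult_r_distr k.\<Omega>.smult_assoc1[symmetric] qc_mult[OF I])
    also have "\<dots> \<in> S" by (intro add dx) (simp_all add: c dx_closed)
    finally show ?thesis .
  qed
qed (rule add)

lemma wedge_add_nth:
  assumes "a \<in> carrier k.\<Omega>" "b \<in> carrier k.\<Omega>" "c \<in> carrier k.\<Omega>" "x \<in> carrier k.\<Omega>"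
  shows "e.w [a \<oplus>\<^bsub>k.\<Omega>\<^esub> x, b, c] = e.w [a, b, c] \<oplus>\<^bsub>e.\<Lambda>\<^esub> e.w [x, b, c]"
    "e.w [a, b \<oplus>\<^bsub>k.\<Omega>\<^esub> x, c] = e.w [a, b, c] \<oplus>\<^bsub>e.\<Lambda>\<^esub> e.w [a, x, c]"
    "e.w [a, b, c \<oplus>\<^bsub>k.\<Omega>\<^esub> x] = e.w [a, b, c] \<oplus>\<^bsub>e.\<Lambda>\<^esub> e.w [a, b, x]"
  using e.wedge_add[OF tuplesI[OF assms(1-3)], of 0 a x] e.wedge_add[OF tuplesI[OF assms(1-3)], of 1 b x]
    e.wedge_add[OF tuplesI[OF assms(1-3)], of 2 c x] assms by simp_all

lemma wedge_smult_nth: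
  assumes "a \<in> carrier k.\<Omega>" "b \<in> carrier k.\<Omega>" "c \<in> carrier k.\<Omega>" "r \<in> carrier Q"
  shows "e.w [r \<odot>\<^bsub>k.\<Omega>\<^esub> a, b, c] = r \<odot>\<^bsub>e.\<Lambda>\<^esub> e.w [a, b, c]"
    "e.w [a, r \<odot>\<^bsub>k.\<Omega>\<^esub> b, c] = r \<odot>\<^bsub>e.\<Lambda>\<^esub> e.w [a, b, c]"
    "e.w [a, b, r \<odot>\<^bsub>k.\<Omega>\<^esub> c] = r \<odot>\<^bsub>e.\<Lambda>\<^esub> e.w [a, b, c]"
  using e.wedge_smult[OF tuplesI[OF assms(1-3)], of 0 r a] e.wedge_smult[OF tuplesI[OF assms(1-3)], of 1 r b]
    e.wedge_smult[OF tuplesI[OF assms(1-3)], of 2 r c] assms by simp_all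

lemma wedge_alt:
  assumes "a \<in> carrier k.\<Omega>" "b \<in> carrier k.\<Omega>"
  shows "e.w [a, a, b] = \<zero>\<^bsub>e.\<Lambda>\<^esub>" "e.w [a, b, a] = \<zero>\<^bsub>e.\<Lambda>\<^esub>" "e.w [b, a, a] = \<zero>\<^bsub>e.\<Lambda>\<^esub>"
  by (rule e.wedge_alternating, intro tuplesI assms, simp)+

lemma W_uminus:
  assumes "m \<in> W" "m \<oplus>\<^bsub>e.\<Lambda>\<^esub> n = \<zero>\<^bsub>e.\<Lambda>\<^esub>" "n \<in> carrier e.\<Lambda>"
  shows "n \<in> W"
proof -
  have m: "m \<in> carrier e.\<Lambda>" using assms(1) by (rule W_closed)
  have "n = \<ominus>\<^bsub>e.\<Lambda>\<^esub> m"
    using e.\<Lambda>.M.minus_equality[of n m] assms m by (simp add: e.\<Lambda>.M.a_comm)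
  also have "\<dots> = \<ominus>\<^bsub>Q\<^esub> \<one>\<^bsub>Q\<^esub> \<odot>\<^bsub>e.\<Lambda>\<^esub> m" by (simp add: e.\<Lambda>.smult_l_minus m)
  also have "\<dots> \<in> W" using assms(1) by (intro smult_W) auto
  finally show ?thesis .
qed

text \<open>Expanding a wedge with the sum of two neighbouring entries in both of their places gives
  0 as the sum of the original wedge and the swapped one.\<close>

lemma wedge_swap:
  assumes "a \<in> carrier k.\<Omega>" "b \<in> carrier k.\<Omega>" "c \<in> carrier k.\<Omega>" "e.w [a, b, c] \<in> W"
  shows "e.w [b, a, c] \<in> W" "e.w [a, c, b] \<in> W"
proof -
  note [simp] = assms(1-3)
  have cl: "e.w [u, v, w] \<in> carrier e.\<Lambda>" if "u \<in> carrier k.\<Omega>" "v \<in> carrier k.\<Omega>" "w \<in> carrier k.\<Omega>" for u v w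
    using that by (intro e.wedge_closed tuplesI)
  have "\<zero>\<^bsub>e.\<Lambda>\<^esub> = e.w [a \<oplus>\<^bsub>k.\<Omega>\<^esub> b, a \<oplus>\<^bsub>k.\<Omega>\<^esub> b, c]" by (simp add: wedge_alt)
  also have "\<dots> = e.w [a, b, c] \<oplus>\<^bsub>e.\<Lambda>\<^esub> e.w [b, a, c]"
    by (simp only: wedge_add_nth assms(1-3) k.\<Omega>.M.a_closed) (simp add: wedge_alt cl e.\<Lambda>.M.a_comm)
  finally show "e.w [b, a, c] \<in> W" using W_uminus[OF assms(4)] cl by simp
  have "\<zero>\<^bsub>e.\<Lambda>\<^esub> = e.w [a, b \<oplus>\<^bsub>k.\<Omega>\<^esub> c, b \<oplus>\<^bsub>k.\<Omega>\<^esub> c]" by (simp add: wedge_alt)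
  also have "\<dots> = e.w [a, b, c] \<oplus>\<^bsub>e.\<Lambda>\<^esub> e.w [a, c, b]"
    by (simp only: wedge_add_nth assms(1-3) k.\<Omega>.M.a_closed) (simp add: wedge_alt cl e.\<Lambda>.M.a_comm)
  finally show "e.w [a, c, b] \<in> W" using W_uminus[OF assms(4)] cl by simp
qed

text \<open>Either two indices agree and the wedge is 0, or the indices are a permutation of 0, 1,
  2, reached by at most three swaps of neighbours.\<close>

lemma wedge_dx_W: "e.w [dx i, dx j, dx l] \<in> W"
proof -
  have 012: "e.w [dx 0, dx 1, dx 2] \<in> W"
    unfolding W_def \<omega>_def[symmetric]
    by (rule image_eqI[of _ _ 1]) (simp_all add: \<omega>_closed flip: qc_one[OF I])
  note s1 = wedge_swap(1)[OF dx_closed dx_closed dx_closed]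
  note s2 = wedge_swap(2)[OF dx_closed dx_closed dx_closed]
  have "\<forall>i j l. e.w [dx i, dx j, dx l] \<in> W" unfolding all_3
    by (simp add: wedge_alt dx_closed W_zero 012 s1[OF 012] s2[OF 012] s2[OF s1[OF 012]] s1[OF s2[OF 012]]
        s2[OF s1[OF s2[OF 012]]])
  then show ?thesis by blast
qed

text \<open>By multilinearity the entries are replaced one after the other by the
  \<open>dx j\<close>, which generate the differentials.\<close>

lemma wedge_W:
  assumes "a \<in> carrier k.\<Omega>" "b \<in> carrier k.\<Omega>" "c \<in> carrier k.\<Omega>"
  shows "e.w [a, b, c] \<in> W"
proof -
  note c = qc_closed[OF I]
  have 1: "a \<in> {a \<in> carrier k.\<Omega>. e.w [a, dx j, dx l] \<in> W}" if "a \<in> carrier k.\<Omega>" for a j l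
    using that by (rule differentials_induct)
      (simp_all add: dx_closed c wedge_add_nth wedge_smult_nth W_add smult_W wedge_dx_W)
  have 2: "b \<in> {b \<in> carrier k.\<Omega>. e.w [a, b, dx l] \<in> W}" if "a \<in> carrier k.\<Omega>" "b \<in> carrier k.\<Omega>" for a b l
    using that(2) 1[OF that(1)] that(1) by (elim differentials_induct)
      (simp_all add: dx_closed c wedge_add_nth wedge_smult_nth W_add smult_W)
  have "c \<in> {c \<in> carrier k.\<Omega>. e.w [a, b, c] \<in> W}"
    using assms(3) 2[OF assms(1,2)] assms(1,2) by (elim differentials_induct)
      (simp_all add: dx_closed c wedge_add_nth wedge_smult_nth W_add smult_W)
  then show ?thesis by simp
qed

lemma carrier_W: "m \<in> carrier e.\<Lambda> \<Longrightarrow> m \<in> W"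
  by (erule e.exterior_induct) (auto intro: W_zero W_add smult_W wedge_W elim!: tuplesE)

text \<open>The polynomials that kill \<open>\<omega>\<close> form an ideal containing
  \<open>I\<close>, so by leastness of \<open>J\<close> the derivatives of elements of
  \<open>I\<close> suffice. For \<open>f\<close> in \<open>I\<close> the differential of its class
  is 0; putting the expansion of this 0 in place of \<open>dx i\<close> in \<open>\<omega>\<close>
  leaves only the i-th derivative times \<open>\<omega>\<close>.\<close>

lemma kernel: "f \<in> J \<Longrightarrow> q f \<odot>\<^bsub>e.\<Lambda>\<^esub> \<omega> = \<zero>\<^bsub>e.\<Lambda>\<^esub>"
proof -
  note c = qc_closed[OF I]
  let ?J = "{f. q f \<odot>\<^bsub>e.\<Lambda>\<^esub> \<omega> = \<zero>\<^bsub>e.\<Lambda>\<^esub>}"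
  have J': "ideal ?J S_ring"
  proof (rule ideal_class_ringI)
    show "0 \<in> ?J" by (simp add: \<omega>_closed flip: qc_zero[OF I])
    show "f + g \<in> ?J" if "f \<in> ?J" "g \<in> ?J" for f g
      using that by (simp add: e.\<Lambda>.smult_l_distr c \<omega>_closed flip: qc_add[OF I])
    show "r * f \<in> ?J" if "f \<in> ?J" for r f
      using that by (simp add: e.\<Lambda>.smult_assoc1 c \<omega>_closed flip: qc_mult[OF I])
  qed
  have q0: "q f = \<zero>\<^bsub>Q\<^esub>" if "f \<in> I" for f
    using that by (simp add: qc_zero[OF I] qc_eq_iff[OF I])
  have I': "I \<subseteq> ?J" by (auto simp: q0 \<omega>_closed)
  have d': "partial_deriv i f \<in> ?J" if f: "f \<in> I" for f i
  proof -
    have "\<zero>\<^bsub>k.\<Omega>\<^esub> = k.d (q (0 :: 'k poly3))"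
      using k.d_const[of 0] by (simp add: pconst.hom_zero)
    also have "q (0 :: 'k poly3) = q f" using q0[OF f] by (simp add: qc_zero[OF I])
    finally have 0: "dx_sum (\<lambda>j. partial_deriv j f) = \<zero>\<^bsub>k.\<Omega>\<^esub>"
      unfolding d_formula by simp
    let ?s = "dx_sum (\<lambda>j. partial_deriv j f)"
    have z: "e.w [\<zero>\<^bsub>k.\<Omega>\<^esub>, a, b] = \<zero>\<^bsub>e.\<Lambda>\<^esub>" "e.w [a, \<zero>\<^bsub>k.\<Omega>\<^esub>, b] = \<zero>\<^bsub>e.\<Lambda>\<^esub>" "e.w [a, b, \<zero>\<^bsub>k.\<Omega>\<^esub>] = \<zero>\<^bsub>e.\<Lambda>\<^esub>"
      if "a \<in> carrier k.\<Omega>" "b \<in> carrier k.\<Omega>" for a b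
      using e.wedge_zero[OF tuplesI[OF that(1) that], of 0] e.wedge_zero[OF tuplesI[OF that(1) that], of 1]
        e.wedge_zero[OF tuplesI[OF that that(1)], of 2] by simp_all
    have cl: "e.w [u, v, w] \<in> carrier e.\<Lambda>" if "u \<in> carrier k.\<Omega>" "v \<in> carrier k.\<Omega>" "w \<in> carrier k.\<Omega>" for u v w
      using that by (intro e.wedge_closed tuplesI)
    note s = wedge_add_nth wedge_smult_nth wedge_alt dx_closed c cl
    have "e.w [?s, dx 1, dx 2] = q (partial_deriv 0 f) \<odot>\<^bsub>e.\<Lambda>\<^esub> \<omega>" by (simp add: s \<omega>_def)
    moreover have "e.w [dx 0, ?s, dx 2] = q (partial_deriv 1 f) \<odot>\<^bsub>e.\<Lambda>\<^esub> \<omega>" by (simp add: s \<omega>_def)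
    moreover have "e.w [dx 0, dx 1, ?s] = q (partial_deriv 2 f) \<odot>\<^bsub>e.\<Lambda>\<^esub> \<omega>" by (simp add: s \<omega>_def)
    ultimately have "\<forall>i. partial_deriv i f \<in> ?J" unfolding all_3 0 by (simp add: z dx_closed)
    then show ?thesis by blast
  qed
  show "q f \<odot>\<^bsub>e.\<Lambda>\<^esub> \<omega> = \<zero>\<^bsub>e.\<Lambda>\<^esub>" if "f \<in> J" using least[OF J' I' d'] that by blast
qed

text \<open>Every element is a multiple of \<open>\<omega>\<close>, and the value of
  \<open>\<Phi>\<close> determines the coefficient modulo \<open>J\<close>, which by
  \<open>kernel\<close> is exactly what matters.\<close>

lemma \<Phi>_bij: "bij_betw \<Phi> (carrier e.\<Lambda>) (range (qc J))"
  unfolding bij_betw_def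
proof
  show "inj_on \<Phi> (carrier e.\<Lambda>)"
  proof (rule inj_onI)
    fix m n assume mn: "m \<in> carrier e.\<Lambda>" "n \<in> carrier e.\<Lambda>" "\<Phi> m = \<Phi> n"
    obtain f g where fg: "m = q f \<odot>\<^bsub>e.\<Lambda>\<^esub> \<omega>" "n = q g \<odot>\<^bsub>e.\<Lambda>\<^esub> \<omega>"
      using carrier_W[OF mn(1)] carrier_W[OF mn(2)] by (auto simp: W_def)
    then have "f - g \<in> J" using mn(3) by (simp add: \<Phi>_\<omega> qc_eq_iff[OF J])
    then have 0: "q (f - g) \<odot>\<^bsub>e.\<Lambda>\<^esub> \<omega> = \<zero>\<^bsub>e.\<Lambda>\<^esub>" by (rule kernel)
    have "m = q (f - g + g) \<odot>\<^bsub>e.\<Lambda>\<^esub> \<omega>" by (simp add: fg)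
    also have "\<dots> = n" unfolding qc_add[OF I, symmetric]
      by (simp only: e.\<Lambda>.smult_l_distr[OF qc_closed[OF I] qc_closed[OF I] \<omega>_closed] 0 fg(2)[symmetric] e.\<Lambda>.M.l_zero[OF mn(2)])
    finally show "m = n" .
  qed
  show "\<Phi> ` carrier e.\<Lambda> = range (qc J)"
  proof
    show "\<Phi> ` carrier e.\<Lambda> \<subseteq> range (qc J)" using \<Phi>.f_im T_carrier by blast
    show "range (qc J) \<subseteq> \<Phi> ` carrier e.\<Lambda>"
    proof safe
      fix f show "qc J f \<in> \<Phi> ` carrier e.\<Lambda>"
        using \<Phi>_\<omega>[of f] \<omega>_closed qc_closed[OF I, of f] by (intro image_eqI[of _ _ "q f \<odot>\<^bsub>e.\<Lambda>\<^esub> \<omega>"]) auto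
    qed
  qed
qed

lemma omega_eq: "omega I 3 = restrict_scalars q e.\<Lambda>"
  by (simp add: omega_def omega1_eq qc_def[abs_def])

lemma omega_carrier: "carrier (omega I 3) = carrier e.\<Lambda>"
  by (simp add: omega_eq restrict_scalars_def)

lemma \<Phi>_module_hom: "\<Phi> \<in> module_hom S_ring (omega I 3) (quot_poly J)"
proof -
  have T: "a \<oplus>\<^bsub>T\<^esub> b = a \<oplus>\<^bsub>quot_poly J\<^esub> b" if "a \<in> range (qc J)" "b \<in> range (qc J)" for a b
    using that by (auto simp: T_add quot_poly_add[OF J])
  have T': "q f \<odot>\<^bsub>T\<^esub> a = f \<odot>\<^bsub>quot_poly J\<^esub> a" if "a \<in> range (qc J)" for a f
    using that by (auto simp: T_smult quot_poly_smult[OF J])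
  have cl: "\<Phi> m \<in> range (qc J)" if "m \<in> carrier e.\<Lambda>" for m using \<Phi>.f_im[OF that] T_carrier by blast
  show ?thesis
    unfolding module_hom_def
    using cl qc_closed[OF I] by (auto simp: omega_eq restrict_scalars_def quot_poly_carrier[OF J] T T')
qed

lemma omega_is_module: "module S_ring (omega I 3)"
  unfolding omega_eq
  by (rule restrict_scalars_is_module[OF e.\<Lambda>.module_axioms class_cring.cring_axioms qc_ring_hom[OF I]])

lemma T_uminus: "\<ominus>\<^bsub>T\<^esub> qc J f = qc J (- f)"
  by (rule T.M.minus_equality) (simp_all add: T_add T_zero T_carrier)

section \<open>Compatibility with the gradings\<close>

lemma omega1_degD:
  assumes "m \<in> omega1_deg I n"
  shows "m \<in> carrier k.\<Omega> \<and> \<psi> l m \<in> qc J ` homog (n - 1)"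
proof (rule generate_hom_image[OF \<psi>_mod_hom _ _ _ _ _ assms[unfolded omega1_deg_def omega1_eq]])
  have "\<psi> l (q f \<odot>\<^bsub>k.\<Omega>\<^esub> dx j) = qc J (if l = j then f else 0)" for f j
    using module_hom_smult[OF \<psi>(1) qc_closed[OF I, of f] dx_closed[of j], of l] by (simp add: \<psi>_dx T_smult)
  then show "\<psi> l ` {r \<odot>\<^bsub>k.\<Omega>\<^esub> dx j | r j. r \<in> quot_poly_deg I (n - 1)} \<subseteq> qc J ` homog (n - 1)"
    by (auto simp: quot_poly_deg_eq[OF I])
qed (use dx_closed qc_closed[OF I] in \<open>auto simp: quot_poly_deg_eq[OF I] T_zero T_add T_uminus homog_add homog_uminus\<close>)

definition omega_gens :: "int \<Rightarrow> (('k poly3 set \<Rightarrow> 'k poly3 set) set list \<Rightarrow> 'k poly3 set) set set"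
  where "omega_gens n = {e.w ws | ws ds. list_all2 (\<lambda>w d. w \<in> omega1_deg I d) ws ds \<and> length ws = 3 \<and> sum_list ds = n}"

lemma omega_deg_generate: "omega_deg I 3 n = generate (add_monoid (omega I 3)) (omega_gens n)"
  unfolding omega_deg_def omega_gens_def omega1_eq ..

text \<open>A differential of degree d has coordinates of degree d - 1, so a determinant of three of
  them loses 3 in degree; this is the origin of the shift.\<close>

lemma omega_degD:
  assumes "m \<in> omega_deg I 3 n"
  shows "m \<in> carrier e.\<Lambda> \<and> \<Phi> m \<in> qc J ` homog (n - 3)"
proof -
  have base: "m \<in> carrier e.\<Lambda> \<and> \<Phi> m \<in> qc J ` homog (n - 3)" if m: "m \<in> omega_gens n" for m
  proof -
    obtain ws ds where ws: "m = e.w ws" "list_all2 (\<lambda>w d. w \<in> omega1_deg I d) ws ds" "length ws = 3" "sum_list ds = n"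
      using m by (auto simp: omega_gens_def)
    then obtain a b c where abc: "ws = [a, b, c]" by (auto simp: numeral_3_eq_3 length_Suc_conv)
    then obtain d1 d2 d3 where ds: "ds = [d1, d2, d3]" "a \<in> omega1_deg I d1" "b \<in> omega1_deg I d2" "c \<in> omega1_deg I d3"
      using ws(2) by (auto simp: list_all2_Cons1)
    note a = omega1_degD[OF ds(2)] and b = omega1_degD[OF ds(3)] and c = omega1_degD[OF ds(4)]
    have "\<forall>j. \<exists>f. \<psi> j a = qc J f \<and> f \<in> homog (d1 - 1)" using a by auto
    then obtain u where u: "\<And>j. \<psi> j a = qc J (u j)" "\<And>j. u j \<in> homog (d1 - 1)" by metis
    have "\<forall>j. \<exists>f. \<psi> j b = qc J f \<and> f \<in> homog (d2 - 1)" using b by auto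
    then obtain v where v: "\<And>j. \<psi> j b = qc J (v j)" "\<And>j. v j \<in> homog (d2 - 1)" by metis
    have "\<forall>j. \<exists>f. \<psi> j c = qc J f \<and> f \<in> homog (d3 - 1)" using c by auto
    then obtain w where w: "\<And>j. \<psi> j c = qc J (w j)" "\<And>j. w j \<in> homog (d3 - 1)" by metis
    have "\<Phi> m = qc J (det3 u v w)"
      unfolding ws(1) abc using a b c vol_eq[OF _ _ _ u(1) v(1) w(1)] by (simp add: \<Phi>(2) tuplesI)
    moreover have "det3 u v w \<in> homog (n - 3)"
      using det3_homog[of u "d1 - 1" v "d2 - 1" w "d3 - 1"] u v w ws(4) ds(1) by (simp add: algebra_simps)
    moreover have "m \<in> carrier e.\<Lambda>" unfolding ws(1) abc using a b c by (intro e.wedge_closed tuplesI) auto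
    ultimately show ?thesis by blast
  qed
  have hom: "mod_hom S_ring (omega I 3) (quot_poly J) \<Phi>"
    using omega_is_module quot_poly_is_module[OF J] \<Phi>_module_hom
    by (simp add: mod_hom_def mod_hom_axioms_def)
  interpret P: module S_ring "quot_poly J" by (rule quot_poly_is_module[OF J])
  have "\<ominus>\<^bsub>quot_poly J\<^esub> qc J f = qc J (- f)" for f
    by (rule P.M.minus_equality) (simp_all add: quot_poly_add[OF J] quot_poly_zero[OF J] quot_poly_carrier[OF J])
  then have "m \<in> carrier (omega I 3) \<and> \<Phi> m \<in> qc J ` homog (n - 3)"
    using base
    by (intro generate_hom_image[OF hom _ _ _ _ _ assms[unfolded omega_deg_generate]])
      (auto simp: omega_carrier quot_poly_zero[OF J] quot_poly_add[OF J] homog_add homog_uminus)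
  then show ?thesis by (simp add: omega_carrier)
qed

lemma \<Phi>_omega_deg: "\<Phi> ` omega_deg I 3 n = qc J ` homog (n - 3)"
proof
  show "\<Phi> ` omega_deg I 3 n \<subseteq> qc J ` homog (n - 3)" using omega_degD by blast
  show "qc J ` homog (n - 3) \<subseteq> \<Phi> ` omega_deg I 3 n"
  proof
    fix a assume "a \<in> qc J ` homog (n - 3)"
    then obtain f where f: "a = qc J f" "f \<in> homog (n - 3)" by blast
    have 1: "q g \<odot>\<^bsub>k.\<Omega>\<^esub> dx j \<in> omega1_deg I d" if "g \<in> homog (d - 1)" for g j d
      unfolding omega1_deg_def omega1_eq using that
      by (intro generate.incl) (auto simp: quot_poly_deg_eq[OF I])
    have dx1: "dx j \<in> omega1_deg I 1" for j
      using 1[of 1 1 j] homog_pconst[of 1] dx_closed[of j] by (simp add: pconst.hom_one qc_one[OF I, symmetric])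
    have "q f \<odot>\<^bsub>k.\<Omega>\<^esub> dx 0 \<in> omega1_deg I (n - 2)" using f(2) by (intro 1) simp
    then have "e.w [q f \<odot>\<^bsub>k.\<Omega>\<^esub> dx 0, dx 1, dx 2] \<in> omega_gens n"
      \<comment> \<open>The coefficient, of degree \<open>n - 3\<close>, is put into the first
        factor, so the three factors have degrees \<open>n - 2\<close>, 1 and 1.\<close>
      unfolding omega_gens_def using dx1 by (intro CollectI exI[of _ "[q f \<odot>\<^bsub>k.\<Omega>\<^esub> dx 0, dx 1, dx 2]"] exI[of _ "[n - 2, 1, 1]"]) simp
    then have "e.w [q f \<odot>\<^bsub>k.\<Omega>\<^esub> dx 0, dx 1, dx 2] \<in> omega_deg I 3 n"
      unfolding omega_deg_generate by (rule generate.incl)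
    then have "q f \<odot>\<^bsub>e.\<Lambda>\<^esub> \<omega> \<in> omega_deg I 3 n"
      unfolding \<omega>_def by (simp only: wedge_smult_nth(1)[OF dx_closed dx_closed dx_closed qc_closed[OF I]])
    then show "a \<in> \<Phi> ` omega_deg I 3 n" unfolding f(1) by (rule image_eqI[where f = \<Phi>, OF \<Phi>_\<omega>[symmetric]])
  qed
qed

theorem omega3_graded_isomorphic:
  "graded_isomorphic S_ring (omega I 3) (omega_deg I 3) (quot_poly J) (shift (- 3) (quot_poly_deg J))"
  unfolding graded_isomorphic_def
  using \<Phi>_module_hom \<Phi>_bij \<Phi>_omega_deg
  by (intro bexI[of _ \<Phi>]) (auto simp: omega_carrier quot_poly_carrier[OF J] shift_def quot_poly_deg_eq[OF J])

end

subsection \<open>Hilbert functions\<close>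

lemma iso_image_gen_set:
  assumes "mod_hom K V W h" "h ` carrier V = carrier W" "A \<subseteq> carrier V" "module.span K V A = carrier V"
  shows "module.span K W (h ` A) = carrier W"
proof -
  interpret mod_hom K V W h by fact
  let ?U = "{v \<in> carrier V. h v \<in> N.span (h ` A)}"
  have hA: "h ` A \<subseteq> carrier W" using assms(3) by auto
  interpret S: LinearCombinations.submodule K "N.span (h ` A)" W by (rule N.span_is_submodule[OF hA])
  have "LinearCombinations.submodule K ?U V"
    by (rule submodule.intro) (auto simp: M.module_axioms)
  moreover have "A \<subseteq> ?U" using assms(3) N.in_own_span[OF hA] by auto
  ultimately have "M.span A \<subseteq> ?U" by (intro M.span_is_subset)
  then have "carrier V \<subseteq> ?U" using assms(4) by simp
  then have "h ` carrier V \<subseteq> N.span (h ` A)" by blast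
  then show ?thesis using assms(2) N.span_is_subset2[OF hA] by simp
qed

text \<open>\<open>dim\<close> is the least size of a finite spanning set, and both \<open>h\<close>
  and its inverse carry spanning sets to spanning sets of the same size.\<close>

lemma iso_dim_eq:
  assumes V: "vectorspace K V" and W: "vectorspace K W" and h: "h \<in> module_hom K V W" "bij_betw h (carrier V) (carrier W)"
  shows "vectorspace.dim K V = vectorspace.dim K W"
proof -
  interpret V: vectorspace K V by fact
  interpret W: vectorspace K W by fact
  define h' where "h' = inv_into (carrier V) h"
  have h'b: "bij_betw h' (carrier W) (carrier V)" unfolding h'_def using h(2) by (rule bij_betw_inv_into)
  have hh': "h (h' w) = w" if "w \<in> carrier W" for w
    using that h(2) unfolding h'_def by (simp add: bij_betw_inv_into_right)
  have h'h: "h' (h v) = v" if "v \<in> carrier V" for v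
    using that h(2) unfolding h'_def by (simp add: bij_betw_inv_into_left)
  have h'c: "h' w \<in> carrier V" if "w \<in> carrier W" for w using h'b that by (auto simp: bij_betw_def)
  have h': "h' \<in> module_hom K W V"
    unfolding module_hom_def
  proof (intro CollectI conjI allI impI funcsetI)
    fix w w' assume w: "w \<in> carrier W \<and> w' \<in> carrier W"
    have "h (h' w \<oplus>\<^bsub>V\<^esub> h' w') = w \<oplus>\<^bsub>W\<^esub> w'" using w by (simp add: module_hom_add[OF h(1)] h'c hh')
    then show "h' (w \<oplus>\<^bsub>W\<^esub> w') = h' w \<oplus>\<^bsub>V\<^esub> h' w'" using h'h[of "h' w \<oplus>\<^bsub>V\<^esub> h' w'"] w h'c by simp
  next
    fix r w assume w: "r \<in> carrier K \<and> w \<in> carrier W"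
    have "h (r \<odot>\<^bsub>V\<^esub> h' w) = r \<odot>\<^bsub>W\<^esub> w" using w by (simp add: module_hom_smult[OF h(1)] h'c hh')
    then show "h' (r \<odot>\<^bsub>W\<^esub> w) = r \<odot>\<^bsub>V\<^esub> h' w" using h'h[of "r \<odot>\<^bsub>V\<^esub> h' w"] w h'c by simp
  qed (rule h'c)
  have gens: "\<exists>A'. finite A' \<and> card A' = n \<and> A' \<subseteq> carrier W' \<and> module.span K W' A' = carrier W'"
    if hyps: "mod_hom K V' W' f" "bij_betw f (carrier V') (carrier W')"
      "\<exists>A. finite A \<and> card A = n \<and> A \<subseteq> carrier V' \<and> module.span K V' A = carrier V'" for n V' W' f
  proof -
    obtain A where A: "finite A" "card A = n" "A \<subseteq> carrier V'" "module.span K V' A = carrier V'"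
      using hyps(3) by blast
    have f: "f ` carrier V' = carrier W'" "inj_on f A"
      using hyps(2) A(3) by (auto simp: bij_betw_def intro: inj_on_subset)
    have "f ` A \<subseteq> carrier W'" unfolding f(1)[symmetric] by (rule image_mono[OF A(3)])
    then show ?thesis
      using iso_image_gen_set[OF hyps(1) f(1) A(3,4)] A(1,2) f(2)
      by (intro exI[of _ "f ` A"]) (simp add: card_image)
  qed
  have mh: "mod_hom K V W h" "mod_hom K W V h'" by unfold_locales (rule h h')+
  have "(\<exists>A. finite A \<and> card A = n \<and> A \<subseteq> carrier V \<and> V.gen_set A) \<longleftrightarrow>
      (\<exists>A. finite A \<and> card A = n \<and> A \<subseteq> carrier W \<and> W.gen_set A)" for n
    by (rule iffI; erule gens[OF mh(1) h(2)] gens[OF mh(2) h'b])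
  then show ?thesis unfolding V.dim_def W.dim_def by simp
qed

lemma class_ring_field: "field (class_ring :: 'k::field ring)"
  by (rule class_field.field_axioms)

lemma pconst_ring_hom: "pconst \<in> Ring.ring_hom class_ring S_ring"
  by (rule ring_hom_memI) (simp_all add: pconst.hom_mult pconst.hom_add)

text \<open>\<open>omega_deg\<close> is defined by additive generation, so its closure under scalars
  is not visible. Since \<open>h\<close> is injective, \<open>G i\<close> is the full preimage of
  \<open>H j\<close> and inherits the subspace structure from it.\<close>

lemma hilbert_function_eq:
  fixes M :: "('k::field poly3, 'm) module" and N :: "('k poly3, 'n) module"
  assumes M: "module S_ring M" and N: "module S_ring N"
    and h: "h \<in> module_hom S_ring M N" "inj_on h (carrier M)"
    and G: "G i \<subseteq> carrier M" "h ` G i = H j"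
    and H: "LinearCombinations.submodule class_ring (H j) (restrict_scalars pconst N)"
  shows "hilbert_function M G i = hilbert_function N H j"
proof -
  let ?M = "restrict_scalars pconst M" and ?N = "restrict_scalars pconst N"
  interpret M: module S_ring M by fact
  interpret N: module S_ring N by fact
  interpret rM: module class_ring ?M
    by (rule restrict_scalars_is_module[OF M class_cring.cring_axioms pconst_ring_hom])
  interpret rN: module class_ring ?N
    by (rule restrict_scalars_is_module[OF N class_cring.cring_axioms pconst_ring_hom])
  interpret H: LinearCombinations.submodule class_ring "H j" ?N by (rule H)
  have rc: "carrier ?M = carrier M" "carrier ?N = carrier N" "add ?M = add M" "add ?N = add N" "zero ?M = zero M" "zero ?N = zero N"
    "module.smult ?M a m = module.smult M (pconst a) m" "module.smult ?N a n = module.smult N (pconst a) n" for a m n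
    by (simp_all add: restrict_scalars_def)
  have memG: "m \<in> G i" if m: "m \<in> carrier M" "h m \<in> H j" for m
  proof -
    obtain m' where "m' \<in> G i" "h m' = h m" using m(2) G(2) by (metis imageE)
    then show ?thesis using m(1) G(1) h(2) by (metis inj_onD subsetD)
  qed
  have hG: "m \<in> G i \<Longrightarrow> h m \<in> H j" for m using G(2) by blast
  interpret h: mod_hom S_ring M N h by unfold_locales (rule h)
  have GS: "LinearCombinations.submodule class_ring (G i) ?M"
  proof (rule submodule.intro)
    show "module class_ring ?M" by (rule rM.module_axioms)
    show "G i \<subseteq> carrier ?M" using G(1) by (simp add: rc)
    show "v \<oplus>\<^bsub>?M\<^esub> w \<in> G i" if "v \<in> G i" "w \<in> G i" for v w
      unfolding rc using that G(1) hG H.m_closed[unfolded rc] by (intro memG) (auto simp: subset_iff)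
    show "\<zero>\<^bsub>?M\<^esub> \<in> G i"
      unfolding rc using H.zero_closed[unfolded rc] by (intro memG) auto
    show "c \<odot>\<^bsub>?M\<^esub> v \<in> G i" if "c \<in> carrier class_ring" "v \<in> G i" for c v
      unfolding rc using that G(1) hG H.smult_closed[unfolded rc] by (intro memG) (auto simp: subset_iff)
  qed
  have V: "vectorspace class_ring (?M\<lparr>carrier := G i\<rparr>)"
    by (rule vectorspace.intro[OF rM.submodule_is_module[OF GS] class_ring_field])
  have W: "vectorspace class_ring (?N\<lparr>carrier := H j\<rparr>)"
    by (rule vectorspace.intro[OF rN.submodule_is_module[OF H] class_ring_field])
  show ?thesis unfolding hilbert_function_def
  proof (rule iso_dim_eq[OF V W])
    show "h \<in> module_hom class_ring (?M\<lparr>carrier := G i\<rparr>) (?N\<lparr>carrier := H j\<rparr>)"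
      unfolding module_hom_def using hG G(1) by (auto simp: rc subset_iff)
    show "bij_betw h (carrier (?M\<lparr>carrier := G i\<rparr>)) (carrier (?N\<lparr>carrier := H j\<rparr>))"
      using G h(2) by (auto simp: bij_betw_def intro: inj_on_subset)
  qed
qed

context derivative_ideal
begin

lemma omega3_hilbert_function:
  "hilbert_function (omega I 3) (omega_deg I 3) n = hilbert_function (quot_poly J) (quot_poly_deg J) (n - 3)"
proof (rule hilbert_function_eq[OF omega_is_module quot_poly_is_module[OF J] \<Phi>_module_hom])
  show "inj_on \<Phi> (carrier (omega I 3))" using \<Phi>_bij by (simp add: omega_carrier bij_betw_def)
  show "omega_deg I 3 n \<subseteq> carrier (omega I 3)" using omega_degD by (auto simp: omega_carrier)
  show "\<Phi> ` omega_deg I 3 n = quot_poly_deg J (n - 3)" by (simp add: \<Phi>_omega_deg quot_poly_deg_eq[OF J])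
  show "LinearCombinations.submodule class_ring (quot_poly_deg J (n - 3)) (restrict_scalars pconst (quot_poly J))"
  proof (rule submodule.intro)
    show "module class_ring (restrict_scalars pconst (quot_poly J))"
      by (rule restrict_scalars_is_module[OF quot_poly_is_module[OF J] class_cring.cring_axioms pconst_ring_hom])
    show "\<zero>\<^bsub>restrict_scalars pconst (quot_poly J)\<^esub> \<in> quot_poly_deg J (n - 3)"
      using quot_poly_zero[OF J] by (auto simp: restrict_scalars_def quot_poly_deg_eq[OF J])
  qed (use homog_mult[OF homog_pconst] in \<open>auto simp: restrict_scalars_def quot_poly_deg_eq[OF J] quot_poly_carrier[OF J] quot_poly_add[OF J] quot_poly_smult[OF J] intro!: imageI homog_add\<close>)
qed

end

context conic_points
begin

section \<open>The given points as parameters, and the conclusion\<close>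

lemma derivative_ideal_MI: "derivative_ideal (I (Suc \<mu>)) (MI \<mu>)"
proof (rule derivative_ideal.intro[OF ideal_I ideal_MI])
  show "I (Suc \<mu>) \<subseteq> MI \<mu>" using I_subset_MI by blast
  show "partial_deriv i f \<in> MI \<mu>" if "f \<in> I (Suc \<mu>)" for f i using that by (rule deriv_MI)
  show "MI \<mu> \<subseteq> J" if "ideal J S_ring" "\<And>f i. f \<in> I (Suc \<mu>) \<Longrightarrow> partial_deriv i f \<in> J" for J
    using that by (rule derivs_generate_MI)
qed

lemma fat_ideal_eq: "fat_ideal k ((\<lambda>a. line (pt a)) ` A) = I k"
  by (simp add: fat_ideal_def I_def ipow_def vi_def)

end

text \<open>No point of \<open>L\<close> lies on \<open>Y 0\<close>, so each has the finite
  parameter \<open>Y 1 / Y 0\<close>. Distinct parameters give distinct points, so the cardinality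
  carries over to \<open>A\<close>.\<close>

lemma conic_points_exist:
  fixes C :: "'k::field_char_0 poly3"
  assumes "nonsingular_conic C" "finite L" "L \<subseteq> proj_plane" "L \<subseteq> zero_locus C" "card L \<ge> 4"
  obtains x y :: "3 \<Rightarrow> 3 \<Rightarrow> 'k" and c A where "conic_points x y c A" "L = (\<lambda>a. line (conic_points.pt x a)) ` A"
proof -
  have "card L \<ge> 2" using assms(5) by simp
  then obtain x y :: "3 \<Rightarrow> 3 \<Rightarrow> 'k" and c where xyc: "c \<noteq> 0"
    "\<And>i j. (\<Sum>k\<in>UNIV. x i k * y k j) = (if i = j then 1 else 0)"
    "\<And>i j. (\<Sum>k\<in>UNIV. y i k * x k j) = (if i = j then 1 else 0)"
    "C = pconst c * ((linform (y 1))\<^sup>2 - linform (y 0) * linform (y 2))"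
    "\<And>P v. P \<in> L \<Longrightarrow> v \<in> P \<Longrightarrow> v \<noteq> (\<lambda>_. 0) \<Longrightarrow> (\<Sum>i\<in>UNIV. y 0 i * v i) \<noteq> 0"
    using conic_normal_form[OF assms(1-4)] by blast
  define pt where "pt a i = x i 0 + x i 1 * a + x i 2 * a\<^sup>2" for a i
  define A where "A = {a. line (pt a) \<in> L}"
  have y_pt: "(\<Sum>i\<in>UNIV. y k i * pt a i) = (if k = 0 then 1 else 0) + (if k = 1 then 1 else 0) * a + (if k = 2 then 1 else 0) * a\<^sup>2" for k a
    unfolding xyc(3)[symmetric] by (simp add: pt_def sum_UNIV_3 algebra_simps)
  have inj: "inj (\<lambda>a. line (pt a))"
  proof (rule injI)
    fix a b assume "line (pt a) = line (pt b)"
    then obtain s where s: "pt a = (\<lambda>i. s * pt b i)" using mem_line[of "pt a"] by (auto simp: line_def)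
    have *: "(\<Sum>i\<in>UNIV. y k i * pt a i) = s * (\<Sum>i\<in>UNIV. y k i * pt b i)" for k
      by (simp add: s sum_distrib_left mult_ac)
    show "a = b" using *[of 0] *[of 1] unfolding y_pt by simp
  qed
  have L: "L = (\<lambda>a. line (pt a)) ` A"
  proof
    show "L \<subseteq> (\<lambda>a. line (pt a)) ` A"
    proof
      fix P assume P: "P \<in> L"
      then obtain v where v: "v \<noteq> (\<lambda>_. 0)" "P = line v" using assms(3) proj_planeE by blast
      have vP: "v \<in> P" by (simp add: v mem_line)
      define Y where "Y k = (\<Sum>i\<in>UNIV. y k i * v i)" for k
      have Y0: "Y 0 \<noteq> 0" using xyc(5)[OF P vP v(1)] by (simp add: Y_def)
      interpret p: comm_ring_hom "peval id v" by (rule peval_hom)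
      have "peval id v C = 0" using P vP assms(4) by (auto simp: zero_locus_def)
      then have Y2: "Y 1 ^ 2 = Y 0 * Y 2"
        using xyc(1) by (simp add: xyc(4) p.hom_mult p.hom_minus p.hom_power peval_pconst peval_linform Y_def)
      \<comment> \<open>On the conic the square of \<open>Y 1\<close> is \<open>Y 0 * Y 2\<close>,
        so the coordinates of \<open>v\<close> are \<open>Y 0\<close> times 1, a, a^2 with
        \<open>a = Y 1 / Y 0\<close>.\<close>
      have "v i = Y 0 * pt (Y 1 / Y 0) i" for i
      proof -
        have "v i = (\<Sum>j\<in>UNIV. (\<Sum>k\<in>UNIV. x i k * y k j) * v j)"
          by (simp add: xyc(2) if_distrib[of "\<lambda>t. t * _"] cong: if_cong)
        also have "\<dots> = x i 0 * Y 0 + x i 1 * Y 1 + x i 2 * Y 2"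
          by (simp add: Y_def sum_UNIV_3 algebra_simps)
        also have "\<dots> = Y 0 * pt (Y 1 / Y 0) i"
          using Y0 Y2 by (simp add: pt_def field_simps power2_eq_square)
        finally show ?thesis .
      qed
      then have "line v = line (pt (Y 1 / Y 0))" using v(1) by (intro line_eqI) auto
      then show "P \<in> (\<lambda>a. line (pt a)) ` A" using P v by (auto simp: A_def)
    qed
  qed (auto simp: A_def)
  have "finite A" using assms(2) inj unfolding L by (metis finite_imageD inj_on_subset subset_UNIV)
  moreover have "card A \<ge> 4" using assms(5) inj unfolding L by (metis card_image inj_on_subset subset_UNIV)
  ultimately have cp: "conic_points x y c A" using xyc by unfold_locales auto
  have "conic_points.pt x = pt" unfolding conic_points.pt_def[OF cp, abs_def] pt_def[abs_def] ..
  then show ?thesis using that[OF cp] L by simp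
qed

theorem theorem9p6:
  fixes s \<nu> :: nat
    and \<X> :: "(3 \<Rightarrow> 'k::field_char_0) set set"
    and C :: "'k poly3"
  assumes "s \<ge> 4" and "\<nu> \<ge> 1"
    and "\<X> \<subseteq> proj_plane" and "finite \<X>" and "card \<X> = s"
    and "nonsingular_conic C" and "\<X> \<subseteq> zero_locus C"
    and "\<X> \<inter> zero_locus (pvar 0) = {}"
  shows "graded_isomorphic S_ring
           (omega (fat_ideal \<nu> \<X>) 3)
           (omega_deg (fat_ideal \<nu> \<X>) 3)
           (quot_poly (ideal_prod S_ring irrelevant_ideal (fat_ideal (\<nu> - 1) \<X>)))
           (shift (- 3) (quot_poly_deg (ideal_prod S_ring irrelevant_ideal (fat_ideal (\<nu> - 1) \<X>))))
       \<and> (\<forall>i :: nat.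
           hilbert_function (omega (fat_ideal \<nu> \<X>) 3) (omega_deg (fat_ideal \<nu> \<X>) 3) (int i)
         = hilbert_function
             (quot_poly (ideal_prod S_ring irrelevant_ideal (fat_ideal (\<nu> - 1) \<X>)))
             (quot_poly_deg (ideal_prod S_ring irrelevant_ideal (fat_ideal (\<nu> - 1) \<X>)))
             (int i - 3))"
proof -
  obtain x y :: "3 \<Rightarrow> 3 \<Rightarrow> 'k" and c A where cp: "conic_points x y c A"
    and L: "\<X> = (\<lambda>a. line (conic_points.pt x a)) ` A"
    using conic_points_exist[of C \<X>] assms by blast
  interpret conic_points x y c A by (rule cp)
  obtain \<mu> where \<nu>: "\<nu> = Suc \<mu>" using assms(2) by (cases \<nu>) auto
  show ?thesis
    using derivative_ideal.omega3_graded_isomorphic[OF derivative_ideal_MI[of \<mu>]]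
      derivative_ideal.omega3_hilbert_function[OF derivative_ideal_MI[of \<mu>]]
    by (simp add: L fat_ideal_eq \<nu> MI_def)
qed

end
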